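(* Let $(X,\mu)$ be an atomless probability space and let $R$ be an ergodic measured equivalence relation of type $\mathrm{II}_1$ on $(X,\mu)$. If the cost $C(R)$ is finite, then $$C(R)=1+\frac12\,h(R),$$ where $h(R)$ denotes the isoperimetric constant of $R$.
   Context: Conventions. Probability spaces are standard Borel, and statements hold up to $\mu$-null sets. An ergodic measured equivalence relation of type $\mathrm{II}_1$ on the atomless probability space $(X,\mu)$ is a Borel equivalence relation $R\subset X\times X$ with countable classes that preserves $\mu$ (every partial Borel isomorphism of $X$ whose graph is contained in $R$ preserves $\mu$) and is ergodic (every $R$-saturated Borel set has measure $0$ or $1$); its classes are then almost surely infinite. For $x\in X$ write $R^x=\{(x,y)\in R\}$. The measure on $R$ is $E\mapsto\int_X |E\cap R^x|\,d\mu(x)$. Generating systems and cost. A partial isomorphism of $R$ is a Borel isomorphism $\varphi:\operatorname{dom}\varphi\to\operatorname{Im}\varphi$ between Borel subsets of $X$ with $(x,\varphi(x))\in R$ for all $x\in\operatorname{dom}\varphi$. The cost of a countable family $\Phi$ of partial isomorphisms of $R$ is $C(\Phi)=\sum_{\varphi\in\Phi}\mu(\operatorname{dom}\varphi)\in[0,\infty]$. The family $\Phi$ is a generating system (graphing) of $R$ if, almost surely, for any two $R$-equivalent points $x,y\in X$ there are $\varphi_1,\dots,\varphi_n\in\Phi$ and $\varepsilon_1,\dots,\varepsilon_n\in\{-1,1\}$ with $\varphi_n^{\varepsilon_n}\cdots\varphi_1^{\varepsilon_1}(x)=y$. The cost of $R$ is $C(R)=\inf_\Phi C(\Phi)$,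 the infimum being over all generating systems $\Phi$ of $R$. Cayley graph. For a generating system $\Phi$, the Cayley graph $\Sigma_\Phi$ is the field of graphs $(\Sigma_\Phi^x)_{x\in X}$, where $\Sigma_\Phi^x$ is the graph with vertex set $R^x$ and whose edges are the pairs $\big((x,y),(x,\varphi(y))\big)$ with $\varphi\in\Phi$, $y\in\operatorname{dom}\varphi$ and $(x,y)\in R$ (each joining its two endpoints). Isoperimetric constant. A symmetric vertex of $\Sigma_\Phi$ is an element $\varphi$ of the full group of $R$, i.e. a Borel automorphism of $X$ whose graph is contained in $R$; it is identified with its graph $\{(x,\varphi(x)):x\in X\}\subset R$. Two symmetric vertices are disjoint if the intersection of their graphs is null for the measure on $R$, i.e. $\mu(\{x:\varphi(x)=\psi(x)\})=0$. For a nonempty finite set $A$ of pairwise disjoint symmetric vertices, put $A^x=\{(x,\varphi(x)):\varphi\in A\}\subset R^x$. The boundary $\partial_{\Sigma_\Phi}A$ is the set of edges of $\Sigma_\Phi$ having exactly one endpoint in $A$ (in the graph of an automorphism of $A$); its fibre over $x$ is the set $\partial_{\Sigma_\Phi^x}A^x$ of edges of $\Sigma_\Phi^x$ with exactly one endpoint in $A^x$. Its measure is $\nu^{(1)}(\partial_{\Sigma_\Phi}A)=\int_X|\partial_{\Sigma_\Phi^x}A^x|\,d\mu(x)$. Define $$h(\Sigma_\Phi)=\inf_A\frac{\nu^{(1)}(\partial_{\Sigma_\Phi}A)}{|A|},$$ the infimum being over all nonempty finite sets $A$ of pairwise disjoint symmetric vertices of $\Sigma_\Phi$, with $|A|$ the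 number of automorphisms in $A$. The isoperimetric constant of $R$ is $h(R)=\inf_\Phi h(\Sigma_\Phi)\in[0,\infty]$, the infimum being over all generating systems $\Phi$ of $R$. *)

theory Defs
  imports "HOL-Probability.Probability"
begin

definition standard_borel :: "'a measure \<Rightarrow> bool" where
  "standard_borel M \<longleftrightarrow>
     (\<exists>T. completely_metrizable_space T \<and> second_countable T \<and>
          space M = topspace T \<and> sets M = sigma_sets (topspace T) {U. openin T U})"

definition atomless :: "'a measure \<Rightarrow> bool" where
  "atomless M \<longleftrightarrow>
     (\<forall>A\<in>sets M. emeasure M A > 0 \<longrightarrow>
        (\<exists>B\<in>sets M. B \<subseteq> A \<and> 0 < emeasure M B \<and> emeasure M B < emeasure M A))"

text \<open>
  Partial transformations are partial functions \<^typ>\<open>'a \<Rightarrow> 'a option\<close>, so that they are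
  determined by their graph.
\<close>

definition partial_borel_iso :: "'a measure \<Rightarrow> ('a \<rightharpoonup> 'a) \<Rightarrow> bool" where
  "partial_borel_iso M \<phi> \<longleftrightarrow>
     dom \<phi> \<in> sets M \<and> ran \<phi> \<in> sets M \<and>
     bij_betw (\<lambda>x. the (\<phi> x)) (dom \<phi>) (ran \<phi>) \<and>
     (\<lambda>x. the (\<phi> x)) \<in> measurable (restrict_space M (dom \<phi>)) (restrict_space M (ran \<phi>)) \<and>
     inv_into (dom \<phi>) (\<lambda>x. the (\<phi> x))
       \<in> measurable (restrict_space M (ran \<phi>)) (restrict_space M (dom \<phi>))"

definition partial_isos :: "'a measure \<Rightarrow> ('a \<times> 'a) set \<Rightarrow> ('a \<rightharpoonup> 'a) set" where
  "partial_isos M R = {\<phi>. partial_borel_iso M \<phi> \<and> Map.graph \<phi> \<subseteq> R}"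

definition preserves_measure :: "'a measure \<Rightarrow> ('a \<times> 'a) set \<Rightarrow> bool" where
  "preserves_measure M R \<longleftrightarrow>
     (\<forall>\<phi>\<in>partial_isos M R. \<forall>B\<in>sets M. B \<subseteq> dom \<phi> \<longrightarrow>
        emeasure M ((\<lambda>x. the (\<phi> x)) ` B) = emeasure M B)"

definition ergodic_rel :: "'a measure \<Rightarrow> ('a \<times> 'a) set \<Rightarrow> bool" where
  "ergodic_rel M R \<longleftrightarrow>
     (\<forall>B\<in>sets M. R `` B = B \<longrightarrow> emeasure M B = 0 \<or> emeasure M B = 1)"

definition ergodic_II1_rel :: "'a measure \<Rightarrow> ('a \<times> 'a) set \<Rightarrow> bool" where
  "ergodic_II1_rel M R \<longleftrightarrow>
     equiv (space M) R \<and> R \<in> sets (M \<Otimes>\<^sub>M M) \<and>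
     (\<forall>x\<in>space M. countable (R `` {x})) \<and>
     preserves_measure M R \<and> ergodic_rel M R"

definition fibre :: "('a \<times> 'a) set \<Rightarrow> 'a \<Rightarrow> ('a \<times> 'a) set" where
  "fibre E x = {p\<in>E. fst p = x}"

definition rel_measure :: "'a measure \<Rightarrow> ('a \<times> 'a) set \<Rightarrow> ('a \<times> 'a) set \<Rightarrow> ennreal" where
  "rel_measure M R E = (\<integral>\<^sup>+ x. emeasure (count_space UNIV) (E \<inter> fibre R x) \<partial>M)"

text \<open>
  The words \<open>\<phi>\<^sub>n\<^bsup>\<epsilon>\<^sub>n\<^esup> \<cdots> \<phi>\<^sub>1\<^bsup>\<epsilon>\<^sub>1\<^esup>\<close> taking \<open>x\<close> to \<open>y\<close> are the paths from \<open>x\<close> to \<open>y\<close> whose steps lie in the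
  graph of some \<open>\<phi> \<in> \<Phi>\<close> or in its converse.
\<close>

definition generating_system :: "'a measure \<Rightarrow> ('a \<times> 'a) set \<Rightarrow> ('a \<rightharpoonup> 'a) set \<Rightarrow> bool" where
  "generating_system M R \<Phi> \<longleftrightarrow>
     countable \<Phi> \<and> \<Phi> \<subseteq> partial_isos M R \<and>
     (AE x in M. \<forall>y. (x, y) \<in> R \<longrightarrow>
        (x, y) \<in> (\<Union>\<phi>\<in>\<Phi>. Map.graph \<phi> \<union> (Map.graph \<phi>)\<inverse>)\<^sup>*)"

definition system_cost :: "'a measure \<Rightarrow> ('a \<rightharpoonup> 'a) set \<Rightarrow> ennreal" where
  "system_cost M \<Phi> = (\<integral>\<^sup>+ \<phi>. emeasure M (dom \<phi>) \<partial>count_space \<Phi>)"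

definition cost :: "'a measure \<Rightarrow> ('a \<times> 'a) set \<Rightarrow> ennreal" where
  "cost M R = (INF \<Phi>\<in>{\<Phi>. generating_system M R \<Phi>}. system_cost M \<Phi>)"

text \<open>
  An edge is the ordered pair of its endpoints; the edges over \<open>x\<close> form a set of such pairs, so a pair
  produced by several elements of \<open>\<Phi>\<close> is a single edge.
\<close>

definition cayley_edges ::
    "('a \<times> 'a) set \<Rightarrow> ('a \<rightharpoonup> 'a) set \<Rightarrow> 'a \<Rightarrow> (('a \<times> 'a) \<times> ('a \<times> 'a)) set" where
  "cayley_edges R \<Phi> x =
     {((x, y), (x, z)) | y z. (x, y) \<in> R \<and> (\<exists>\<phi>\<in>\<Phi>. (y, z) \<in> Map.graph \<phi>)}"

definition edge_boundary :: "('v \<times> 'v) set \<Rightarrow> 'v set \<Rightarrow> ('v \<times> 'v) set" where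
  "edge_boundary E V = {e\<in>E. (fst e \<in> V) \<noteq> (snd e \<in> V)}"

definition full_group :: "'a measure \<Rightarrow> ('a \<times> 'a) set \<Rightarrow> ('a \<rightharpoonup> 'a) set" where
  "full_group M R = {\<phi>\<in>partial_isos M R. dom \<phi> = space M \<and> ran \<phi> = space M}"

definition disjoint_vertices ::
    "'a measure \<Rightarrow> ('a \<times> 'a) set \<Rightarrow> ('a \<rightharpoonup> 'a) \<Rightarrow> ('a \<rightharpoonup> 'a) \<Rightarrow> bool" where
  "disjoint_vertices M R \<phi> \<psi> \<longleftrightarrow> rel_measure M R (Map.graph \<phi> \<inter> Map.graph \<psi>) = 0"

definition vertex_sets :: "'a measure \<Rightarrow> ('a \<times> 'a) set \<Rightarrow> ('a \<rightharpoonup> 'a) set set" where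
  "vertex_sets M R =
     {A. finite A \<and> A \<noteq> {} \<and> A \<subseteq> full_group M R \<and> pairwise (disjoint_vertices M R) A}"

definition boundary_measure ::
    "'a measure \<Rightarrow> ('a \<times> 'a) set \<Rightarrow> ('a \<rightharpoonup> 'a) set \<Rightarrow> ('a \<rightharpoonup> 'a) set \<Rightarrow> ennreal" where
  "boundary_measure M R \<Phi> A =
     (\<integral>\<^sup>+ x. emeasure (count_space UNIV)
               (edge_boundary (cayley_edges R \<Phi> x) (\<Union>\<phi>\<in>A. fibre (Map.graph \<phi>) x)) \<partial>M)"

definition graph_isoperimetric ::
    "'a measure \<Rightarrow> ('a \<times> 'a) set \<Rightarrow> ('a \<rightharpoonup> 'a) set \<Rightarrow> ennreal" where
  "graph_isoperimetric M R \<Phi> =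
     (INF A\<in>vertex_sets M R. boundary_measure M R \<Phi> A / of_nat (card A))"

definition isoperimetric_constant :: "'a measure \<Rightarrow> ('a \<times> 'a) set \<Rightarrow> ennreal" where
  "isoperimetric_constant M R =
     (INF \<Phi>\<in>{\<Phi>. generating_system M R \<Phi>}. graph_isoperimetric M R \<Phi>)"

end

theory Submission
  imports Defs
begin

text \<open>
  Upper bound for the cost. Given a generating system with edge set \<open>F\<close> and \<open>A = {\<phi>\<^sub>1, \<dots>, \<phi>\<^sub>n}\<close>, put
  \<open>A\<^sub>x = {\<phi>\<^sub>1 x, \<dots>, \<phi>\<^sub>n x}\<close>. Colour the points of \<open>X\<close> by integers so that the colours on each \<open>A\<^sub>x\<close> are
  distinct, label an edge by the pair of colours of its endpoints, and keep an edge only if its endpoints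
  cannot be joined by edges of smaller label. As labels are integers, the remaining edges \<open>F'\<close> still
  generate, and as labels are distinct on \<open>A\<^sub>x\<close> they form a forest there (Kruskal), so that there are fewer
  than \<open>n\<close> of them inside \<open>A\<^sub>x\<close>. Summing the degrees of \<open>F'\<close> over \<open>A\<^sub>x\<close> and integrating, with each \<open>\<phi>\<^sub>i\<close>
  measure preserving, gives \<open>2 n C \<le> 2 n + \<nu>(\<partial>A)\<close>.

  Lower bound. Partition \<open>X\<close> into \<open>N\<close> sets of measure \<open>1/N\<close> and let partial isomorphisms \<open>\<theta>\<^sub>i\<close> identify the
  first one, \<open>Y\<close>, with the others. Contracting a spanning forest rooted in \<open>Y\<close> turns a generating system of
  cost \<open>c\<close> into a system \<open>\<Psi>\<close> of cost at most \<open>c - (1 - 1/N)\<close> that together with the \<open>\<theta>\<^sub>i\<close> generates. The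
  automorphisms permuting the \<open>N\<close> pieces cyclically form a set \<open>A\<close> whose \<open>A\<^sub>x\<close> have no \<open>\<theta>\<^sub>i\<close>-edge in their
  boundary, so \<open>\<nu>(\<partial>A) \<le> 2 N (c - (1 - 1/N))\<close>, and \<open>N\<close> is arbitrary.
\<close>

section \<open>Partial Borel isomorphisms\<close>

text \<open>The summand 1 is the price of a spanning forest, seen from two sides: a forest on n
  points has degree sum below 2n, and contracting onto \<open>Y\<close> saves one edge at almost
  every point outside \<open>Y\<close>. The factor 1/2 arises because a degree sum meets every edge
  at both ends. The main obstacle is Borel measurability. No projection of a Borel set is taken:
  edge relations lie in countable unions of graphs of partial isomorphisms, and choices (of a
  parent, of a path) take the least index in such a list. Nor can the edges of an uncountable space
  be labelled injectively by integers, while a well-founded label is needed to show that discarded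
  edges stay connected. Labels that are injective on each A_x alone reconcile the two demands, at
  the price that F' need not be acyclic globally. In the other direction, adding the transports
  \<theta> may raise the cost of the system but adds nothing to the boundary of A, and the
  isoperimetric constant sees only the boundary.\<close>

declare [[simproc del: measurable]]

text \<open>Extended by the identity, so that \<open>tot \<phi>\<close> is measurable on the whole space.\<close>

definition tot :: "('a \<rightharpoonup> 'a) \<Rightarrow> 'a \<Rightarrow> 'a" where
  "tot \<phi> x = (case \<phi> x of None \<Rightarrow> x | Some y \<Rightarrow> y)"

definition pinv :: "('a \<rightharpoonup> 'a) \<Rightarrow> ('a \<rightharpoonup> 'a)" where
  "pinv \<phi> y = (if \<exists>x. \<phi> x = Some y then Some (SOME x. \<phi> x = Some y) else None)"

definition pinj :: "('a \<rightharpoonup> 'a) \<Rightarrow> bool" where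
  "pinj \<phi> \<longleftrightarrow> (\<forall>x x' y. \<phi> x = Some y \<longrightarrow> \<phi> x' = Some y \<longrightarrow> x = x')"

lemma graph_iff: "(x, y) \<in> Map.graph \<phi> \<longleftrightarrow> \<phi> x = Some y"
  by (auto simp: Map.graph_def)

lemma tot_Some: "\<phi> x = Some y \<Longrightarrow> tot \<phi> x = y"
  by (simp add: tot_def)

lemma dom_tot: "x \<in> dom \<phi> \<Longrightarrow> \<phi> x = Some (tot \<phi> x)"
  by (auto simp: tot_def)

lemma pinv_iff:
  assumes "pinj \<phi>" shows "pinv \<phi> y = Some x \<longleftrightarrow> \<phi> x = Some y"
proof (cases "\<exists>x. \<phi> x = Some y")
  case True
  then have "\<phi> (SOME x. \<phi> x = Some y) = Some y" by (rule someI_ex)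
  then show ?thesis using assms True unfolding pinv_def pinj_def by auto
qed (simp add: pinv_def)

lemma dom_pinv: "dom (pinv \<phi>) = ran \<phi>"
  by (auto simp: pinv_def ran_def split: if_splits)

lemma ran_pinv: "pinj \<phi> \<Longrightarrow> ran (pinv \<phi>) = dom \<phi>"
  by (auto simp: ran_def pinv_iff)

lemma pinj_pinv: "pinj \<phi> \<Longrightarrow> pinj (pinv \<phi>)"
  by (simp add: pinj_def pinv_iff)

lemma pinv_pinv:
  assumes "pinj \<phi>" shows "pinv (pinv \<phi>) = \<phi>"
proof
  have "pinv (pinv \<phi>) x = Some y \<longleftrightarrow> \<phi> x = Some y" for x y
    using assms by (simp add: pinv_iff pinj_pinv)
  then show "pinv (pinv \<phi>) x = \<phi> x" for x by (metis not_Some_eq)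
qed

lemma graph_pinv: "pinj \<phi> \<Longrightarrow> Map.graph (pinv \<phi>) = (Map.graph \<phi>)\<inverse>"
  by (auto simp: graph_iff pinv_iff)

lemma tot_image:
  assumes "D \<subseteq> dom \<phi>" shows "tot \<phi> ` D = {y. \<exists>x\<in>D. \<phi> x = Some y}"
proof -
  have "y = tot \<phi> x \<longleftrightarrow> \<phi> x = Some y" if "x \<in> D" for x y
    by (metis assms that dom_tot option.inject subsetD)
  then show ?thesis by (simp add: image_def cong: bex_cong)
qed

lemma tot_measurable_iff:
  assumes "dom \<phi> \<in> sets M"
  shows "tot \<phi> \<in> measurable M M \<longleftrightarrow>
    (\<lambda>x. the (\<phi> x)) \<in> measurable (restrict_space M (dom \<phi>)) M"
proof -
  have eq: "tot \<phi> = (\<lambda>x. if x \<in> dom \<phi> then the (\<phi> x) else x)"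
    by (auto simp: tot_def fun_eq_iff split: option.splits)
  have "{x \<in> space M. x \<in> dom \<phi>} = dom \<phi>"
    using sets.sets_into_space[OF assms] by auto
  then have "{x \<in> space M. x \<in> dom \<phi>} \<in> sets M" using assms by simp
  moreover have "(\<lambda>x. x) \<in> measurable (restrict_space M {x. x \<notin> dom \<phi>}) M"
    by (intro measurable_restrict_space1 measurable_ident_sets refl)
  ultimately show ?thesis unfolding eq
    by (subst measurable_If_restrict_space_iff) auto
qed

text \<open>Total functions free the later measurability proofs from restricted spaces; extending by
  the identity on a measurable complement changes nothing.\<close>

lemma partial_borel_iso_iff:
  "partial_borel_iso M \<phi> \<longleftrightarrow> dom \<phi> \<in> sets M \<and> ran \<phi> \<in> sets M \<and> pinj \<phi> \<and>
     tot \<phi> \<in> measurable M M \<and> tot (pinv \<phi>) \<in> measurable M M"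
proof (cases "dom \<phi> \<in> sets M \<and> ran \<phi> \<in> sets M")
  case True
  then have sp: "dom \<phi> \<subseteq> space M" "ran \<phi> \<subseteq> space M"
    using sets.sets_into_space by auto
  have bij: "bij_betw (\<lambda>x. the (\<phi> x)) (dom \<phi>) (ran \<phi>) \<longleftrightarrow> pinj \<phi>"
  proof -
    have "(\<lambda>x. the (\<phi> x)) ` dom \<phi> = ran \<phi>"
      by (force simp: ran_def image_iff)
    moreover have "inj_on (\<lambda>x. the (\<phi> x)) (dom \<phi>) \<longleftrightarrow> pinj \<phi>"
      unfolding inj_on_def pinj_def by (fastforce simp: dom_def)
    ultimately show ?thesis by (simp add: bij_betw_def)
  qed
  have inv: "inv_into (dom \<phi>) (\<lambda>x. the (\<phi> x)) y = the (pinv \<phi> y)"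
    if "pinj \<phi>" "y \<in> ran \<phi>" for y
  proof -
    from that obtain x where x: "\<phi> x = Some y" by (auto simp: ran_def)
    have "inv_into (dom \<phi>) (\<lambda>x. the (\<phi> x)) ((\<lambda>x. the (\<phi> x)) x) = x"
      by (rule inv_into_f_f) (use that bij x in \<open>auto simp: bij_betw_def\<close>)
    then show ?thesis using x that by (simp add: pinv_iff[THEN iffD2])
  qed
  have "(\<lambda>x. the (\<phi> x)) \<in> measurable (restrict_space M (dom \<phi>)) (restrict_space M (ran \<phi>))
     \<longleftrightarrow> tot \<phi> \<in> measurable M M"
    using True sp by (subst measurable_restrict_space2_iff)
      (auto simp: tot_measurable_iff space_restrict_space ran_def)
  moreover have "inv_into (dom \<phi>) (\<lambda>x. the (\<phi> x))
       \<in> measurable (restrict_space M (ran \<phi>)) (restrict_space M (dom \<phi>))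
     \<longleftrightarrow> tot (pinv \<phi>) \<in> measurable M M" if "pinj \<phi>"
  proof -
    have "the (pinv \<phi> y) \<in> dom \<phi>" if "y \<in> ran \<phi>" for y
      using \<open>pinj \<phi>\<close> that
      by (metis domI dom_pinv domIff option.exhaust_sel pinv_iff)
    moreover have "inv_into (dom \<phi>) (\<lambda>x. the (\<phi> x)) \<in> measurable (restrict_space M (ran \<phi>)) M \<longleftrightarrow>
        (\<lambda>y. the (pinv \<phi> y)) \<in> measurable (restrict_space M (ran \<phi>)) M"
      using inv[OF that] by (intro measurable_cong) (auto simp: space_restrict_space)
    ultimately show ?thesis
      using True sp that inv[OF that] by (subst measurable_restrict_space2_iff)
        (auto simp: tot_measurable_iff dom_pinv space_restrict_space)
  qed
  ultimately show ?thesis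
    unfolding partial_borel_iso_def using True bij by auto
qed (auto simp: partial_borel_iso_def)

text \<open>Exhibiting the inverse \<open>\<psi>\<close> by a symmetric equation yields injectivity
  and the range at once, so that only domains and total extensions have to be measured.\<close>

lemma partial_borel_isoI:
  assumes "\<And>x y. \<phi> x = Some y \<longleftrightarrow> \<psi> y = Some x"
    and "dom \<phi> \<in> sets M" "dom \<psi> \<in> sets M"
    and "tot \<phi> \<in> measurable M M" "tot \<psi> \<in> measurable M M"
  shows "partial_borel_iso M \<phi>"
proof -
  have inj: "pinj \<phi>" by (metis assms(1) option.inject pinj_def)
  have "pinv \<phi> = \<psi>"
    by (rule ext) (metis assms(1) inj not_Some_eq pinv_iff)
  then show ?thesis
    unfolding partial_borel_iso_iff using assms(2-5) inj dom_pinv[of \<phi>] by simp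
qed

context
  fixes M :: "'a measure" and \<phi> :: "'a \<rightharpoonup> 'a"
  assumes iso: "partial_borel_iso M \<phi>"
begin

lemma iso_dom: "dom \<phi> \<in> sets M" and iso_ran: "ran \<phi> \<in> sets M" and iso_inj: "pinj \<phi>"
  and iso_tot: "tot \<phi> \<in> measurable M M" and iso_tot_pinv: "tot (pinv \<phi>) \<in> measurable M M"
  using iso by (auto simp: partial_borel_iso_iff)

lemma iso_pinv: "partial_borel_iso M (pinv \<phi>)"
  unfolding partial_borel_iso_iff
  by (simp add: dom_pinv ran_pinv iso_dom iso_ran iso_inj iso_tot iso_tot_pinv pinj_pinv pinv_pinv)

lemma iso_pre:
  assumes "B \<in> sets M"
  shows "{x \<in> dom \<phi>. tot \<phi> x \<in> B} \<in> sets M"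
proof -
  have "{x \<in> dom \<phi>. tot \<phi> x \<in> B} = dom \<phi> \<inter> (tot \<phi> -` B \<inter> space M)"
    using sets.sets_into_space[OF iso_dom] by auto
  then show ?thesis using iso_dom measurable_sets[OF iso_tot assms] by auto
qed

text \<open>The image is the preimage under the inverse, which makes it measurable.\<close>

lemma iso_image:
  assumes "D \<in> sets M" "D \<subseteq> dom \<phi>"
  shows "tot \<phi> ` D \<in> sets M"
proof -
  have "tot \<phi> ` D = {y \<in> ran \<phi>. tot (pinv \<phi>) y \<in> D}"
    using assms(2) iso_inj by (auto simp: tot_image pinv_iff[THEN iffD2] tot_Some ran_def)
  moreover have "{y \<in> dom (pinv \<phi>). tot (pinv \<phi>) y \<in> D} \<in> sets M"
  proof -
    have "{y \<in> dom (pinv \<phi>). tot (pinv \<phi>) y \<in> D} =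
        dom (pinv \<phi>) \<inter> (tot (pinv \<phi>) -` D \<inter> space M)"
      using sets.sets_into_space[OF iso_ran] by (auto simp: dom_pinv)
    then show ?thesis using iso_ran measurable_sets[OF iso_tot_pinv assms(1)]
      by (auto simp: dom_pinv)
  qed
  ultimately show ?thesis by (simp add: dom_pinv)
qed

end

lemma tot_restrict: "tot (\<phi> |` D) = (\<lambda>x. if x \<in> D then tot \<phi> x else x)"
  by (auto simp: tot_def restrict_map_def)

lemma iso_restrict:
  assumes "partial_borel_iso M \<phi>" "D \<in> sets M"
  shows "partial_borel_iso M (\<phi> |` D)"
proof (rule partial_borel_isoI)
  let ?E = "{y \<in> dom (pinv \<phi>). tot (pinv \<phi>) y \<in> D}"
  note inj = iso_inj[OF assms(1)]
  have E: "?E \<in> sets M" by (rule iso_pre[OF iso_pinv[OF assms(1)] assms(2)])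
  show "(\<phi> |` D) x = Some y \<longleftrightarrow> (pinv \<phi> |` ?E) y = Some x" for x y
  proof -
    have "(pinv \<phi> |` ?E) y = Some x \<longleftrightarrow> pinv \<phi> y = Some x \<and> tot (pinv \<phi>) y \<in> D"
      by (auto simp: restrict_map_def)
    also have "\<dots> \<longleftrightarrow> pinv \<phi> y = Some x \<and> x \<in> D"
      by (auto simp: tot_Some)
    finally show ?thesis by (auto simp: pinv_iff[OF inj] restrict_map_def)
  qed
  have sp: "D \<inter> space M \<in> sets M" "?E \<inter> space M \<in> sets M"
    using assms(2) E by auto
  show "dom (\<phi> |` D) \<in> sets M" using assms(2) iso_dom[OF assms(1)] by auto
  have "dom (pinv \<phi>) \<in> sets M" using iso_dom[OF iso_pinv[OF assms(1)]] .
  then show "dom (pinv \<phi> |` ?E) \<in> sets M" using E by (simp add: sets.Int)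
  show "tot (\<phi> |` D) \<in> measurable M M"
    unfolding tot_restrict
    by (rule measurable_If_set[OF iso_tot[OF assms(1)] measurable_ident sp(1), unfolded id_def])
  show "tot (pinv \<phi> |` ?E) \<in> measurable M M"
    unfolding tot_restrict
    by (rule measurable_If_set[OF iso_tot_pinv[OF assms(1)] measurable_ident sp(2), unfolded id_def])
qed

lemma iso_comp:
  assumes "partial_borel_iso M \<phi>" "partial_borel_iso M \<eta>"
  shows "partial_borel_iso M (\<eta> \<circ>\<^sub>m \<phi>)"
proof (rule partial_borel_isoI)
  have dm: "dom (\<eta> \<circ>\<^sub>m \<phi>) \<in> sets M" and tm: "tot (\<eta> \<circ>\<^sub>m \<phi>) \<in> measurable M M"
    if "partial_borel_iso M \<phi>" "partial_borel_iso M \<eta>" for \<phi> \<eta> :: "'a \<rightharpoonup> 'a"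
  proof -
    have eq: "dom (\<eta> \<circ>\<^sub>m \<phi>) = {x \<in> dom \<phi>. tot \<phi> x \<in> dom \<eta>}"
      by (auto simp: map_comp_def tot_def split: option.splits)
    show *: "dom (\<eta> \<circ>\<^sub>m \<phi>) \<in> sets M"
      unfolding eq by (rule iso_pre[OF that(1) iso_dom[OF that(2)]])
    have "tot (\<eta> \<circ>\<^sub>m \<phi>) = (\<lambda>x. if x \<in> dom (\<eta> \<circ>\<^sub>m \<phi>) then tot \<eta> (tot \<phi> x) else x)"
      by (auto simp: fun_eq_iff tot_def map_comp_def split: option.splits)
    then show "tot (\<eta> \<circ>\<^sub>m \<phi>) \<in> measurable M M"
      using * by (simp only:) (intro measurable_If_set measurable_compose[OF iso_tot iso_tot] measurable_ident_sets that, auto)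
  qed
  note inv = iso_pinv[OF assms(1)] iso_pinv[OF assms(2)]
  show "(\<eta> \<circ>\<^sub>m \<phi>) x = Some y \<longleftrightarrow> (pinv \<phi> \<circ>\<^sub>m pinv \<eta>) y = Some x" for x y
    by (auto simp: map_comp_Some_iff pinv_iff iso_inj[OF assms(1)] iso_inj[OF assms(2)])
  show "dom (\<eta> \<circ>\<^sub>m \<phi>) \<in> sets M" "tot (\<eta> \<circ>\<^sub>m \<phi>) \<in> measurable M M"
    using dm tm assms by auto
  show "dom (pinv \<phi> \<circ>\<^sub>m pinv \<eta>) \<in> sets M" "tot (pinv \<phi> \<circ>\<^sub>m pinv \<eta>) \<in> measurable M M"
    using dm tm inv by auto
qed

lemma iso_id: "partial_borel_iso M (Some |` space M)"
proof (rule partial_borel_isoI)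
  have [simp]: "tot (Some |` space M) = (\<lambda>x. x)"
    by (simp add: fun_eq_iff tot_restrict tot_Some)
  show "tot (Some |` space M) \<in> measurable M M" "tot (Some |` space M) \<in> measurable M M"
    by (simp_all add: measurable_ident_sets)
  have [simp]: "dom (Some |` space M) = space M" by (simp add: dom_def restrict_map_def)
  show "dom (Some |` space M) \<in> sets M" "dom (Some |` space M) \<in> sets M"
    by simp_all
  show "(Some |` space M) x = Some y \<longleftrightarrow> (Some |` space M) y = Some x" for x y
    unfolding restrict_map_def by (cases "x = y") simp_all
qed

lemma iso_empty: "partial_borel_iso M Map.empty"
  using iso_restrict[OF iso_id, of "{}"] by simp

text \<open>On \<open>dom (k n)\<close> the map agrees with \<open>k n\<close>, elsewhere with the
  identity, and countably many such pieces suffice. Overlaps do no harm, as all \<open>k n\<close>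
  agree with \<open>\<phi>\<close>.\<close>

lemma tot_UN_measurable:
  fixes k :: "nat \<Rightarrow> 'a \<rightharpoonup> 'a"
  assumes k: "\<And>n. partial_borel_iso M (k n)"
    and G: "\<And>x y. \<phi> x = Some y \<longleftrightarrow> (\<exists>n. k n x = Some y)"
  shows "dom \<phi> \<in> sets M" "tot \<phi> \<in> measurable M M"
proof -
  have "dom \<phi> = (\<Union>n. dom (k n))"
    unfolding dom_def using G by (auto simp del: not_None_eq) (metis not_Some_eq option.distinct(1))+
  then show dm: "dom \<phi> \<in> sets M" using iso_dom[OF k] by auto
  let ?C = "insert (- dom \<phi>) (range (\<lambda>n. dom (k n)))"
  show "tot \<phi> \<in> measurable M M"
  proof (rule measurable_piecewise_restrict[of ?C])
    show "countable ?C" by simp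
    show "\<Omega> \<inter> space M \<in> sets M" if "\<Omega> \<in> ?C" for \<Omega>
    proof -
      have "- dom \<phi> \<inter> space M = space M - dom \<phi>" by auto
      then show ?thesis using that iso_dom[OF k] dm by auto
    qed
    show "space M \<subseteq> \<Union>?C" using \<open>dom \<phi> = (\<Union>n. dom (k n))\<close> by auto
    fix \<Omega> assume "\<Omega> \<in> ?C"
    then consider "\<Omega> = - dom \<phi>" | n where "\<Omega> = dom (k n)" by auto
    then show "tot \<phi> \<in> measurable (restrict_space M \<Omega>) M"
    proof cases
      case 1
      have "tot \<phi> \<in> measurable (restrict_space M \<Omega>) M \<longleftrightarrow> (\<lambda>x. x) \<in> measurable (restrict_space M \<Omega>) M"
        by (rule measurable_cong) (auto simp: 1 space_restrict_space tot_def split: option.splits)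
      then show ?thesis by (simp add: measurable_restrict_space1 measurable_ident_sets)
    next
      case (2 n)
      have "tot \<phi> \<in> measurable (restrict_space M \<Omega>) M \<longleftrightarrow> tot (k n) \<in> measurable (restrict_space M \<Omega>) M"
      proof (rule measurable_cong)
        fix x assume "x \<in> space (restrict_space M \<Omega>)"
        then obtain y where "k n x = Some y" by (auto simp: 2 space_restrict_space)
        then show "tot \<phi> x = tot (k n) x" using G by (metis tot_Some)
      qed
      then show ?thesis using iso_tot[OF k] by (simp add: measurable_restrict_space1)
    qed
  qed
qed

text \<open>Disjoint domains make the union of the graphs a function, and disjoint ranges do the
  same for the converse, which is then the inverse.\<close>

lemma iso_glue:
  fixes k :: "nat \<Rightarrow> 'a \<rightharpoonup> 'a"
  assumes k: "\<And>n. partial_borel_iso M (k n)"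
    and d: "\<And>m n. m \<noteq> n \<Longrightarrow> dom (k m) \<inter> dom (k n) = {}"
    and r: "\<And>m n. m \<noteq> n \<Longrightarrow> ran (k m) \<inter> ran (k n) = {}"
  obtains \<phi> where "partial_borel_iso M \<phi>" "\<And>x y. \<phi> x = Some y \<longleftrightarrow> (\<exists>n. k n x = Some y)"
proof -
  have glue: "\<exists>\<phi>. \<forall>x y. \<phi> x = Some y \<longleftrightarrow> (\<exists>n. k n x = Some y)"
    if d: "\<And>m n. m \<noteq> n \<Longrightarrow> dom (k m) \<inter> dom (k n) = {}" for k :: "nat \<Rightarrow> 'a \<rightharpoonup> 'a"
  proof
    have u: "y = z" if "k n x = Some y" "k m x = Some z" for n m x y z
      using that d[of m n] by (cases "m = n") auto
    have "(if \<exists>n. x \<in> dom (k n) then k (SOME n. x \<in> dom (k n)) x else None) = Some y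
       \<longleftrightarrow> (\<exists>n. k n x = Some y)" (is "?l = _ \<longleftrightarrow> _") for x y
    proof (cases "\<exists>n. x \<in> dom (k n)")
      case True
      then have "x \<in> dom (k (SOME n. x \<in> dom (k n)))" by (rule someI_ex)
      then have "?l = Some (tot (k (SOME n. x \<in> dom (k n))) x)" using True dom_tot by metis
      moreover have "k (SOME n. x \<in> dom (k n)) x = Some (tot (k (SOME n. x \<in> dom (k n))) x)"
        using \<open>x \<in> dom (k (SOME n. x \<in> dom (k n)))\<close> dom_tot by metis
      ultimately show ?thesis by (metis option.inject u)
    qed auto
    then show "\<forall>x y. (if \<exists>n. x \<in> dom (k n) then k (SOME n. x \<in> dom (k n)) x else None) = Some y
       \<longleftrightarrow> (\<exists>n. k n x = Some y)" by blast
  qed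
  from glue[of k, OF d] obtain \<phi>
    where \<phi>': "\<forall>x y. \<phi> x = Some y \<longleftrightarrow> (\<exists>n. k n x = Some y)" by (rule exE)
  then have \<phi>: "\<And>x y. \<phi> x = Some y \<longleftrightarrow> (\<exists>n. k n x = Some y)" by (elim allE)
  have "dom (pinv (k m)) \<inter> dom (pinv (k n)) = {}" if "m \<noteq> n" for m n
    unfolding dom_pinv by (rule r[OF that])
  from glue[of "\<lambda>n. pinv (k n)", OF this]
  obtain \<psi> where "\<forall>x y. \<psi> x = Some y \<longleftrightarrow> (\<exists>n. pinv (k n) x = Some y)" by (rule exE)
  then have \<psi>: "\<And>x y. \<psi> x = Some y \<longleftrightarrow> (\<exists>n. pinv (k n) x = Some y)" by (elim allE)
  have "partial_borel_iso M \<phi>"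
  proof (rule partial_borel_isoI)
    show "\<phi> x = Some y \<longleftrightarrow> \<psi> y = Some x" for x y
      unfolding \<phi> \<psi> by (simp add: pinv_iff iso_inj[OF k])
    show "dom \<phi> \<in> sets M" "tot \<phi> \<in> measurable M M"
      by (rule tot_UN_measurable[of M k, OF k \<phi>]; assumption?)+
    show "dom \<psi> \<in> sets M" "tot \<psi> \<in> measurable M M"
      by (rule tot_UN_measurable[of M "\<lambda>n. pinv (k n)", OF iso_pinv[OF k] \<psi>]; assumption?)+
  qed
  then show thesis using \<phi> by (rule that[of \<phi>])
qed

section \<open>Measure preserving relations\<close>

definition sym_graph :: "(nat \<Rightarrow> 'a \<rightharpoonup> 'a) \<Rightarrow> ('a \<times> 'a) set" where
  "sym_graph e = (\<Union>n. Map.graph (e n) \<union> (Map.graph (e n))\<inverse>)"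

text \<open>Even indices carry the maps, odd ones their inverses, so a step in either direction
  along \<open>sym_graph e\<close> is a step of a single sequence. The parity later tells in which
  direction a parent edge traverses \<open>e n\<close>.\<close>

definition interleave_inverses :: "(nat \<Rightarrow> 'a \<rightharpoonup> 'a) \<Rightarrow> nat \<Rightarrow> 'a \<rightharpoonup> 'a" where
  "interleave_inverses e n = (if even n then e (n div 2) else pinv (e (n div 2)))"

lemma sym_sym_graph: "sym (sym_graph e)"
  by (auto simp: sym_graph_def sym_def)

lemma interleave_even: "interleave_inverses e (2 * n) = e n"
  and interleave_odd: "interleave_inverses e (Suc (2 * n)) = pinv (e n)"
  by (simp_all add: interleave_inverses_def)

lemma sym_graph_interleave:
  assumes "\<And>n. pinj (e n)"
  shows "sym_graph e = (\<Union>n. Map.graph (interleave_inverses e n))"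
proof (intro set_eqI iffI)
  fix p assume "p \<in> sym_graph e"
  then obtain n where "p \<in> Map.graph (e n) \<or> p \<in> Map.graph (pinv (e n))"
    by (auto simp: sym_graph_def graph_pinv[OF assms])
  then show "p \<in> (\<Union>n. Map.graph (interleave_inverses e n))"
    using interleave_even[of e n] interleave_odd[of e n] by (metis UN_I UNIV_I)
next
  fix p assume "p \<in> (\<Union>n. Map.graph (interleave_inverses e n))"
  then obtain n where "p \<in> Map.graph (interleave_inverses e n)" by auto
  then show "p \<in> sym_graph e"
    by (auto simp: sym_graph_def graph_pinv[OF assms] interleave_inverses_def split: if_splits)
qed

text \<open>
  The coordinate \<open>f\<close> exists on every standard Borel space; it makes the diagonal measurable and orders the
  points linearly.
\<close>

locale pmp_rel = prob_space M for M :: "'a measure" +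
  fixes R :: "('a \<times> 'a) set" and f :: "'a \<Rightarrow> real"
  assumes f_measurable: "f \<in> borel_measurable M"
    and f_inj: "inj_on f (space M)"
    and R_equiv: "equiv (space M) R"
    and R_pres: "preserves_measure M R"
begin

lemma R_sub: "R \<subseteq> space M \<times> space M"
  using R_equiv by (auto simp: equiv_def refl_on_def)

lemma R_refl: "x \<in> space M \<Longrightarrow> (x, x) \<in> R"
  using R_equiv by (auto simp: equiv_def refl_on_def)

lemma R_sym: "(x, y) \<in> R \<Longrightarrow> (y, x) \<in> R"
  using R_equiv by (auto simp: equiv_def sym_def)

lemma R_trans: "(x, y) \<in> R \<Longrightarrow> (y, z) \<in> R \<Longrightarrow> (x, z) \<in> R"
  using R_equiv unfolding equiv_def trans_def by blast

lemma eq_set: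
  assumes "g \<in> measurable N M" "h \<in> measurable N M"
  shows "{x \<in> space N. g x = h x} \<in> sets N"
proof -
  have "(\<lambda>x. f (g x)) \<in> borel_measurable N" "(\<lambda>x. f (h x)) \<in> borel_measurable N"
    using assms f_measurable measurable_compose by blast+
  then have "{x \<in> space N. f (g x) = f (h x)} \<in> sets N" by measurable
  moreover have "{x \<in> space N. g x = h x} = {x \<in> space N. f (g x) = f (h x)}"
    using f_inj assms by (auto simp: inj_on_def dest: measurable_space)
  ultimately show ?thesis by simp
qed

lemma pisoD:
  assumes "\<phi> \<in> partial_isos M R"
  shows "partial_borel_iso M \<phi>" "\<phi> x = Some y \<Longrightarrow> (x, y) \<in> R"
  using assms by (auto simp: partial_isos_def graph_iff[symmetric])

lemma pisoI:
  assumes "partial_borel_iso M \<phi>" "\<And>x y. \<phi> x = Some y \<Longrightarrow> (x, y) \<in> R"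
  shows "\<phi> \<in> partial_isos M R"
  using assms by (auto simp: partial_isos_def Map.graph_def)

lemma piso_pinv:
  assumes "\<phi> \<in> partial_isos M R" shows "pinv \<phi> \<in> partial_isos M R"
proof (rule pisoI)
  note iso = pisoD(1)[OF assms]
  show "partial_borel_iso M (pinv \<phi>)" by (rule iso_pinv[OF iso])
  show "(x, y) \<in> R" if "pinv \<phi> x = Some y" for x y
    using that pisoD(2)[OF assms] by (simp add: pinv_iff[OF iso_inj[OF iso]] R_sym)
qed

lemma piso_restrict:
  assumes "\<phi> \<in> partial_isos M R" "D \<in> sets M" shows "\<phi> |` D \<in> partial_isos M R"
proof (rule pisoI)
  show "partial_borel_iso M (\<phi> |` D)" by (rule iso_restrict[OF pisoD(1)[OF assms(1)] assms(2)])
  show "(x, y) \<in> R" if "(\<phi> |` D) x = Some y" for x y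
    using that pisoD(2)[OF assms(1)] by (simp add: restrict_map_def split: if_splits)
qed

lemma piso_comp:
  assumes "\<phi> \<in> partial_isos M R" "\<eta> \<in> partial_isos M R" shows "\<eta> \<circ>\<^sub>m \<phi> \<in> partial_isos M R"
proof (rule pisoI)
  show "partial_borel_iso M (\<eta> \<circ>\<^sub>m \<phi>)" by (rule iso_comp[OF assms[THEN pisoD(1)]])
  show "(x, y) \<in> R" if "(\<eta> \<circ>\<^sub>m \<phi>) x = Some y" for x y
    using that R_trans[OF pisoD(2)[OF assms(1)] pisoD(2)[OF assms(2)]]
    by (auto simp: map_comp_Some_iff)
qed

lemma piso_id: "Some |` space M \<in> partial_isos M R"
  by (intro pisoI iso_id) (auto simp: restrict_map_def R_refl split: if_splits)

lemma piso_empty: "Map.empty \<in> partial_isos M R"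
  by (intro pisoI iso_empty) auto

lemma interleave_piso:
  "(\<And>n. e n \<in> partial_isos M R) \<Longrightarrow> interleave_inverses e n \<in> partial_isos M R"
  by (simp add: interleave_inverses_def piso_pinv)

context
  fixes \<phi> assumes piso: "\<phi> \<in> partial_isos M R"
begin

lemma piso_dom: "dom \<phi> \<in> sets M" and piso_ran: "ran \<phi> \<in> sets M"
  and piso_inj: "pinj \<phi>" and piso_tot: "tot \<phi> \<in> measurable M M"
  using pisoD(1)[OF piso] by (simp_all add: iso_dom iso_ran iso_inj iso_tot)

lemma piso_image_measure:
  assumes "D \<in> sets M" "D \<subseteq> dom \<phi>"
  shows "emeasure M (tot \<phi> ` D) = emeasure M D"
proof -
  have "(\<lambda>x. the (\<phi> x)) ` D = tot \<phi> ` D"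
  proof (intro image_cong refl)
    fix x assume "x \<in> D"
    then have "x \<in> dom \<phi>" using assms by auto
    from dom_tot[OF this] show "the (\<phi> x) = tot \<phi> x" by simp
  qed
  moreover have "emeasure M ((\<lambda>x. the (\<phi> x)) ` D) = emeasure M D"
    using R_pres piso assms unfolding preserves_measure_def by blast
  ultimately show ?thesis by simp
qed

lemma tot_image_dom: "tot \<phi> ` dom \<phi> = ran \<phi>"
  by (auto simp: tot_image ran_def dom_def)

lemma piso_ran_measure: "emeasure M (ran \<phi>) = emeasure M (dom \<phi>)"
  using piso_image_measure[OF piso_dom order.refl] by (simp add: tot_image_dom)

lemma piso_pre_null:
  assumes "N \<in> null_sets M"
  shows "{x \<in> dom \<phi>. tot \<phi> x \<in> N} \<in> null_sets M"
proof -
  let ?D = "{x \<in> dom \<phi>. tot \<phi> x \<in> N}"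
  have D: "?D \<in> sets M" using iso_pre[OF pisoD(1)[OF piso]] assms by blast
  have "emeasure M ?D = emeasure M (tot \<phi> ` ?D)"
    by (rule piso_image_measure[symmetric, OF D]) auto
  also have "\<dots> \<le> emeasure M N"
    using assms by (intro emeasure_mono) auto
  finally show ?thesis using D assms by (simp add: null_sets_def)
qed

lemma graph_measurable: "Map.graph \<phi> \<in> sets (M \<Otimes>\<^sub>M M)"
proof -
  have "(\<lambda>p. tot \<phi> (fst p)) \<in> measurable (M \<Otimes>\<^sub>M M) M"
    by (rule measurable_compose[OF measurable_fst piso_tot])
  from eq_set[OF this measurable_snd]
  have "{p \<in> space (M \<Otimes>\<^sub>M M). tot \<phi> (fst p) = snd p} \<inter> (fst -` dom \<phi> \<inter> space (M \<Otimes>\<^sub>M M))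
      \<in> sets (M \<Otimes>\<^sub>M M)"
    using measurable_sets[OF measurable_fst piso_dom] by (rule sets.Int)
  moreover have "Map.graph \<phi> = {p \<in> space (M \<Otimes>\<^sub>M M). tot \<phi> (fst p) = snd p} \<inter> (fst -` dom \<phi> \<inter> space (M \<Otimes>\<^sub>M M))"
  proof (intro set_eqI iffI)
    fix p assume p: "p \<in> Map.graph \<phi>"
    then have "\<phi> (fst p) = Some (snd p)" by (auto simp: Map.graph_def)
    moreover from pisoD(2)[OF piso this] R_sub have "fst p \<in> space M" "snd p \<in> space M" by auto
    ultimately show "p \<in> {p \<in> space (M \<Otimes>\<^sub>M M). tot \<phi> (fst p) = snd p} \<inter> (fst -` dom \<phi> \<inter> space (M \<Otimes>\<^sub>M M))"
      by (auto simp: tot_Some space_pair_measure mem_Times_iff)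
  next
    fix p assume "p \<in> {p \<in> space (M \<Otimes>\<^sub>M M). tot \<phi> (fst p) = snd p} \<inter> (fst -` dom \<phi> \<inter> space (M \<Otimes>\<^sub>M M))"
    then show "p \<in> Map.graph \<phi>"
      using dom_tot[of "fst p" \<phi>] by (cases p) (auto simp: graph_iff)
  qed
  ultimately show ?thesis by simp
qed

end

lemma full_group_tot:
  assumes "\<phi> \<in> full_group M R"
  shows "\<phi> \<in> partial_isos M R" "x \<in> space M \<Longrightarrow> \<phi> x = Some (tot \<phi> x)"
    "x \<in> space M \<Longrightarrow> tot \<phi> x \<in> space M" "x \<in> space M \<Longrightarrow> tot (pinv \<phi>) (tot \<phi> x) = x"
    "x \<in> space M \<Longrightarrow> (x, tot \<phi> x) \<in> R"
proof -
  show *: "\<phi> \<in> partial_isos M R" using assms by (simp add: full_group_def)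
  show **: "\<phi> x = Some (tot \<phi> x)" if "x \<in> space M"
    using that assms by (intro dom_tot) (auto simp: full_group_def)
  show "tot \<phi> x \<in> space M" if "x \<in> space M"
    using measurable_space[OF piso_tot[OF *] that] .
  show "tot (pinv \<phi>) (tot \<phi> x) = x" if "x \<in> space M"
    using **[OF that] by (intro tot_Some) (simp add: pinv_iff piso_inj[OF *])
  show "(x, tot \<phi> x) \<in> R" if "x \<in> space M" using pisoD(2)[OF * **[OF that]] .
qed

text \<open>Both halves of the theorem average a degree function over A with this identity: every
  automorphism in A contributes the same integral.\<close>

lemma full_group_nn_integral:
  assumes \<phi>: "\<phi> \<in> full_group M R" and g: "g \<in> borel_measurable M"
  shows "(\<integral>\<^sup>+ x. g (tot \<phi> x) \<partial>M) = (\<integral>\<^sup>+ x. g x \<partial>M)"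
proof -
  note p = full_group_tot[OF \<phi>]
  have "distr M M (tot \<phi>) = M"
  proof (rule measure_eqI)
    fix B assume "B \<in> sets (distr M M (tot \<phi>))"
    then have B: "B \<in> sets M" by simp
    have D: "tot \<phi> -` B \<inter> space M \<in> sets M" by (rule measurable_sets[OF piso_tot[OF p(1)] B])
    have "tot \<phi> ` (tot \<phi> -` B \<inter> space M) = B"
    proof
      show "B \<subseteq> tot \<phi> ` (tot \<phi> -` B \<inter> space M)"
      proof
        fix y assume y: "y \<in> B"
        then have "y \<in> ran \<phi>" using \<phi> sets.sets_into_space[OF B] by (auto simp: full_group_def)
        then obtain x where x: "\<phi> x = Some y" by (auto simp: ran_def)
        then have "x \<in> space M" using \<phi> by (auto simp: full_group_def)
        then show "y \<in> tot \<phi> ` (tot \<phi> -` B \<inter> space M)" using x y by (force simp: tot_Some)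
      qed
    qed auto
    moreover have "emeasure M (tot \<phi> ` (tot \<phi> -` B \<inter> space M)) = emeasure M (tot \<phi> -` B \<inter> space M)"
      using \<phi> by (intro piso_image_measure[OF p(1) D]) (auto simp: full_group_def)
    ultimately show "emeasure (distr M M (tot \<phi>)) B = emeasure M B"
      using emeasure_distr[OF piso_tot[OF p(1)] B] by simp
  qed simp
  then show ?thesis using nn_integral_distr[OF piso_tot[OF p(1)], of g] g by simp
qed

lemma sym_graph_measurable:
  assumes "\<And>n. e n \<in> partial_isos M R"
  shows "sym_graph e \<in> sets (M \<Otimes>\<^sub>M M)"
  unfolding sym_graph_interleave[of e, OF piso_inj[OF assms]]
  using graph_measurable[OF interleave_piso[OF assms]] by (intro sets.countable_UN) auto

lemma sym_graph_sub_R: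
  assumes "\<And>n. e n \<in> partial_isos M R"
  shows "sym_graph e \<subseteq> R"
  using pisoD(2)[OF assms] R_sym by (auto simp: sym_graph_def graph_iff)

text \<open>A composition is a projection, which in general leaves the Borel sets. Here the middle
  point is \<open>tot (q n) x\<close> for one of countably many n, so the projection becomes a
  countable union of preimages.\<close>

lemma relcomp_measurable:
  fixes q :: "nat \<Rightarrow> 'a \<rightharpoonup> 'a"
  assumes q: "\<And>n. q n \<in> partial_isos M R"
    and E: "E \<in> sets (M \<Otimes>\<^sub>M M)" "E \<subseteq> (\<Union>n. Map.graph (q n))"
    and E': "E' \<in> sets (M \<Otimes>\<^sub>M M)"
  shows "E O E' \<in> sets (M \<Otimes>\<^sub>M M)"
proof -
  let ?P = "M \<Otimes>\<^sub>M M"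
  define C where "C n = (fst -` dom (q n) \<inter> space ?P)
     \<inter> ((\<lambda>p. (fst p, tot (q n) (fst p))) -` E \<inter> space ?P)
     \<inter> ((\<lambda>p. (tot (q n) (fst p), snd p)) -` E' \<inter> space ?P)" for n
  have t: "(\<lambda>p. tot (q n) (fst p)) \<in> measurable ?P M" for n
    by (rule measurable_compose[OF measurable_fst piso_tot[OF q]])
  have m1: "fst -` dom (q n) \<inter> space ?P \<in> sets ?P" for n
    by (rule measurable_sets[OF measurable_fst piso_dom[OF q]])
  have m2: "(\<lambda>p. (fst p, tot (q n) (fst p))) -` E \<inter> space ?P \<in> sets ?P" for n
    by (rule measurable_sets[OF measurable_Pair[OF measurable_fst t] E(1)])
  have m3: "(\<lambda>p. (tot (q n) (fst p), snd p)) -` E' \<inter> space ?P \<in> sets ?P" for n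
    by (rule measurable_sets[OF measurable_Pair[OF t measurable_snd] E'])
  have "C n \<in> sets ?P" for n
    unfolding C_def by (rule sets.Int[OF sets.Int[OF m1 m2] m3])
  then have "range C \<subseteq> sets ?P" by auto
  then have "(\<Union>n. C n) \<in> sets ?P" using sets.countable_nat_UN[of C ?P] by simp
  moreover have "E O E' = (\<Union>n. C n)"
  proof (intro set_eqI iffI)
    fix p assume "p \<in> E O E'"
    then obtain x y z where p: "p = (x, z)" "(x, y) \<in> E" "(y, z) \<in> E'" by auto
    then obtain n where n: "q n x = Some y" using E(2) by (auto simp: graph_iff)
    have "(x, y) \<in> space ?P" by (rule subsetD[OF sets.sets_into_space[OF E(1)] p(2)])
    moreover have "(y, z) \<in> space ?P" by (rule subsetD[OF sets.sets_into_space[OF E'] p(3)])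
    ultimately have "p \<in> C n" using p n by (auto simp: C_def tot_Some space_pair_measure)
    then show "p \<in> (\<Union>n. C n)" by blast
  next
    fix p assume "p \<in> (\<Union>n. C n)"
    then show "p \<in> E O E'" by (cases p) (auto simp: C_def)
  qed
  ultimately show ?thesis by simp
qed

lemma trancl_measurable:
  fixes q :: "nat \<Rightarrow> 'a \<rightharpoonup> 'a"
  assumes q: "\<And>n. q n \<in> partial_isos M R"
    and E: "E \<in> sets (M \<Otimes>\<^sub>M M)" "E \<subseteq> (\<Union>n. Map.graph (q n))"
  shows "E\<^sup>+ \<in> sets (M \<Otimes>\<^sub>M M)"
proof -
  have "E ^^ Suc n \<in> sets (M \<Otimes>\<^sub>M M)" for n
  proof (induction n)
    case (Suc n)
    have "E ^^ Suc (Suc n) = E O E ^^ Suc n" by (metis relpow_commute relpow.simps(2))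
    then show ?case using relcomp_measurable[OF q E Suc.IH] by simp
  qed (use E in simp)
  then have "(\<Union>n. E ^^ Suc n) \<in> sets (M \<Otimes>\<^sub>M M)" by blast
  moreover have "E\<^sup>+ = (\<Union>n. E ^^ Suc n)"
    by (auto simp: trancl_power simp del: relpow.simps) (metis Suc_pred)
  ultimately show ?thesis by simp
qed

text \<open>A sequence instead of a countable set, with repetitions and empty maps allowed:
  sequences can be interleaved, cut up and summed, and repetitions can only increase the sum of the
  measures of the domains.\<close>

definition gen_seq :: "(nat \<Rightarrow> 'a \<rightharpoonup> 'a) \<Rightarrow> bool" where
  "gen_seq e \<longleftrightarrow> (\<forall>n. e n \<in> partial_isos M R) \<and>
     (AE x in M. \<forall>y. (x, y) \<in> R \<longrightarrow> (x, y) \<in> (sym_graph e)\<^sup>*)"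

lemma gen_seq_generating: "gen_seq e \<Longrightarrow> generating_system M R (range e)"
  by (auto simp: gen_seq_def generating_system_def sym_graph_def)

lemma gen_seq_cost: "system_cost M (range e) \<le> (\<Sum>n. emeasure M (dom (e n)))"
proof -
  \<comment> \<open>\<open>J\<close> picks one index for each map in the range, so that a repeated
    map enters the cost once.\<close>
  obtain J where J: "inj_on e J" "range e = e ` J"
    using subset_image_inj[of "range e" e UNIV] by auto
  have "system_cost M (range e) = (\<integral>\<^sup>+ n. emeasure M (dom (e n)) \<partial>count_space J)"
    unfolding system_cost_def J(2)
    by (subst nn_integral_bij_count_space[symmetric, of e J])
      (auto simp: J bij_betw_def)
  also have "\<dots> = (\<integral>\<^sup>+ n. emeasure M (dom (e n)) * indicator J n \<partial>count_space UNIV)"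
    by (rule nn_integral_count_space_indicator) simp
  also have "\<dots> \<le> (\<integral>\<^sup>+ n. emeasure M (dom (e n)) \<partial>count_space UNIV)"
    by (intro nn_integral_mono) (auto simp: indicator_def)
  finally show ?thesis by (simp add: nn_integral_count_space_nat)
qed

lemma cost_le_seq: "gen_seq e \<Longrightarrow> cost M R \<le> (\<Sum>n. emeasure M (dom (e n)))"
  unfolding cost_def
  using gen_seq_generating by (intro order.trans[OF _ gen_seq_cost] INF_lower) simp

text \<open>The enumeration is injective and padded with the empty map, so the sum equals the cost
  and is not merely an upper bound. The union of the graphs is recorded because the Cayley graph
  depends on it alone.\<close>

lemma generating_seq:
  assumes "generating_system M R \<Phi>"
  obtains e where "gen_seq e" "(\<Union>n. Map.graph (e n)) = (\<Union>\<phi>\<in>\<Phi>. Map.graph \<phi>)"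
    "(\<Sum>n. emeasure M (dom (e n))) = system_cost M \<Phi>"
proof -
  have \<Phi>: "countable \<Phi>" "\<Phi> \<subseteq> partial_isos M R"
    and AE: "AE x in M. \<forall>y. (x, y) \<in> R \<longrightarrow> (x, y) \<in> (\<Union>\<phi>\<in>\<Phi>. Map.graph \<phi> \<union> (Map.graph \<phi>)\<inverse>)\<^sup>*"
    using assms by (auto simp: generating_system_def)
  define J where "J = to_nat_on \<Phi> ` \<Phi>"
  have inj: "inj_on (to_nat_on \<Phi>) \<Phi>" using \<Phi>(1) by (rule inj_on_to_nat_on)
  define g where "g = the_inv_into \<Phi> (to_nat_on \<Phi>)"
  have g: "bij_betw g J \<Phi>"
    unfolding g_def J_def using inj by (intro bij_betw_the_inv_into) (simp add: bij_betw_def)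
  define e where "e n = (if n \<in> J then g n else Map.empty)" for n
  have e\<Phi>: "e n \<in> \<Phi> \<or> e n = Map.empty" for n
    using g by (auto simp: e_def bij_betw_def)
  have \<Phi>e: "\<exists>n. e n = \<phi>" if "\<phi> \<in> \<Phi>" for \<phi>
  proof -
    from that g obtain n where "n \<in> J" "\<phi> = g n" by (auto simp: bij_betw_def)
    then have "e n = \<phi>" by (simp add: e_def)
    then show ?thesis ..
  qed
  have gr: "(\<Union>n. Map.graph (e n)) = (\<Union>\<phi>\<in>\<Phi>. Map.graph \<phi>)" (is "?l = ?r")
  proof
    have "Map.graph (e n) \<subseteq> ?r" for n
      using e\<Phi>[of n] by (cases "e n = Map.empty") auto
    then show "?l \<subseteq> ?r" by auto
    show "?r \<subseteq> ?l" using \<Phi>e by blast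
  qed
  have "sym_graph e = (\<Union>n. Map.graph (e n)) \<union> (\<Union>n. Map.graph (e n))\<inverse>"
    by (auto simp: sym_graph_def)
  moreover have "(\<Union>\<phi>\<in>\<Phi>. Map.graph \<phi> \<union> (Map.graph \<phi>)\<inverse>) = (\<Union>\<phi>\<in>\<Phi>. Map.graph \<phi>) \<union> (\<Union>\<phi>\<in>\<Phi>. Map.graph \<phi>)\<inverse>"
    by auto
  ultimately have sg: "sym_graph e = (\<Union>\<phi>\<in>\<Phi>. Map.graph \<phi> \<union> (Map.graph \<phi>)\<inverse>)"
    using gr by simp
  have "gen_seq e"
    unfolding gen_seq_def sg
  proof
    show "\<forall>n. e n \<in> partial_isos M R"
    proof
      show "e n \<in> partial_isos M R" for n
        using e\<Phi>[of n] \<Phi>(2) piso_empty by (cases "e n = Map.empty") auto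
    qed
  qed (rule AE)
  moreover have "(\<Sum>n. emeasure M (dom (e n))) = system_cost M \<Phi>"
  proof -
    have "(\<Sum>n. emeasure M (dom (e n))) = (\<integral>\<^sup>+ n. emeasure M (dom (e n)) \<partial>count_space UNIV)"
      by (simp add: nn_integral_count_space_nat)
    also have "\<dots> = (\<integral>\<^sup>+ n. emeasure M (dom (g n)) * indicator J n \<partial>count_space UNIV)"
      by (intro nn_integral_cong) (auto simp: e_def)
    also have "\<dots> = (\<integral>\<^sup>+ n. emeasure M (dom (g n)) \<partial>count_space J)"
      by (rule nn_integral_count_space_indicator[symmetric]) simp
    also have "\<dots> = system_cost M \<Phi>"
      unfolding system_cost_def by (rule nn_integral_bij_count_space[OF g])
    finally show ?thesis .
  qed
  ultimately show thesis using that gr by blast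
qed

end

section \<open>Discrete minimal spanning forests\<close>

text \<open>Induction on the number of edges, for the sharper bound that edges plus components are
  at most vertices. The ends of the edge of largest label are not connected by the other edges, so
  adding it merges two components.\<close>

lemma kruskal_card:
  fixes l :: "'b \<times> 'b \<Rightarrow> nat"
  assumes V: "finite V" "V \<noteq> {}"
    and "finite G" "G \<subseteq> V \<times> V" "inj_on l G"
    and "\<And>p. p \<in> G \<Longrightarrow> p \<notin> ({e \<in> G. l e < l p} \<union> {e \<in> G. l e < l p}\<inverse>)\<^sup>*"
  shows "card G < card V"
proof -
  define T :: "('b \<times> 'b) set \<Rightarrow> ('b \<times> 'b) set" where "T G = (G \<union> G\<inverse>)\<^sup>*" for G
  have T_refl: "(v, v) \<in> T G" for v G by (simp add: T_def)
  have T_mono: "G \<subseteq> G' \<Longrightarrow> T G \<subseteq> T G'" for G G'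
    unfolding T_def by (intro rtrancl_mono) auto
  have T_sym: "(v, w) \<in> T G \<Longrightarrow> (w, v) \<in> T G" for v w G
    unfolding T_def by (metis converse_Un converse_converse rtrancl_converseD sup_commute)
  have T_trans: "(u, v) \<in> T G \<Longrightarrow> (v, w) \<in> T G \<Longrightarrow> (u, w) \<in> T G" for u v w G
    unfolding T_def by (rule rtrancl_trans)
  define comps where "comps G = (\<lambda>v. T G `` {v}) ` V" for G
  have "card G + card (comps G) \<le> card V"
    using assms(3-6)
  proof (induction "card G" arbitrary: G)
    case 0
    then have "G = {}" by simp
    then show ?case using V by (simp add: comps_def card_image_le)
  next
    case (Suc n)
    have "G \<noteq> {}" using Suc.hyps(2) by auto
    then have "Max (l ` G) \<in> l ` G" using Suc.prems(1) by simp
    then obtain p where p: "p \<in> G" "l p = Max (l ` G)" by (metis imageE)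
    have max: "l e \<le> l p" if "e \<in> G" for e
      using that Suc.prems(1) p(2) by simp
    define G' where "G' = G - {p}"
    have low: "{e \<in> G. l e < l p} = G'"
    proof (intro set_eqI iffI)
      fix e assume e: "e \<in> G'"
      then have "l e \<noteq> l p" using inj_onD[OF Suc.prems(3), of e p] p(1) by (auto simp: G'_def)
      then show "e \<in> {e \<in> G. l e < l p}" using e max[of e] by (auto simp: G'_def)
    qed (auto simp: G'_def)
    have nT: "p \<notin> T G'" using Suc.prems(4)[OF p(1)] unfolding T_def low .
    have "card G' = n" using Suc.hyps(2) p(1) Suc.prems(1) by (simp add: G'_def)
    moreover have "card G' + card (comps G') \<le> card V"
    proof (rule Suc.hyps(1))
      show "n = card G'" using \<open>card G' = n\<close> by simp
      show "finite G'" "G' \<subseteq> V \<times> V" using Suc.prems by (auto simp: G'_def)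
      show "inj_on l G'" using Suc.prems(3) by (rule inj_on_subset) (auto simp: G'_def)
      fix q assume q: "q \<in> G'"
      then have "q \<notin> T {e \<in> G. l e < l q}" using Suc.prems(4)[of q] by (simp add: T_def G'_def)
      moreover have "T {e \<in> G'. l e < l q} \<subseteq> T {e \<in> G. l e < l q}"
        by (rule T_mono) (auto simp: G'_def)
      ultimately show "q \<notin> ({e \<in> G'. l e < l q} \<union> {e \<in> G'. l e < l q}\<inverse>)\<^sup>*"
        unfolding T_def by blast
    qed
    moreover have "card (comps G) < card (comps G')"
    proof -
      have fin: "finite (comps G')" using V by (simp add: comps_def)
      have sub: "T G' \<subseteq> T G" by (rule T_mono) (auto simp: G'_def)
      have g: "T G `` (T G' `` {v}) = T G `` {v}" for v
        using sub T_trans[of v _ G] T_refl[of v G'] by blast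
      \<comment> \<open>Components of \<open>G\<close> are unions of components of
        \<open>G'\<close>. If there were equally many, this map would be injective and the ends of
        \<open>p\<close> would already share a component of \<open>G'\<close>.\<close>
      have im: "comps G = (\<lambda>C. T G `` C) ` comps G'"
        unfolding comps_def image_image g ..
      have le: "card (comps G) \<le> card (comps G')"
        unfolding im by (rule card_image_le[OF fin])
      have "card (comps G) \<noteq> card (comps G')"
      proof
        assume "card (comps G) = card (comps G')"
        then have inj: "inj_on (\<lambda>C. T G `` C) (comps G')"
          unfolding im by (rule eq_card_imp_inj_on[OF fin])
        obtain a b where ab: "p = (a, b)" by (cases p)
        then have V': "a \<in> V" "b \<in> V" using p(1) Suc.prems(2) by auto
        have "(a, b) \<in> T G" using p(1) ab by (auto simp: T_def)
        then have "T G `` {a} = T G `` {b}"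
          using T_trans[of _ _ G] T_sym[of _ _ G] by blast
        then have "T G `` (T G' `` {a}) = T G `` (T G' `` {b})" by (simp add: g)
        from inj_onD[OF inj this] have "T G' `` {a} = T G' `` {b}"
          using V' by (simp add: comps_def)
        then have "(a, b) \<in> T G'" using T_refl[of b G'] by blast
        then show False using nT ab by simp
      qed
      with le show ?thesis by simp
    qed
    ultimately show ?case using Suc.hyps(2) by linarith
  qed
  moreover have "card (comps G) > 0"
    using V by (simp add: comps_def card_gt_0_iff)
  ultimately show ?thesis by linarith
qed

abbreviation count :: "'b set \<Rightarrow> ennreal" where
  "count A \<equiv> emeasure (count_space UNIV) A"

lemma count_image: "inj_on g B \<Longrightarrow> count (g ` B) = count B"
  by (cases "finite B") (auto simp: emeasure_count_space card_image finite_image_iff)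

lemma count_mono: "B \<subseteq> C \<Longrightarrow> count B \<le> count C"
  by (rule emeasure_mono) auto

lemma count_Un: "count (B \<union> C) \<le> count B + count C"
  by (rule emeasure_subadditive) auto

lemma sum_degree:
  assumes "finite V"
  shows "(\<Sum>y\<in>V. count {z. (y, z) \<in> F}) = count {p \<in> F. fst p \<in> V}"
proof -
  have "(\<Sum>y\<in>V. count {z. (y, z) \<in> F}) = (\<Sum>y\<in>V. count (Pair y ` {z. (y, z) \<in> F}))"
    by (simp add: count_image inj_on_def)
  also have "\<dots> = count (\<Union>y\<in>V. Pair y ` {z. (y, z) \<in> F})"
    using assms by (intro sum_emeasure) (auto simp: disjoint_family_on_def)
  also have "(\<Union>y\<in>V. Pair y ` {z. (y, z) \<in> F}) = {p \<in> F. fst p \<in> V}"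
    by force
  finally show ?thesis .
qed

text \<open>An edge inside \<open>V\<close> is counted at both ends, an edge leaving
  \<open>V\<close> at one end, and the leaving ones inject into the boundary in the Cayley graph
  over \<open>x\<close>. In the application \<open>H\<close> holds one orientation of each
  edge.\<close>

lemma degree_sum_bound:
  assumes V: "finite V" "\<And>y. y \<in> V \<Longrightarrow> (x, y) \<in> R"
    and R: "trans R" "sym R"
    and H: "card {p \<in> H. fst p \<in> V \<and> snd p \<in> V} \<le> card V"
    and E: "H \<union> H\<inverse> \<subseteq> E \<union> E\<inverse>" "E \<subseteq> R" "E = (\<Union>\<phi>\<in>\<Phi>. Map.graph \<phi>)"
  shows "(\<Sum>y\<in>V. count {z. (y, z) \<in> H \<union> H\<inverse>})
    \<le> 2 * of_nat (card V) + count (edge_boundary (cayley_edges R \<Phi> x) ({x} \<times> V))"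
proof -
  let ?F = "H \<union> H\<inverse>"
  define G where "G = {p \<in> H. fst p \<in> V \<and> snd p \<in> V}"
  define B where "B = {p \<in> ?F. fst p \<in> V \<and> snd p \<notin> V}"
  have "G \<subseteq> V \<times> V" by (auto simp: G_def)
  moreover have "finite (V \<times> V)" using V(1) by simp
  ultimately have "finite G" by (rule finite_subset)
  then have "count G = of_nat (card G)" by simp
  then have G: "count G \<le> of_nat (card V)" using H by (simp add: G_def)
  have "count (prod.swap ` G) = count G" by (rule count_image) (auto simp: inj_on_def)
  then have "count (G \<union> prod.swap ` G) \<le> of_nat (card V) + of_nat (card V)"
    using G by (intro order.trans[OF count_Un] add_mono) simp_all
  then have K: "count (G \<union> prod.swap ` G) \<le> 2 * of_nat (card V)" by (simp add: mult_2)
  \<comment> \<open>\<open>H\<close> and \<open>E\<close> may orient an edge differently;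
    \<open>g\<close> takes an orientation found in \<open>E\<close>. It is injective on
    \<open>B\<close> because only the first coordinate of a pair in \<open>B\<close> lies in
    \<open>V\<close>.\<close>
  define g where "g p = (if p \<in> E then ((x, fst p), (x, snd p)) else ((x, snd p), (x, fst p)))"
    for p :: "'a \<times> 'a"
  have "inj_on g B"
    by (rule inj_onI) (auto simp: g_def B_def prod_eq_iff split: if_splits)
  then have "count B = count (g ` B)" by (simp add: count_image)
  also have "\<dots> \<le> count (edge_boundary (cayley_edges R \<Phi> x) ({x} \<times> V))"
  proof (rule count_mono, rule subsetI)
    fix q assume "q \<in> g ` B"
    then obtain p where p: "p \<in> B" "q = g p" by auto
    obtain y z where "p = (y, z)" by (cases p)
    then have yz: "(y, z) \<in> ?F" "y \<in> V" "z \<notin> V" and q: "q = g (y, z)"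
      using p by (simp_all add: B_def)
    have xy: "(x, y) \<in> R" using V(2)[OF yz(2)] .
    show "q \<in> edge_boundary (cayley_edges R \<Phi> x) ({x} \<times> V)"
    proof (cases "(y, z) \<in> E")
      case True
      then have "q = ((x, y), (x, z))" by (simp add: q g_def)
      moreover have "\<exists>\<phi>\<in>\<Phi>. (y, z) \<in> Map.graph \<phi>" using True E(3) by auto
      ultimately show ?thesis using xy yz unfolding edge_boundary_def cayley_edges_def by auto
    next
      case False
      then have zy: "(z, y) \<in> E" using yz(1) E(1) by auto
      then have "(y, z) \<in> R" using E(2) R(2) by (meson subsetD symD)
      then have "(x, z) \<in> R" using R(1) xy by (meson transD)
      moreover have "q = ((x, z), (x, y))" using False by (simp add: q g_def)
      moreover have "\<exists>\<phi>\<in>\<Phi>. (z, y) \<in> Map.graph \<phi>" using zy E(3) by auto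
      ultimately show ?thesis using yz unfolding edge_boundary_def cayley_edges_def by auto
    qed
  qed
  finally have B: "count B \<le> count (edge_boundary (cayley_edges R \<Phi> x) ({x} \<times> V))" .
  have "(\<Sum>y\<in>V. count {z. (y, z) \<in> ?F}) = count {p \<in> ?F. fst p \<in> V}"
    by (rule sum_degree[OF V(1)])
  also have "\<dots> \<le> count ((G \<union> prod.swap ` G) \<union> B)"
  proof (rule count_mono, rule subsetI)
    fix p assume p: "p \<in> {p \<in> ?F. fst p \<in> V}"
    show "p \<in> (G \<union> prod.swap ` G) \<union> B"
    proof (cases "snd p \<in> V")
      case True
      then show ?thesis using p by (cases p) (auto simp: G_def image_iff)
    qed (use p in \<open>auto simp: B_def\<close>)
  qed
  also have "\<dots> \<le> count (G \<union> prod.swap ` G) + count B" by (rule count_Un)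
  also have "\<dots> \<le> 2 * of_nat (card V) + count (edge_boundary (cayley_edges R \<Phi> x) ({x} \<times> V))"
    by (rule add_mono[OF K B])
  finally show ?thesis .
qed

lemma count_dom: "count {z. \<phi> y = Some z} = indicator (dom \<phi>) y"
proof (cases "\<phi> y")
  case (Some w)
  then have "{z. \<phi> y = Some z} = {w}" by auto
  then show ?thesis using Some by (simp add: indicator_def dom_def)
qed (simp add: indicator_def dom_def)

lemma count_UN_graph:
  fixes k :: "nat \<Rightarrow> 'a \<rightharpoonup> 'a"
  assumes "\<And>m n. m \<noteq> n \<Longrightarrow> Map.graph (k m) \<inter> Map.graph (k n) = {}"
  shows "count {z. (y, z) \<in> (\<Union>n. Map.graph (k n))} = (\<Sum>n. indicator (dom (k n)) y)"
proof -
  have "disjoint_family (\<lambda>n. {z. k n y = Some z})"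
    unfolding disjoint_family_on_def using assms by (fastforce simp: Map.graph_def)
  then have "(\<Sum>n. count {z. k n y = Some z}) = count (\<Union>n. {z. k n y = Some z})"
    by (intro suminf_emeasure) auto
  moreover have "{z. (y, z) \<in> (\<Union>n. Map.graph (k n))} = (\<Union>n. {z. k n y = Some z})"
    by (auto simp: graph_iff)
  ultimately show ?thesis by (simp add: count_dom)
qed

context pmp_rel
begin

text \<open>Cutting each \<open>q n\<close> down to the points whose image is not already supplied
  by an earlier \<open>q m\<close> makes the graphs disjoint; the cost of the new sequence counts
  every pair of \<open>H\<close> once, whatever repetitions \<open>q\<close> had.\<close>

lemma relation_seq:
  fixes q :: "nat \<Rightarrow> 'a \<rightharpoonup> 'a"
  assumes q: "\<And>n. q n \<in> partial_isos M R"
    and H: "H \<in> sets (M \<Otimes>\<^sub>M M)" "H \<subseteq> (\<Union>n. Map.graph (q n))"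
  obtains k where "\<And>n::nat. k n \<in> partial_isos M R" "(\<Union>n. Map.graph (k n)) = H"
    "\<And>m n. m \<noteq> n \<Longrightarrow> Map.graph (k m) \<inter> Map.graph (k n) = {}"
proof -
  define D where "D n = dom (q n) \<inter> ((\<lambda>x. (x, tot (q n) x)) -` H \<inter> space M)
     - (\<Union>m<n. dom (q m) \<inter> {x \<in> space M. tot (q m) x = tot (q n) x})" for n
  have a: "(\<lambda>x. (x, tot (q n) x)) -` H \<inter> space M \<in> sets M" for n
    by (rule measurable_sets[OF measurable_Pair[OF measurable_ident_sets[OF refl] piso_tot[OF q]] H(1)])
  have b: "dom (q m) \<inter> {x \<in> space M. tot (q m) x = tot (q n) x} \<in> sets M" for m n
    by (rule sets.Int[OF piso_dom[OF q] eq_set[OF piso_tot[OF q] piso_tot[OF q]]])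
  have D: "D n \<in> sets M" for n
    unfolding D_def
    by (rule sets.Diff[OF sets.Int[OF piso_dom[OF q] a] sets.finite_UN[OF finite_lessThan b]])
  define k where "k n = q n |` D n" for n
  have k: "k n x = Some y \<longleftrightarrow> q n x = Some y \<and> (x, y) \<in> H \<and> (\<forall>m<n. q m x \<noteq> Some y)" for n x y
  proof (cases "q n x = Some y")
    case True
    then have xy: "x \<in> dom (q n)" "tot (q n) x = y" by (auto simp: tot_Some)
    have sp: "x \<in> space M" using xy(1) sets.sets_into_space[OF piso_dom[OF q]] by blast
    have "x \<in> dom (q m) \<and> tot (q m) x = y \<longleftrightarrow> q m x = Some y" for m
      using dom_tot[of x "q m"] by (auto simp: tot_Some)
    then have "x \<in> D n \<longleftrightarrow> (x, y) \<in> H \<and> (\<forall>m<n. q m x \<noteq> Some y)"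
      using xy sp by (auto simp: D_def)
    then show ?thesis using True by (simp add: k_def restrict_map_def)
  qed (simp add: k_def restrict_map_def)
  show thesis
  proof (rule that[of k])
    show "k n \<in> partial_isos M R" for n unfolding k_def by (rule piso_restrict[OF q D])
    show "(\<Union>n. Map.graph (k n)) = H"
    proof (intro set_eqI iffI)
      fix p assume p: "p \<in> H"
      then have ex: "\<exists>n. q n (fst p) = Some (snd p)"
        using subsetD[OF H(2), of p] by (cases p) (auto simp: graph_iff)
      define N where "N = (LEAST n. q n (fst p) = Some (snd p))"
      have "q N (fst p) = Some (snd p)" unfolding N_def by (rule LeastI_ex[OF ex])
      moreover have "\<forall>m<N. q m (fst p) \<noteq> Some (snd p)"
        unfolding N_def using not_less_Least by blast
      moreover have "(fst p, snd p) \<in> H" using p by simp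
      ultimately have "k N (fst p) = Some (snd p)" by (simp only: k)
      then show "p \<in> (\<Union>n. Map.graph (k n))"
        using graph_iff[of "fst p" "snd p"] by auto
    next
      fix p assume "p \<in> (\<Union>n. Map.graph (k n))"
      then show "p \<in> H" by (cases p) (auto simp: graph_iff k)
    qed
    show "Map.graph (k m) \<inter> Map.graph (k n) = {}" if "m \<noteq> n" for m n
    proof -
      have False if "k m x = Some y" "k n x = Some y" for x y
        using that \<open>m \<noteq> n\<close> unfolding k by (metis linorder_neqE_nat)
      then show ?thesis by (auto simp: Map.graph_def)
    qed
  qed
qed

lemma separating_colour:
  assumes P: "finite P" "\<And>\<psi>. \<psi> \<in> P \<Longrightarrow> \<psi> \<in> measurable M M"
  obtains d :: "'a \<Rightarrow> nat" where "d \<in> measurable M (count_space UNIV)"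
    "\<And>x \<psi>. x \<in> space M \<Longrightarrow> \<psi> \<in> P \<Longrightarrow> \<psi> x \<noteq> x \<Longrightarrow> d (\<psi> x) \<noteq> d x"
proof -
  \<comment> \<open>Cut the line into cells so small that every \<open>\<psi> \<in> P\<close> moving \<open>x\<close> moves it out of its cell; the colour
    records the scale and the cell.\<close>
  define Q where "Q j x \<longleftrightarrow> (\<forall>\<psi>\<in>P. f (\<psi> x) = f x \<or> 1 / real (Suc j) < \<bar>f (\<psi> x) - f x\<bar>)" for j x
  define k where "k x = (LEAST j. Q j x)" for x
  define d where "d x = to_nat (k x, \<lfloor>f x * real (Suc (k x))\<rfloor>)" for x
  have Q_ex: "\<exists>j. Q j x" for x
  proof -
    have "\<exists>J. \<forall>j\<ge>J. f (\<psi> x) = f x \<or> 1 / real (Suc j) < \<bar>f (\<psi> x) - f x\<bar>" for \<psi>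
    proof (cases "f (\<psi> x) = f x")
      case False
      then obtain J where J: "1 / real (Suc J) < \<bar>f (\<psi> x) - f x\<bar>"
        using nat_approx_posE[of "\<bar>f (\<psi> x) - f x\<bar>"] by auto
      have "1 / real (Suc j) \<le> 1 / real (Suc J)" if "J \<le> j" for j
        using that by (intro divide_left_mono) auto
      then show ?thesis using J by (meson le_less_trans)
    qed auto
    then obtain J where J: "\<forall>\<psi>. \<forall>j\<ge>J \<psi>. f (\<psi> x) = f x \<or> 1 / real (Suc j) < \<bar>f (\<psi> x) - f x\<bar>"
      by metis
    \<comment> \<open>For each map there is a threshold beyond which every scale is fine enough at
      \<open>x\<close>; as \<open>P\<close> is finite, the largest threshold serves all
      maps.\<close>
    have "Q (Max (insert 0 (J ` P))) x"
      unfolding Q_def using J P(1) by (auto intro!: J[rule_format])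
    then show ?thesis ..
  qed
  have Qk: "Q (k x) x" for x unfolding k_def by (rule LeastI_ex[OF Q_ex])
  have "Measurable.pred M (Q j)" for j
    unfolding Q_def
  proof (rule pred_intros_finite(3)[OF P(1)])
    fix \<psi> assume "\<psi> \<in> P"
    have [measurable]: "(\<lambda>x. f (\<psi> x)) \<in> borel_measurable M" "f \<in> borel_measurable M"
      using measurable_compose[OF P(2)[OF \<open>\<psi> \<in> P\<close>] f_measurable] f_measurable by auto
    show "Measurable.pred M (\<lambda>x. f (\<psi> x) = f x \<or> 1 / real (Suc j) < \<bar>f (\<psi> x) - f x\<bar>)"
      by measurable
  qed
  then have k: "k \<in> measurable M (count_space UNIV)"
    unfolding k_def by (intro measurable_Least) auto
  have dj: "(\<lambda>x. to_nat (j, \<lfloor>f x * real (Suc j)\<rfloor>)) \<in> measurable M (count_space UNIV)" for j :: nat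
  proof -
    have "(\<lambda>x. f x * real (Suc j)) \<in> borel_measurable M" using f_measurable by measurable
    then have "(\<lambda>x. \<lfloor>f x * real (Suc j)\<rfloor>) \<in> measurable M (count_space UNIV)"
      by (rule measurable_compose[OF _ measurable_real_floor])
    then show ?thesis by (rule measurable_compose) simp
  qed
  show thesis
  proof (rule that[of d])
    show "d \<in> measurable M (count_space UNIV)"
      unfolding d_def by (rule measurable_compose_countable[OF dj k])
    fix x \<psi> assume x: "x \<in> space M" and \<psi>: "\<psi> \<in> P" "\<psi> x \<noteq> x"
    have "\<psi> x \<in> space M" using measurable_space[OF P(2)[OF \<psi>(1)] x] .
    then have ne: "f (\<psi> x) \<noteq> f x" using inj_onD[OF f_inj, of "\<psi> x" x] x \<psi>(2) by blast
    show "d (\<psi> x) \<noteq> d x"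
    proof
      assume "d (\<psi> x) = d x"
      then have eq: "k (\<psi> x) = k x"
        and fl: "\<lfloor>f (\<psi> x) * real (Suc (k (\<psi> x)))\<rfloor> = \<lfloor>f x * real (Suc (k x))\<rfloor>"
        by (auto simp: d_def)
      define j where "j = k x"
      \<comment> \<open>Equal colours mean equal scale and equal cell, hence a distance below 1 / (j
        + 1), whereas \<open>Q\<close> at this scale places the moved point farther away.\<close>
      have "\<lfloor>f (\<psi> x) * real (Suc j)\<rfloor> = \<lfloor>f x * real (Suc j)\<rfloor>" using fl eq j_def by simp
      then have "\<bar>f (\<psi> x) * real (Suc j) - f x * real (Suc j)\<bar> < 1" by linarith
      then have "\<bar>f (\<psi> x) - f x\<bar> * real (Suc j) < 1"
        by (simp add: abs_mult left_diff_distrib[symmetric])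
      then have "\<bar>f (\<psi> x) - f x\<bar> < 1 / real (Suc j)"
        by (simp add: pos_less_divide_eq)
      moreover have "1 / real (Suc j) < \<bar>f (\<psi> x) - f x\<bar>"
        using Qk[of x] \<psi>(1) ne unfolding Q_def j_def by blast
      ultimately show False by simp
    qed
  qed
qed


text \<open>Disjointness is only almost sure. Since \<open>A\<close> is finite, the exceptional sets
  of all pairs are null together, and off them A_x really has \<open>card A\<close> points.\<close>

lemma vertex_sets_inj:
  assumes "A \<in> vertex_sets M R"
  shows "AE x in M. inj_on (\<lambda>\<phi>. tot \<phi> x) A"
proof -
  have A: "finite A" "A \<subseteq> full_group M R" "pairwise (disjoint_vertices M R) A"
    using assms by (auto simp: vertex_sets_def)
  have ne: "AE x in M. tot \<phi> x \<noteq> tot \<psi> x" if "\<phi> \<in> A" "\<psi> \<in> A" "\<phi> \<noteq> \<psi>" for \<phi> \<psi>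
  proof -
    have fg: "\<phi> \<in> full_group M R" "\<psi> \<in> full_group M R" using that A(2) by auto
    note \<phi> = full_group_tot[OF fg(1)] and \<psi> = full_group_tot[OF fg(2)]
    let ?E = "{x \<in> space M. tot \<phi> x = tot \<psi> x}"
    have E: "?E \<in> sets M" by (rule eq_set[OF piso_tot[OF \<phi>(1)] piso_tot[OF \<psi>(1)]])
    have "count (Map.graph \<phi> \<inter> Map.graph \<psi> \<inter> fibre R x) = indicator ?E x" if x: "x \<in> space M" for x
    proof (cases "x \<in> ?E")
      case True
      then have "Map.graph \<phi> \<inter> Map.graph \<psi> \<inter> fibre R x = {(x, tot \<phi> x)}"
        using \<phi>(2)[OF x] \<psi>(2)[OF x] \<phi>(5)[OF x] by (auto simp: fibre_def graph_iff)
      then show ?thesis using True by (simp add: indicator_def)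
    next
      case False
      then have "Map.graph \<phi> \<inter> Map.graph \<psi> \<inter> fibre R x = {}"
        using \<phi>(2)[OF x] \<psi>(2)[OF x] x by (auto simp: fibre_def graph_iff)
      then show ?thesis using False by (simp add: indicator_def)
    qed
    then have "rel_measure M R (Map.graph \<phi> \<inter> Map.graph \<psi>) = (\<integral>\<^sup>+ x. indicator ?E x \<partial>M)"
      unfolding rel_measure_def by (rule nn_integral_cong)
    also have "\<dots> = emeasure M ?E" by (rule nn_integral_indicator[OF E])
    finally have "emeasure M ?E = 0"
      using A(3) that by (simp add: pairwise_def disjoint_vertices_def)
    then have "?E \<in> null_sets M" using E by (simp add: null_sets_def)
    then show ?thesis by (rule AE_I') auto
  qed
  have "AE x in M. \<phi> \<noteq> \<psi> \<longrightarrow> tot \<phi> x \<noteq> tot \<psi> x" if "\<phi> \<in> A" "\<psi> \<in> A" for \<phi> \<psi>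
    using ne[OF that] by (cases "\<phi> = \<psi>") auto
  then have "AE x in M. \<forall>\<psi>\<in>A. \<phi> \<noteq> \<psi> \<longrightarrow> tot \<phi> x \<noteq> tot \<psi> x" if "\<phi> \<in> A" for \<phi>
    using that by (intro AE_finite_allI[OF A(1)])
  then have "AE x in M. \<forall>\<phi>\<in>A. \<forall>\<psi>\<in>A. \<phi> \<noteq> \<psi> \<longrightarrow> tot \<phi> x \<noteq> tot \<psi> x"
    by (rule AE_finite_allI[OF A(1)])
  then show ?thesis by eventually_elim (auto simp: inj_on_def)
qed

text \<open>Stated without subtraction or division, so that it is meaningful for infinite values as
  well.\<close>

lemma cost_le_boundary:
  assumes e: "gen_seq e" and e\<Phi>: "(\<Union>n. Map.graph (e n)) = (\<Union>\<phi>\<in>\<Phi>. Map.graph \<phi>)"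
    and A: "A \<in> vertex_sets M R"
  shows "of_nat (card A) * (2 * cost M R) \<le> 2 * of_nat (card A) + boundary_measure M R \<Phi> A"
proof -
  let ?P = "M \<Otimes>\<^sub>M M"
  have pe: "e n \<in> partial_isos M R" for n using e by (simp add: gen_seq_def)
  define q where "q = interleave_inverses e"
  have pq: "q n \<in> partial_isos M R" for n unfolding q_def by (rule interleave_piso[OF pe])
  define F where "F = sym_graph e"
  have Fq: "F = (\<Union>n. Map.graph (q n))"
    unfolding F_def q_def by (rule sym_graph_interleave[OF piso_inj[OF pe]])
  have Fm: "F \<in> sets ?P" unfolding F_def by (rule sym_graph_measurable[OF pe])
  have FR: "F \<subseteq> R" unfolding F_def by (rule sym_graph_sub_R[OF pe])
  have Fsym: "(z, y) \<in> F" if "(y, z) \<in> F" for y z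
    using that sym_sym_graph[of e] unfolding F_def by (rule symD[rotated])
  have Fsp: "y \<in> space M" "z \<in> space M" if "(y, z) \<in> F" for y z
    using that FR R_sub by auto
  have finA: "finite A" and A0: "A \<noteq> {}" and AG: "\<And>\<phi>. \<phi> \<in> A \<Longrightarrow> \<phi> \<in> full_group M R"
    using A by (auto simp: vertex_sets_def)
  note G = full_group_tot[OF AG]
  \<comment> \<open>Such a map carries \<open>tot \<psi> x\<close> to \<open>tot \<phi> x\<close>,
    so a colouring that changes whenever one of them moves its point is injective on every
    A_x.\<close>
  define Ps where "Ps = (\<lambda>(\<phi>, \<psi>) x. tot \<phi> (tot (pinv \<psi>) x)) ` (A \<times> A)"
  have Ps: "finite Ps" using finA by (simp add: Ps_def)
  have Psm: "\<rho> \<in> measurable M M" if "\<rho> \<in> Ps" for \<rho>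
  proof -
    from that obtain \<phi> \<psi> where "\<phi> \<in> A" "\<psi> \<in> A" "\<rho> = (\<lambda>x. tot \<phi> (tot (pinv \<psi>) x))"
      by (auto simp: Ps_def)
    then show ?thesis
      using measurable_compose[OF piso_tot[OF piso_pinv[OF G(1)]] piso_tot[OF G(1)]] by simp
  qed
  obtain d where d: "d \<in> measurable M (count_space (UNIV :: nat set))"
    and d_ne: "\<And>x \<rho>. x \<in> space M \<Longrightarrow> \<rho> \<in> Ps \<Longrightarrow> \<rho> x \<noteq> x \<Longrightarrow> d (\<rho> x) \<noteq> d x"
    using separating_colour[OF Ps Psm] by metis
  have d_inj: "inj_on d ((\<lambda>\<phi>. tot \<phi> x) ` A)" if x: "x \<in> space M" for x
  proof (rule inj_onI, elim imageE)
    fix u v \<phi> \<psi> assume uv: "d u = d v" "u = tot \<phi> x" "v = tot \<psi> x" "\<phi> \<in> A" "\<psi> \<in> A"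
    define \<rho> where "\<rho> = (\<lambda>x. tot \<phi> (tot (pinv \<psi>) x))"
    have "\<rho> \<in> Ps" using uv(4,5) by (force simp: \<rho>_def Ps_def)
    moreover have "\<rho> v = u" using G(4)[OF uv(5) x] uv by (simp add: \<rho>_def)
    ultimately show "u = v" using d_ne[of v \<rho>] uv G(3)[OF uv(5) x] by auto
  qed
  \<comment> \<open>Minimum and maximum encode the unordered pair of colours: both orientations of
    an edge get the same label.\<close>
  define l where "l p = to_nat (min (d (fst p)) (d (snd p)), max (d (fst p)) (d (snd p)))" for p
  have l_sym: "l (y, z) = l (z, y)" for y z
    by (simp add: l_def min.commute max.commute)
  have lm: "l \<in> measurable ?P (count_space UNIV)"
  proof -
    have d1: "(\<lambda>p. d (fst p)) \<in> measurable ?P (count_space UNIV)"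
      and d2: "(\<lambda>p. d (snd p)) \<in> measurable ?P (count_space UNIV)"
      using measurable_compose[OF measurable_fst d] measurable_compose[OF measurable_snd d] by auto
    have "(\<lambda>p. to_nat (min i (d (snd p)), max i (d (snd p)))) \<in> measurable ?P (count_space UNIV)"
      for i
      by (rule measurable_compose[OF d2]) simp
    from measurable_compose_countable[OF this d1] show ?thesis
      unfolding l_def[abs_def] .
  qed
  have lev: "l -` S \<inter> space ?P \<in> sets ?P" for S
    by (rule measurable_sets[OF lm]) simp
  define L where "L m = {p \<in> F. l p < m}" for m
  have Lm: "L m \<in> sets ?P" for m
  proof -
    have "L m = F \<inter> (l -` {..<m} \<inter> space ?P)"
      using sets.sets_into_space[OF Fm] by (auto simp: L_def)
    then show ?thesis using sets.Int[OF Fm lev] by simp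
  qed
  have LF: "L m \<subseteq> F" for m by (auto simp: L_def)
  have Lsym: "sym ((L m)\<^sup>+)" for m
    by (rule sym_trancl) (auto simp: sym_def L_def l_sym intro: Fsym)
  have Ltm: "(L m)\<^sup>+ \<in> sets ?P" for m
  proof (rule trancl_measurable[where q=q, OF pq Lm])
    show "L m \<subseteq> (\<Union>n. Map.graph (q n))" using LF[of m] Fq by simp
  qed
  \<comment> \<open>Loops are discarded separately. For distinct endpoints, the transitive and the
    reflexive transitive closure agree, and it is the former whose measurability has been
    shown.\<close>
  define F' where "F' = {p \<in> F. fst p \<noteq> snd p \<and> p \<notin> (L (l p))\<^sup>+}"
  have F'm: "F' \<in> sets ?P"
  proof -
    \<comment> \<open>The closure varies with the label of the edge; slicing by label value turns
      the condition into a countable union.\<close>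
    have "F' = F - {p \<in> space ?P. fst p = snd p} - (\<Union>m. (l -` {m} \<inter> space ?P) \<inter> (L m)\<^sup>+)"
      using sets.sets_into_space[OF Fm] by (auto simp: F'_def)
    moreover have "(\<Union>m. (l -` {m} \<inter> space ?P) \<inter> (L m)\<^sup>+) \<in> sets ?P"
      using lev Ltm by (intro sets.countable_nat_UN) (auto intro!: sets.Int[OF lev Ltm])
    ultimately show ?thesis
      using sets.Diff[OF sets.Diff[OF Fm eq_set[OF measurable_fst measurable_snd]]] by simp
  qed
  have F'sym: "(z, y) \<in> F'" if "(y, z) \<in> F'" for y z
    using that Fsym[of y z] symD[OF Lsym, of z y] by (auto simp: F'_def l_sym[of z y])
  \<comment> \<open>The coordinate selects one orientation of each edge, so that the cost counts
    edges once although \<open>F'\<close> is symmetric.\<close>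
  define H where "H = {p \<in> F'. f (fst p) < f (snd p)}"
  have Hm: "H \<in> sets ?P"
  proof -
    have [measurable]: "f \<in> borel_measurable M" by (rule f_measurable)
    have "{p \<in> space ?P. f (fst p) < f (snd p)} \<in> sets ?P" by measurable
    from sets.Int[OF F'm this] show ?thesis
    proof (rule back_subst[of "\<lambda>X. X \<in> sets ?P"])
      show "F' \<inter> {p \<in> space ?P. f (fst p) < f (snd p)} = H"
        using sets.sets_into_space[OF F'm] by (auto simp: H_def)
    qed
  qed
  have F'H: "F' = H \<union> H\<inverse>"
  proof (intro set_eqI iffI)
    fix p assume p: "p \<in> F'"
    obtain y z where yz: "p = (y, z)" by (cases p)
    have "(y, z) \<in> F" "y \<noteq> z" using p by (auto simp: F'_def yz)
    then have "f y \<noteq> f z" using inj_onD[OF f_inj] Fsp by blast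
    then show "p \<in> H \<union> H\<inverse>" using p F'sym[of y z] by (auto simp: H_def yz)
  next
    fix p assume "p \<in> H \<union> H\<inverse>"
    then show "p \<in> F'" using F'sym by (cases p) (auto simp: H_def)
  qed
  \<comment> \<open>Strong induction on the label: a discarded edge is a loop or is replaced by a
    path of edges with strictly smaller labels.\<close>
  have FF': "F \<subseteq> F'\<^sup>*"
  proof -
    have "\<forall>p\<in>F. l p = m \<longrightarrow> p \<in> F'\<^sup>*" for m
    proof (induction m rule: less_induct)
      case (less m)
      show ?case
      proof (intro ballI impI)
        fix p assume p: "p \<in> F" "l p = m"
        show "p \<in> F'\<^sup>*"
        proof (cases "fst p \<noteq> snd p \<and> p \<notin> (L m)\<^sup>+")
          case True
          then have "p \<in> F'" using p by (simp add: F'_def)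
          then show ?thesis by (cases p) auto
        next
          case False
          have "L m \<subseteq> F'\<^sup>*" using less.IH by (auto simp: L_def)
          then have "(L m)\<^sup>* \<subseteq> F'\<^sup>*" by (rule rtrancl_subset_rtrancl)
          moreover have "p \<in> (L m)\<^sup>*" using False by (cases p) (auto intro: trancl_into_rtrancl)
          ultimately show ?thesis ..
        qed
      qed
    qed
    then show ?thesis by blast
  qed
  have HF': "H \<subseteq> F'" by (auto simp: H_def)
  have F'F: "F' \<subseteq> F" by (auto simp: F'_def)
  have Hq: "H \<subseteq> (\<Union>n. Map.graph (q n))" using HF' F'F Fq by simp
  obtain k where pk: "\<And>n::nat. k n \<in> partial_isos M R" and kH: "(\<Union>n. Map.graph (k n)) = H"
    and kd: "\<And>m n. m \<noteq> n \<Longrightarrow> Map.graph (k m) \<inter> Map.graph (k n) = {}"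
    by (rule relation_seq[where q=q, OF pq Hm Hq]) (rule that)
  have kF': "sym_graph k = F'"
    unfolding F'H kH[symmetric] by (auto simp: sym_graph_def)
  have "gen_seq k"
    unfolding gen_seq_def
  proof
    have "AE x in M. \<forall>y. (x, y) \<in> R \<longrightarrow> (x, y) \<in> F\<^sup>*"
      using e by (simp add: gen_seq_def F_def)
    moreover have "F\<^sup>* \<subseteq> F'\<^sup>*" by (rule rtrancl_subset_rtrancl[OF FF'])
    ultimately show "AE x in M. \<forall>y. (x, y) \<in> R \<longrightarrow> (x, y) \<in> (sym_graph k)\<^sup>*"
      unfolding kF' by (auto elim!: eventually_mono)
  qed (use pk in blast)
  then have cost: "cost M R \<le> (\<Sum>n. emeasure M (dom (k n)))" by (rule cost_le_seq)
  \<comment> \<open>Pointwise this is the number of neighbours in \<open>F'\<close>. Ranges have the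
    measure of domains, so its integral is twice the cost of the new system.\<close>
  define deg where "deg y = (\<Sum>n. indicator (dom (k n)) y) + (\<Sum>n. indicator (ran (k n)) y :: ennreal)" for y
  have deg: "count {z. (y, z) \<in> F'} = deg y" for y
  proof -
    have 1: "count {z. (y, z) \<in> H} = (\<Sum>n. indicator (dom (k n)) y)"
      by (rule count_UN_graph[of k y, unfolded kH]) (rule kd)
    have inv: "Map.graph (pinv (k n)) = (Map.graph (k n))\<inverse>" for n
      by (rule graph_pinv[OF piso_inj[OF pk]])
    have invd: "Map.graph (pinv (k m)) \<inter> Map.graph (pinv (k n)) = {}" if "m \<noteq> n" for m n
      unfolding inv using kd[OF that] by blast
    have "count {z. (y, z) \<in> (\<Union>n. Map.graph (pinv (k n)))} = (\<Sum>n. indicator (ran (k n)) y)"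
      by (rule count_UN_graph[of "\<lambda>n. pinv (k n)", unfolded dom_pinv]) (rule invd)
    moreover have "(\<Union>n. Map.graph (pinv (k n))) = H\<inverse>"
      unfolding inv kH[symmetric] by auto
    ultimately have 2: "count {z. (y, z) \<in> H\<inverse>} = (\<Sum>n. indicator (ran (k n)) y)" by simp
    have "{z. (y, z) \<in> F'} = {z. (y, z) \<in> H} \<union> {z. (y, z) \<in> H\<inverse>}" by (auto simp: F'H)
    moreover have "{z. (y, z) \<in> H} \<inter> {z. (y, z) \<in> H\<inverse>} = {}" by (auto simp: H_def)
    ultimately have "count {z. (y, z) \<in> F'} = count {z. (y, z) \<in> H} + count {z. (y, z) \<in> H\<inverse>}"
      by (simp add: plus_emeasure)
    then show ?thesis unfolding 1 2 deg_def .
  qed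
  have dm: "(\<lambda>y. indicator (dom (k n)) y :: ennreal) \<in> borel_measurable M"
    and rm: "(\<lambda>y. indicator (ran (k n)) y :: ennreal) \<in> borel_measurable M" for n
    using piso_dom[OF pk] piso_ran[OF pk] by (auto intro: borel_measurable_indicator)
  have degm: "deg \<in> borel_measurable M"
    unfolding deg_def[abs_def]
    by (intro borel_measurable_add borel_measurable_suminf_order dm rm)
  have "(\<integral>\<^sup>+ y. deg y \<partial>M) = (\<Sum>n. emeasure M (dom (k n))) + (\<Sum>n. emeasure M (ran (k n)))"
    unfolding deg_def
    by (simp add: nn_integral_add nn_integral_suminf dm rm borel_measurable_suminf_order
        nn_integral_indicator piso_dom[OF pk] piso_ran[OF pk])
  then have degint: "(\<integral>\<^sup>+ y. deg y \<partial>M) = 2 * (\<Sum>n. emeasure M (dom (k n)))"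
    by (simp add: piso_ran_measure[OF pk] mult_2)
  define b where "b x = count (edge_boundary (cayley_edges R \<Phi> x) (\<Union>\<phi>\<in>A. fibre (Map.graph \<phi>) x))" for x
  let ?n = "of_nat (card A) :: ennreal"
  have pw: "(\<Sum>\<phi>\<in>A. deg (tot \<phi> x)) \<le> 2 * ?n + b x"
    if x: "x \<in> space M" and inj: "inj_on (\<lambda>\<phi>. tot \<phi> x) A" for x
  proof -
    define V where "V = (\<lambda>\<phi>. tot \<phi> x) ` A"
    have V: "finite V" "V \<noteq> {}" "card V = card A"
      using finA A0 card_image[OF inj] by (auto simp: V_def)
    have "fibre (Map.graph \<phi>) x = {(x, tot \<phi> x)}" if "\<phi> \<in> A" for \<phi>
      using G(2)[OF that x] by (auto simp: fibre_def graph_iff)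
    then have fib: "(\<Union>\<phi>\<in>A. fibre (Map.graph \<phi>) x) = {x} \<times> V"
      by (auto simp: V_def)
    define K where "K = {p \<in> H. fst p \<in> V \<and> snd p \<in> V}"
    have dV: "inj_on d V" using d_inj[OF x] by (simp add: V_def)
    have "card K < card V"
    \<comment> \<open>Distinct colours on \<open>V\<close> and the orientation fixed by the
      coordinate make labels injective on \<open>K\<close>. The ends of an \<open>F'\<close>-edge
      are not joined by smaller labels in all of \<open>F\<close>, hence not within
      \<open>K\<close>.\<close>
    proof (rule kruskal_card[where l=l])
      show "finite V" "V \<noteq> {}" using V by auto
      show sub: "K \<subseteq> V \<times> V" by (auto simp: K_def)
      show "finite K" by (rule finite_subset[OF sub]) (use V(1) in simp)
      show "inj_on l K"
      proof (rule inj_onI)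
        fix p p' assume p: "p \<in> K" "p' \<in> K" "l p = l p'"
        have V4: "fst p \<in> V" "snd p \<in> V" "fst p' \<in> V" "snd p' \<in> V" using p by (auto simp: K_def)
        have lt: "f (fst p) < f (snd p)" "f (fst p') < f (snd p')" using p by (auto simp: K_def H_def)
        have "min (d (fst p)) (d (snd p)) = min (d (fst p')) (d (snd p'))"
          "max (d (fst p)) (d (snd p)) = max (d (fst p')) (d (snd p'))"
          using p(3) by (auto simp: l_def)
        then have "(d (fst p) = d (fst p') \<and> d (snd p) = d (snd p')) \<or>
            (d (fst p) = d (snd p') \<and> d (snd p) = d (fst p'))"
          by (auto simp: min_def max_def split: if_splits)
        then show "p = p'"
        proof
          assume "d (fst p) = d (fst p') \<and> d (snd p) = d (snd p')"
          then have "fst p = fst p'" "snd p = snd p'" using inj_onD[OF dV] V4 by auto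
          then show ?thesis by (simp add: prod_eq_iff)
        next
          assume "d (fst p) = d (snd p') \<and> d (snd p) = d (fst p')"
          then have "fst p = snd p'" "snd p = fst p'" using inj_onD[OF dV] V4 by auto
          then show ?thesis using lt by simp
        qed
      qed
      fix p assume "p \<in> K"
      then have p: "p \<in> F'" using HF' by (auto simp: K_def)
      have KF: "e \<in> F" if "e \<in> K" for e using that HF' F'F by (auto simp: K_def)
      have "{e \<in> K. l e < l p} \<union> {e \<in> K. l e < l p}\<inverse> \<subseteq> L (l p)"
        using KF Fsym by (auto simp: L_def l_sym)
      then have "({e \<in> K. l e < l p} \<union> {e \<in> K. l e < l p}\<inverse>)\<^sup>* \<subseteq> (L (l p))\<^sup>*"
        by (rule rtrancl_mono)
      moreover have "p \<notin> (L (l p))\<^sup>*"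
        using p by (cases p) (auto simp: F'_def rtrancl_eq_or_trancl)
      ultimately show "p \<notin> ({e \<in> K. l e < l p} \<union> {e \<in> K. l e < l p}\<inverse>)\<^sup>*" by blast
    qed
    then have "(\<Sum>y\<in>V. count {z. (y, z) \<in> H \<union> H\<inverse>})
      \<le> 2 * of_nat (card V) + count (edge_boundary (cayley_edges R \<Phi> x) ({x} \<times> V))"
    proof (intro degree_sum_bound[where E="\<Union>n. Map.graph (e n)"])
      show "(x, y) \<in> R" if "y \<in> V" for y using that G(5)[OF _ x] by (auto simp: V_def)
      show "trans R" "sym R" using R_equiv by (auto simp: equiv_def)
      have "F = (\<Union>n. Map.graph (e n)) \<union> (\<Union>n. Map.graph (e n))\<inverse>"
        by (auto simp: F_def sym_graph_def)
      then show "H \<union> H\<inverse> \<subseteq> (\<Union>n. Map.graph (e n)) \<union> (\<Union>n. Map.graph (e n))\<inverse>"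
        using F'F F'H by simp
      show "(\<Union>n. Map.graph (e n)) \<subseteq> R" using FR by (auto simp: F_def sym_graph_def)
    qed (use V e\<Phi> in \<open>auto simp: K_def\<close>)
    moreover have "(\<Sum>y\<in>V. count {z. (y, z) \<in> H \<union> H\<inverse>}) = (\<Sum>\<phi>\<in>A. deg (tot \<phi> x))"
      unfolding V_def F'H[symmetric] deg by (rule sum.reindex_cong[OF inj]) auto
    ultimately show ?thesis by (simp add: b_def fib V(3))
  qed
  have Dm: "(\<lambda>x. deg (tot \<phi> x)) \<in> borel_measurable M" if "\<phi> \<in> A" for \<phi>
    by (rule measurable_compose[OF piso_tot[OF G(1)[OF that]] degm])
  define D where "D x = (\<Sum>\<phi>\<in>A. deg (tot \<phi> x))" for x
  have DM: "D \<in> borel_measurable M"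
    unfolding D_def[abs_def] by (rule borel_measurable_sum) (rule Dm)
  have "?n * (2 * cost M R) \<le> ?n * (\<integral>\<^sup>+ y. deg y \<partial>M)"
    unfolding degint by (intro mult_left_mono cost) auto
  also have "\<dots> = (\<Sum>\<phi>\<in>A. \<integral>\<^sup>+ x. deg (tot \<phi> x) \<partial>M)"
    using full_group_nn_integral[OF AG degm] by simp
  also have "\<dots> = (\<integral>\<^sup>+ x. D x \<partial>M)"
    unfolding D_def by (rule nn_integral_sum[symmetric]) (rule Dm)
  \<comment> \<open>Measurability of \<open>b\<close> is not established, so an integral of a sum
    with \<open>b\<close> is not split. The constant moves to the side of the measurable
    \<open>D\<close> by truncated subtraction, and the comparison with \<open>b\<close> uses only
    monotonicity.\<close>
  also have "\<dots> \<le> (\<integral>\<^sup>+ x. (D x - 2 * ?n) + 2 * ?n \<partial>M)"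
  proof (rule nn_integral_mono)
    show "D x \<le> (D x - 2 * ?n) + 2 * ?n" for x
    proof (cases "2 * ?n \<le> D x")
      case True
      then show ?thesis by (simp add: diff_add_cancel_ennreal)
    next
      case False
      then show ?thesis by (simp add: add_increasing)
    qed
  qed
  also have "\<dots> = (\<integral>\<^sup>+ x. D x - 2 * ?n \<partial>M) + 2 * ?n"
  proof -
    have "(\<lambda>x. D x - 2 * ?n) \<in> borel_measurable M" using DM by measurable
    then show ?thesis by (subst nn_integral_add) (simp_all add: emeasure_space_1 borel_measurable_const)
  qed
  also have "\<dots> \<le> (\<integral>\<^sup>+ x. b x \<partial>M) + 2 * ?n"
  proof (rule add_right_mono, rule nn_integral_mono_AE)
    show "AE x in M. D x - 2 * ?n \<le> b x"
      using vertex_sets_inj[OF A] AE_space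
    proof eventually_elim
      case (elim x)
      then have "D x \<le> 2 * ?n + b x" unfolding D_def by (intro pw)
      then show ?case
        by (subst ennreal_minus_le_iff) (auto simp: add.commute ennreal_mult_eq_top_iff)
    qed
  qed
  finally show ?thesis by (simp add: b_def boundary_measure_def add.commute)
qed

end

section \<open>Ergodicity\<close>

text \<open>A point is coded by the basic open sets containing it, read as digits 0 and 1 in base 3.
  Two points are separated by some basic set since the space is Hausdorff, and in base 3 the first
  differing digit outweighs all later ones.\<close>

lemma standard_borel_real_injection:
  assumes "standard_borel M"
  obtains f :: "'a \<Rightarrow> real" where "f \<in> borel_measurable M" "inj_on f (space M)"
proof -
  obtain T where T: "completely_metrizable_space T" "second_countable T"
    and sp: "space M = topspace T" and st: "sets M = sigma_sets (topspace T) {U. openin T U}"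
    using assms unfolding standard_borel_def by blast
  have haus: "Hausdorff_space T"
    by (rule metrizable_imp_Hausdorff_space[OF completely_metrizable_imp_metrizable_space[OF T(1)]])
  obtain B where "countable B \<and> (\<forall>V\<in>B. openin T V) \<and>
      (\<forall>U x. openin T U \<and> x \<in> U \<longrightarrow> (\<exists>V\<in>B. x \<in> V \<and> V \<subseteq> U))"
    using T(2) unfolding second_countable_def by (elim exE)
  then have B: "countable B" "\<And>V. V \<in> B \<Longrightarrow> openin T V"
    "\<And>U x. openin T U \<Longrightarrow> x \<in> U \<Longrightarrow> \<exists>V\<in>B. x \<in> V \<and> V \<subseteq> U"
    by simp_all
  \<comment> \<open>The empty set is added so that there is something to enumerate even if the basis
    is empty.\<close>
  define U where "U n = from_nat_into (insert {} B) n" for n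
  have U: "range U = insert {} B"
    unfolding U_def using B(1) by (intro range_from_nat_into) auto
  have "openin T (U n)" for n
  proof -
    have "U n \<in> insert {} B" using U by blast
    then show ?thesis using B(2) by auto
  qed
  then have Um: "U n \<in> sets M" for n unfolding st by (intro sigma_sets.Basic) simp
  define c where "c x n = (1/3::real) ^ n * indicator (U n) x" for x n
  have c01: "0 \<le> c x n" "c x n \<le> (1/3) ^ n" for x n
    by (auto simp: c_def indicator_def)
  have sm: "summable (c x)" for x
    by (rule summable_comparison_test'[where g="\<lambda>n. (1/3::real) ^ n" and N=0])
      (use c01 in auto)
  define f where "f x = (\<Sum>n. c x n)" for x
  have "(\<lambda>x. indicator (U n) x :: real) \<in> borel_measurable M" for n
    using Um by (rule borel_measurable_indicator)
  then have "f \<in> borel_measurable M"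
    unfolding f_def[abs_def] c_def
    by (intro borel_measurable_suminf borel_measurable_times borel_measurable_const)
  moreover have "inj_on f (space M)"
  proof (rule inj_onI, rule ccontr)
    fix x y assume xy: "x \<in> space M" "y \<in> space M" "f x = f y" "x \<noteq> y"
    then obtain S where S: "openin T S" "x \<in> S" "y \<notin> S"
      using Hausdorff_space_def haus unfolding sp by (metis disjoint_iff disjnt_def)
    then obtain V where "V \<in> B" "x \<in> V" "V \<subseteq> S" using B(3) by blast
    then obtain m where m: "U m = V" using U by (metis imageE insertI2)
    have ex: "\<exists>n. (x \<in> U n) \<noteq> (y \<in> U n)" using m \<open>x \<in> V\<close> \<open>V \<subseteq> S\<close> S(3) by blast
    define N where "N = (LEAST n. (x \<in> U n) \<noteq> (y \<in> U n))"
    have N: "(x \<in> U N) \<noteq> (y \<in> U N)" unfolding N_def by (rule LeastI_ex[OF ex])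
    have eq: "c x n = c y n" if "n < N" for n
      using not_less_Least[of n "\<lambda>n. (x \<in> U n) \<noteq> (y \<in> U n)"] that
      by (simp add: N_def c_def indicator_def)
    have gt: "f u < f v" if "u \<notin> U N" "v \<in> U N" "\<And>n. n < N \<Longrightarrow> c u n = c v n" for u v
    proof -
      have split: "f w = (\<Sum>n. c w (n + Suc N)) + (\<Sum>n<Suc N. c w n)" for w
        unfolding f_def by (rule suminf_split_initial_segment[OF sm])
      have geo: "(\<lambda>n. (1/3::real) ^ (n + Suc N)) sums ((1/3) ^ Suc N * (1 / (1 - 1/3)))"
        using sums_mult[OF geometric_sums[of "1/3::real"], of "(1/3) ^ Suc N"]
        by (simp add: power_add mult.commute)
      have "(\<Sum>n. c u (n + Suc N)) \<le> (\<Sum>n. (1/3::real) ^ (n + Suc N))"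
        by (intro suminf_le c01 summable_ignore_initial_segment[OF sm] sums_summable[OF geo])
      also have "\<dots> = (1/3) ^ Suc N * (1 / (1 - 1/3))" using geo by (rule sums_unique[symmetric])
      \<comment> \<open>The tail bound is half of 3^-N; in base 2 it would only equal the leading
        digit.\<close>
      also have "\<dots> < (1/3) ^ N" by (simp add: field_simps)
      finally have "(\<Sum>n. c u (n + Suc N)) < (1/3) ^ N" .
      moreover have "(\<Sum>n<Suc N. c v n) = (\<Sum>n<Suc N. c u n) + (1/3) ^ N"
        using that by (simp add: c_def)
      moreover have "0 \<le> (\<Sum>n. c v (n + Suc N))"
        by (intro suminf_nonneg c01 summable_ignore_initial_segment[OF sm])
      ultimately show ?thesis unfolding split[of u] split[of v] by linarith
    qed
    show False using N gt[of x y] gt[of y x] eq xy(3) by fastforce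
  qed
  ultimately show thesis by (rule that)
qed

lemma dom_tot_iff: "x \<in> dom \<phi> \<and> tot \<phi> x \<in> B \<longleftrightarrow> (\<exists>z. \<phi> x = Some z \<and> z \<in> B)"
  by (cases "\<phi> x") (auto simp: tot_def)

text \<open>The head of the list is applied first. The empty word is the identity restricted to
  \<open>S\<close>, so that every word is a partial map of the space.\<close>

primrec word :: "(nat \<Rightarrow> 'a \<rightharpoonup> 'a) \<Rightarrow> 'a set \<Rightarrow> nat list \<Rightarrow> 'a \<rightharpoonup> 'a" where
  "word q S [] = Some |` S"
| "word q S (n # w) = word q S w \<circ>\<^sub>m q n"

context pmp_rel
begin

text \<open>An enumeration of all words: on a conull set, \<open>R\<close> becomes a countable union
  of graphs of partial isomorphisms.\<close>

definition walk :: "(nat \<Rightarrow> 'a \<rightharpoonup> 'a) \<Rightarrow> nat \<Rightarrow> 'a \<rightharpoonup> 'a" where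
  "walk e i = word (interleave_inverses e) (space M) (from_nat i)"

context
  fixes e :: "nat \<Rightarrow> 'a \<rightharpoonup> 'a"
  assumes e: "gen_seq e"
begin

lemma gen_seq_piso: "e n \<in> partial_isos M R"
  using e by (simp add: gen_seq_def)

lemma walk_piso: "walk e i \<in> partial_isos M R"
proof -
  have "word (interleave_inverses e) (space M) w \<in> partial_isos M R" for w
  proof (induction w)
    case (Cons n w)
    then show ?case using piso_comp[OF interleave_piso[of e, OF gen_seq_piso]] by simp
  qed (simp add: piso_id)
  then show ?thesis by (simp add: walk_def)
qed

lemma walk_path:
  assumes "walk e i x = Some y" shows "(x, y) \<in> (sym_graph e)\<^sup>*"
proof -
  have sg: "sym_graph e = (\<Union>n. Map.graph (interleave_inverses e n))"
    by (rule sym_graph_interleave[OF piso_inj[OF gen_seq_piso]])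
  have "word (interleave_inverses e) (space M) w x = Some y \<Longrightarrow> (x, y) \<in> (sym_graph e)\<^sup>*" for w
  proof (induction w arbitrary: x)
    case Nil
    then show ?case by (simp add: restrict_map_def split: if_splits)
  next
    case (Cons n w)
    then obtain z where z: "interleave_inverses e n x = Some z"
      "word (interleave_inverses e) (space M) w z = Some y"
      by (auto simp: map_comp_Some_iff)
    then have "(x, z) \<in> sym_graph e" by (auto simp: sg graph_iff)
    then show ?case using Cons.IH[OF z(2)] by (rule converse_rtrancl_into_rtrancl)
  qed
  then show ?thesis using assms by (simp add: walk_def)
qed

lemma path_walk:
  assumes "(x, y) \<in> (sym_graph e)\<^sup>*" "x \<in> space M"
  shows "\<exists>i. walk e i x = Some y"
proof -
  have sg: "sym_graph e = (\<Union>n. Map.graph (interleave_inverses e n))"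
    by (rule sym_graph_interleave[OF piso_inj[OF gen_seq_piso]])
  have "x \<in> space M \<longrightarrow> (\<exists>w. word (interleave_inverses e) (space M) w x = Some y)"
    using assms(1)
  proof (induction rule: converse_rtrancl_induct)
    case base
    have "y \<in> space M \<Longrightarrow> word (interleave_inverses e) (space M) [] y = Some y" by simp
    then show ?case by blast
  next
    case (step x z)
    then obtain n where n: "interleave_inverses e n x = Some z" by (auto simp: sg graph_iff)
    then have "z \<in> space M" using pisoD(2)[OF interleave_piso[of e, OF gen_seq_piso] n] R_sub by auto
    then obtain w where "word (interleave_inverses e) (space M) w z = Some y"
      using step.IH by blast
    then have "word (interleave_inverses e) (space M) (n # w) x = Some y"
      using n by (simp add: map_comp_Some_iff)
    then show ?case by blast
  qed
  then obtain w where "word (interleave_inverses e) (space M) w x = Some y" using assms(2) by blast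
  then have "walk e (to_nat w) x = Some y" by (simp add: walk_def)
  then show ?thesis ..
qed

lemma walk_id: "x \<in> space M \<Longrightarrow> \<exists>i. walk e i x = Some x"
  by (rule path_walk) simp_all

end

text \<open>All points that some walk takes into the bad set are removed. They form a countable
  union of null preimages, and what remains is closed under \<open>R\<close>, so almost sure
  statements hold there along whole classes.\<close>

lemma conull_invariant:
  assumes e: "gen_seq e" and N: "N \<in> null_sets M"
  obtains X0 where "X0 \<in> sets M" "space M - X0 \<in> null_sets M" "X0 \<inter> N = {}"
    "\<And>x y. x \<in> X0 \<Longrightarrow> (x, y) \<in> R \<Longrightarrow> y \<in> X0"
    "\<And>x y. x \<in> X0 \<Longrightarrow> (x, y) \<in> R \<Longrightarrow> (x, y) \<in> (sym_graph e)\<^sup>*"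
proof -
  from e have "AE x in M. \<forall>y. (x, y) \<in> R \<longrightarrow> (x, y) \<in> (sym_graph e)\<^sup>*" by (simp add: gen_seq_def)
  then obtain N0 where N0: "N0 \<in> null_sets M"
    and gen: "{x \<in> space M. \<not> (\<forall>y. (x, y) \<in> R \<longrightarrow> (x, y) \<in> (sym_graph e)\<^sup>*)} \<subseteq> N0"
    by (auto elim!: AE_E intro: null_setsI)
  define N1 where "N1 = N0 \<union> N"
  have N1: "N1 \<in> null_sets M" unfolding N1_def using N0 N by (rule null_sets.Un)
  define N' where "N' = (\<Union>i. {x \<in> dom (walk e i). tot (walk e i) x \<in> N1})"
  have N'_iff: "x \<in> N' \<longleftrightarrow> (\<exists>i z. walk e i x = Some z \<and> z \<in> N1)" for x
    by (simp add: N'_def dom_tot_iff)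
  have N': "N' \<in> null_sets M"
    unfolding N'_def by (rule null_sets_UN) (rule piso_pre_null[OF walk_piso[OF e] N1])
  have N1N': "x \<notin> N1" if "x \<in> space M - N'" for x
  proof
    assume x: "x \<in> N1"
    obtain i where "walk e i x = Some x" using walk_id[OF e, of x] \<open>x \<in> space M - N'\<close> by blast
    then have "x \<in> N'" unfolding N'_iff using x by (intro exI conjI)
    then show False using that by simp
  qed
  have gen': "(x, y) \<in> (sym_graph e)\<^sup>*" if "x \<in> space M - N'" "(x, y) \<in> R" for x y
    using N1N'[OF that(1)] that gen by (auto simp: N1_def)
  show thesis
  proof (rule that[of "space M - N'"])
    show "space M - N' \<in> sets M" using N' by auto
    have "space M - (space M - N') = N'" using sets.sets_into_space N' by blast
    then show "space M - (space M - N') \<in> null_sets M" using N' by simp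
    show "(space M - N') \<inter> N = {}" using N1N' by (auto simp: N1_def)
    show "(x, y) \<in> (sym_graph e)\<^sup>*" if "x \<in> space M - N'" "(x, y) \<in> R" for x y
      using gen'[OF that] .
    show "y \<in> space M - N'" if "x \<in> space M - N'" "(x, y) \<in> R" for x y
    proof
      show "y \<in> space M" using that(2) R_sub by auto
      show "y \<notin> N'"
      proof
        assume "y \<in> N'"
        then obtain i z where z: "walk e i y = Some z" "z \<in> N1" by (auto simp: N'_iff)
        \<comment> \<open>A walk of \<open>y\<close> into the bad set, preceded by a path from
          \<open>x\<close> to \<open>y\<close>, would be such a walk of \<open>x\<close>.\<close>
        have "(x, z) \<in> (sym_graph e)\<^sup>*"
          using gen'[OF that] walk_path[OF e z(1)] by (rule rtrancl_trans)
        then have "\<exists>j. walk e j x = Some z" using that(1) by (intro path_walk[OF e]) simp_all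
        then obtain j where "walk e j x = Some z" by (rule exE)
        then have "x \<in> N'" unfolding N'_iff using z(2) by (intro exI conjI)
        then show False using that(1) by simp
      qed
    qed
  qed
qed

text \<open>The saturation of \<open>B\<close> is replaced by the set of points with a walk into
  \<open>B\<close>, which is measurable; cut down to an invariant conull set it is exactly
  \<open>R\<close>-saturated, as ergodicity demands.\<close>

lemma ergodic_saturation:
  assumes erg: "ergodic_rel M R" and e: "gen_seq e" and B: "B \<in> sets M" "emeasure M B \<noteq> 0"
  shows "AE x in M. \<exists>i y. walk e i x = Some y \<and> y \<in> B"
proof -
  obtain X0 where X0: "X0 \<in> sets M" "space M - X0 \<in> null_sets M"
    "\<And>x y. x \<in> X0 \<Longrightarrow> (x, y) \<in> R \<Longrightarrow> y \<in> X0"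
    "\<And>x y. x \<in> X0 \<Longrightarrow> (x, y) \<in> R \<Longrightarrow> (x, y) \<in> (sym_graph e)\<^sup>*"
    using conull_invariant[OF e, of "{}"] by auto
  define S where "S = (\<Union>i. {x \<in> dom (walk e i). tot (walk e i) x \<in> B})"
  have S_iff: "x \<in> S \<longleftrightarrow> (\<exists>i y. walk e i x = Some y \<and> y \<in> B)" for x
    by (simp add: S_def dom_tot_iff)
  have Sm: "S \<in> sets M"
    unfolding S_def using iso_pre[OF pisoD(1)[OF walk_piso[OF e]] B(1)] by blast
  have sp: "x \<in> space M" if "x \<in> X0" for x using that sets.sets_into_space[OF X0(1)] by blast
  have "R `` (S \<inter> X0) = S \<inter> X0"
  proof
    show "R `` (S \<inter> X0) \<subseteq> S \<inter> X0"
    proof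
      fix y assume "y \<in> R `` (S \<inter> X0)"
      then obtain x where x: "x \<in> S" "x \<in> X0" "(x, y) \<in> R" by blast
      then obtain i z where z: "walk e i x = Some z" "z \<in> B" by (auto simp: S_iff)
      have y: "y \<in> X0" using X0(3) x by blast
      have "(y, z) \<in> R" using R_trans[OF R_sym[OF x(3)] pisoD(2)[OF walk_piso[OF e] z(1)]] .
      then have "(y, z) \<in> (sym_graph e)\<^sup>*" using X0(4) y by blast
      then obtain j where "walk e j y = Some z" using path_walk[OF e _ sp[OF y]] by blast
      then have "y \<in> S" unfolding S_iff using z(2) by (intro exI conjI)
      then show "y \<in> S \<inter> X0" using y by simp
    qed
    show "S \<inter> X0 \<subseteq> R `` (S \<inter> X0)" using R_refl sp by blast
  qed
  then have "emeasure M (S \<inter> X0) = 0 \<or> emeasure M (S \<inter> X0) = 1"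
    using erg Sm X0(1) unfolding ergodic_rel_def by blast
  moreover have "emeasure M (S \<inter> X0) \<noteq> 0"
  proof
    assume "emeasure M (S \<inter> X0) = 0"
    then have "S \<inter> X0 \<in> null_sets M" using Sm X0(1) by (simp add: null_sets_def sets.Int)
    then have "(S \<inter> X0) \<union> (space M - X0) \<in> null_sets M" using X0(2) by (rule null_sets.Un)
    moreover have "B \<subseteq> (S \<inter> X0) \<union> (space M - X0)"
    proof
      fix x assume x: "x \<in> B"
      then have "x \<in> space M" using sets.sets_into_space[OF B(1)] by blast
      then obtain i where "walk e i x = Some x" using walk_id[OF e, of x] by blast
      then have "x \<in> S" unfolding S_iff using x by (intro exI conjI)
      then show "x \<in> (S \<inter> X0) \<union> (space M - X0)" using \<open>x \<in> space M\<close> by simp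
    qed
    ultimately have "B \<in> null_sets M" using B(1) null_sets_subset by blast
    then show False using B(2) by auto
  qed
  ultimately have "prob (S \<inter> X0) = 1" by (simp add: measure_def)
  then have "AE x in M. x \<in> S \<inter> X0" by (rule AE_prob_1)
  then show ?thesis by eventually_elim (simp add: S_iff)
qed

lemma ergodic_transport:
  assumes erg: "ergodic_rel M R" and e: "gen_seq e"
    and YZ: "Y \<in> sets M" "Z \<in> sets M" "emeasure M Y = emeasure M Z"
  obtains \<theta> where "\<theta> \<in> partial_isos M R" "dom \<theta> \<subseteq> Y" "ran \<theta> \<subseteq> Z" "Y - dom \<theta> \<in> null_sets M"
proof -
  define h where "h = walk e"
  have ph: "h n \<in> partial_isos M R" for n unfolding h_def by (rule walk_piso[OF e])
  \<comment> \<open>The pair consists of the points of \<open>Y\<close> and of \<open>Z\<close>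
    consumed before stage n.\<close>
  define used where "used = rec_nat ({}, {}) (\<lambda>n (U, W).
    (U \<union> {x \<in> dom (h n). x \<in> Y - U \<and> tot (h n) x \<in> Z - W},
     W \<union> tot (h n) ` {x \<in> dom (h n). x \<in> Y - U \<and> tot (h n) x \<in> Z - W}))"
  define U where "U n = fst (used n)" for n
  define W where "W n = snd (used n)" for n
  define D where "D n = {x \<in> dom (h n). x \<in> Y - U n \<and> tot (h n) x \<in> Z - W n}" for n
  have U0: "U 0 = {}" "W 0 = {}" by (simp_all add: U_def W_def used_def)
  have US: "U (Suc n) = U n \<union> D n" "W (Suc n) = W n \<union> tot (h n) ` D n" for n
    by (simp_all add: U_def W_def D_def used_def split_beta)
  have Dsub: "D n \<subseteq> dom (h n)" for n by (auto simp: D_def)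
  have Deq: "D n = {x \<in> dom (h n). tot (h n) x \<in> Z - W n} \<inter> (Y - U n)" for n
    by (auto simp: D_def)
  have UW: "U n \<in> sets M \<and> W n \<in> sets M \<and> D n \<in> sets M" for n
  proof (induction n)
    case 0
    have "D 0 \<in> sets M" unfolding Deq U0 using YZ
      by (intro sets.Int[OF iso_pre[OF pisoD(1)[OF ph]]]) auto
    then show ?case by (simp add: U0)
  next
    case (Suc n)
    then have *: "U (Suc n) \<in> sets M" "W (Suc n) \<in> sets M"
      unfolding US using iso_image[OF pisoD(1)[OF ph] _ Dsub] by (auto intro: sets.Un)
    have "D (Suc n) \<in> sets M" unfolding Deq using YZ *
      by (intro sets.Int[OF iso_pre[OF pisoD(1)[OF ph]]]) auto
    then show ?case using * by simp
  qed
  define k where "k n = h n |` D n" for n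
  have pk: "k n \<in> partial_isos M R" for n
    unfolding k_def using piso_restrict[OF ph] UW by blast
  have dk: "dom (k n) = D n" for n using Dsub by (auto simp: k_def)
  have rk: "ran (k n) = tot (h n) ` D n" for n
    unfolding tot_image[OF Dsub] by (auto simp: k_def ran_def restrict_map_def)
  have incl: "D m \<subseteq> U n \<and> tot (h m) ` D m \<subseteq> W n" if "m < n" for m n
    using that by (induction n) (auto simp: US less_Suc_eq)
  have dj: "D m \<inter> D n = {} \<and> tot (h m) ` D m \<inter> tot (h n) ` D n = {}" if "m < n" for m n
  proof -
    have "D n \<inter> U n = {}" "tot (h n) ` D n \<inter> W n = {}" by (auto simp: D_def)
    then show ?thesis using incl[OF that] by blast
  qed
  have djn: "dom (k m) \<inter> dom (k n) = {}" "ran (k m) \<inter> ran (k n) = {}" if "m \<noteq> n" for m n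
    using that dj[of m n] dj[of n m] unfolding dk rk by (auto simp: neq_iff)
  obtain \<theta> where \<theta>: "partial_borel_iso M \<theta>" "\<And>x y. \<theta> x = Some y \<longleftrightarrow> (\<exists>n. k n x = Some y)"
    using iso_glue[of M k, OF pisoD(1)[OF pk]] djn by metis
  have p\<theta>: "\<theta> \<in> partial_isos M R"
    by (rule pisoI[OF \<theta>(1)]) (use \<theta>(2) pisoD(2)[OF pk] in blast)
  have d\<theta>: "dom \<theta> = (\<Union>n. D n)"
  proof -
    have "dom \<theta> = (\<Union>n. dom (k n))" using \<theta>(2) by (auto simp: dom_def simp del: not_None_eq) (metis not_None_eq option.distinct(1))+
    then show ?thesis by (simp add: dk)
  qed
  have r\<theta>: "ran \<theta> = (\<Union>n. tot (h n) ` D n)"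
  proof -
    have "ran \<theta> = (\<Union>n. ran (k n))" unfolding ran_def using \<theta>(2) by auto
    then show ?thesis by (simp add: rk)
  qed
  have sub: "dom \<theta> \<subseteq> Y" "ran \<theta> \<subseteq> Z" unfolding d\<theta> r\<theta> by (auto simp: D_def)
  have Y': "Y - dom \<theta> \<in> sets M" "Z - ran \<theta> \<in> sets M"
    using YZ piso_dom[OF p\<theta>] piso_ran[OF p\<theta>] by auto
  have "emeasure M (Y - dom \<theta>) = emeasure M Y - emeasure M (dom \<theta>)"
    by (rule emeasure_Diff[OF _ YZ(1) piso_dom[OF p\<theta>] sub(1)]) simp
  moreover have "emeasure M (Z - ran \<theta>) = emeasure M Z - emeasure M (ran \<theta>)"
    by (rule emeasure_Diff[OF _ YZ(2) piso_ran[OF p\<theta>] sub(2)]) simp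
  ultimately have eq: "emeasure M (Z - ran \<theta>) = emeasure M (Y - dom \<theta>)"
    using YZ(3) piso_ran_measure[OF p\<theta>] by simp
  have "emeasure M (Y - dom \<theta>) = 0"
  proof (rule ccontr)
    assume pos: "emeasure M (Y - dom \<theta>) \<noteq> 0"
    then have ae: "AE x in M. \<exists>i y. h i x = Some y \<and> y \<in> Z - ran \<theta>"
      unfolding h_def by (intro ergodic_saturation[OF erg e Y'(2)]) (simp add: eq)
    have nae: "\<not> (AE x in M. x \<notin> Y - dom \<theta>)"
      using pos Y'(1) AE_iff_null_sets[OF Y'(1)] by auto
    have "\<exists>x. x \<in> Y - dom \<theta> \<and> (\<exists>i y. h i x = Some y \<and> y \<in> Z - ran \<theta>)"
    proof -
      have "AE x in M. x \<notin> Y - dom \<theta>" if "\<not> ?thesis"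
        using ae by (rule eventually_mono) (use that in blast)
      then show ?thesis using nae by blast
    qed
    then obtain x i y where x: "x \<in> Y - dom \<theta>" "h i x = Some y" "y \<in> Z - ran \<theta>" by blast
    have "U i \<subseteq> dom \<theta>" "W i \<subseteq> ran \<theta>"
    proof -
      have "U i \<subseteq> (\<Union>n. D n) \<and> W i \<subseteq> (\<Union>n. tot (h n) ` D n)"
        by (induction i) (auto simp: U0 US)
      then show "U i \<subseteq> dom \<theta>" "W i \<subseteq> ran \<theta>" by (auto simp: d\<theta> r\<theta>)
    qed
    then have "x \<in> D i" using x by (auto simp: D_def tot_Some)
    then show False using x(1) by (auto simp: d\<theta>)
  qed
  then have "Y - dom \<theta> \<in> null_sets M" using Y'(1) by (simp add: null_sets_def)
  then show thesis using that p\<theta> sub by blast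
qed

text \<open>Cuts at quantiles of the law of \<open>f\<close>. As \<open>f\<close> is injective, an
  atom of this law would be a single point of positive measure; hence the distribution function is
  continuous and takes every value strictly between 0 and 1.\<close>

lemma equal_partition:
  assumes atomless: "atomless M" and N: "N > 0"
  obtains X where "\<And>i. X i \<in> sets M" "\<And>i. i < N \<Longrightarrow> emeasure M (X i) = ennreal (1 / real N)"
    "\<And>i j. i < N \<Longrightarrow> j < N \<Longrightarrow> i \<noteq> j \<Longrightarrow> X i \<inter> X j = {}"
proof -
  define L where "L = distr M borel f"
  interpret L: real_distribution L
    unfolding L_def by (rule real_distribution_distr[OF f_measurable])
  have "isCont (cdf L) t" for t
  proof -
    let ?S = "f -` {t} \<inter> space M"
    have S: "?S \<in> sets M" by (rule measurable_sets[OF f_measurable borel_closed[OF closed_singleton]])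
    have sing: "x = y" if "x \<in> ?S" "y \<in> ?S" for x y using that f_inj by (auto simp: inj_on_def)
    have "emeasure M ?S = 0"
    proof (rule ccontr)
      assume "emeasure M ?S \<noteq> 0"
      then have "emeasure M ?S > 0" by (simp add: zero_less_iff_neq_zero)
      then obtain B where B: "B \<in> sets M" "B \<subseteq> ?S" "0 < emeasure M B" "emeasure M B < emeasure M ?S"
        using atomless S unfolding atomless_def by blast
      have "B \<noteq> {}" using B(3) by auto
      then have "B = ?S" using B(2) sing by blast
      then show False using B(4) by simp
    qed
    moreover have "emeasure L {t} = emeasure M ?S"
      unfolding L_def by (rule emeasure_distr[OF f_measurable borel_closed[OF closed_singleton]])
    ultimately have "measure L {t} = 0" by (simp add: measure_def)
    then show ?thesis by (simp add: L.isCont_cdf)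
  qed
  then have cont: "continuous_on UNIV (cdf L)" by (simp add: continuous_on_eq_continuous_at)
  have ex: "\<exists>t. cdf L t = c" if "0 < c" "c < 1" for c
  proof -
    have "eventually (\<lambda>t. cdf L t < c) at_bot"
      using L.cdf_lim_at_bot that(1) by (rule order_tendstoD(2))
    then obtain a where a: "cdf L a < c" by (metis eventually_happens trivial_limit_at_bot_linorder)
    have "eventually (\<lambda>t. c < cdf L t) at_top"
      using L.cdf_lim_at_top_prob that(2) by (rule order_tendstoD(1))
    then obtain b where b: "c < cdf L b" by (metis eventually_happens trivial_limit_at_top_linorder)
    have "a \<le> b"
    proof (rule ccontr)
      assume "\<not> a \<le> b"
      then have "cdf L b \<le> cdf L a" by (intro L.cdf_nondecreasing) simp
      then show False using a b by simp
    qed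
    then have "\<exists>t. a \<le> t \<and> t \<le> b \<and> cdf L t = c"
      using a b cont by (intro IVT') (auto intro: continuous_on_subset)
    then show ?thesis by blast
  qed
  have "\<forall>i. \<exists>t. 0 < i \<and> i < N \<longrightarrow> cdf L t = real i / real N"
    using ex N by (simp add: divide_less_eq)
  then obtain t where t: "\<And>i. 0 < i \<Longrightarrow> i < N \<Longrightarrow> cdf L (t i) = real i / real N" by metis
  \<comment> \<open>The values 0 and 1 need not be attained by the distribution function, so both
    ends are set by hand.\<close>
  define S where "S i = (if i = 0 then {} else if i < N then {x \<in> space M. f x \<le> t i} else space M)" for i
  have [measurable]: "f \<in> borel_measurable M" by (rule f_measurable)
  have Sm: "S i \<in> sets M" for i unfolding S_def by (auto) measurable
  have Sp: "prob (S i) = real i / real N" if "i \<le> N" for i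
  proof -
    have "prob {x \<in> space M. f x \<le> t i} = real i / real N" if "0 < i" "i < N"
    proof -
      have "{x \<in> space M. f x \<le> t i} = f -` {..t i} \<inter> space M" by auto
      then have "cdf L (t i) = prob {x \<in> space M. f x \<le> t i}"
        unfolding cdf_def L_def using measure_distr[OF f_measurable borel_closed[OF closed_atMost]] by simp
      then show ?thesis using t[OF that] by simp
    qed
    then show ?thesis using \<open>i \<le> N\<close> N prob_space by (auto simp: S_def)
  qed
  have Smono: "S i \<subseteq> S j" if "i \<le> j" for i j
  proof (cases "0 < i \<and> i < j \<and> j < N")
    case True
    have "t i \<le> t j"
    proof (rule ccontr)
      assume "\<not> t i \<le> t j"
      then have "cdf L (t j) \<le> cdf L (t i)" by (intro L.cdf_nondecreasing) simp
      then have "real j / real N \<le> real i / real N" using t[of i] t[of j] True by simp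
      then show False using True N by (simp add: divide_le_cancel)
    qed
    then show ?thesis using True by (auto simp: S_def)
  next
    case False
    then show ?thesis using that by (auto simp: S_def)
  qed
  show thesis
  proof (rule that[of "\<lambda>i. S (Suc i) - S i"])
    show "S (Suc i) - S i \<in> sets M" for i using Sm by (rule sets.Diff) (rule Sm)
    show "emeasure M (S (Suc i) - S i) = ennreal (1 / real N)" if "i < N" for i
    proof -
      have "prob (S (Suc i) - S i) = prob (S (Suc i)) - prob (S i)"
        by (rule finite_measure_Diff[OF Sm Sm Smono]) simp
      also have "\<dots> = 1 / real N" using Sp[of i] Sp[of "Suc i"] that
        by (simp add: diff_divide_distrib[symmetric])
      finally show ?thesis by (simp add: emeasure_eq_measure)
    qed
    show "(S (Suc i) - S i) \<inter> (S (Suc j) - S j) = {}" if "i < N" "j < N" "i \<noteq> j" for i j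
      using that Smono[of "Suc i" j] Smono[of "Suc j" i] by (cases "i < j") auto
  qed
qed

end

section \<open>Contracting a generating system\<close>

context pmp_rel
begin

text \<open>Transport reaches a piece only up to null sets. The points missed by one of the finitely
  many transports are removed from \<open>Y\<close>, so that all of them have the domain
  \<open>Y\<close> exactly.\<close>

lemma ergodic_rotations:
  assumes erg: "ergodic_rel M R" and e: "gen_seq e" and atomless: "atomless M" and N: "N > 0"
  obtains \<theta> Y where "\<And>i::nat. \<theta> i \<in> partial_isos M R" "\<And>i. i < N \<Longrightarrow> dom (\<theta> i) = Y"
    "\<And>i j. i < N \<Longrightarrow> j < N \<Longrightarrow> i \<noteq> j \<Longrightarrow> ran (\<theta> i) \<inter> ran (\<theta> j) = {}"
    "\<And>y. y \<in> Y \<Longrightarrow> \<theta> 0 y = Some y" "Y \<in> sets M" "emeasure M Y = ennreal (1 / real N)"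
proof -
  obtain X where X: "\<And>i. X i \<in> sets M" "\<And>i. i < N \<Longrightarrow> emeasure M (X i) = ennreal (1 / real N)"
    "\<And>i j. i < N \<Longrightarrow> j < N \<Longrightarrow> i \<noteq> j \<Longrightarrow> X i \<inter> X j = {}"
    by (rule equal_partition[OF atomless N]) (rule that)
  have "\<forall>i. \<exists>\<eta>. i < N \<longrightarrow> \<eta> \<in> partial_isos M R \<and> dom \<eta> \<subseteq> X 0 \<and> ran \<eta> \<subseteq> X i \<and> X 0 - dom \<eta> \<in> null_sets M"
  proof
    fix i
    show "\<exists>\<eta>. i < N \<longrightarrow> \<eta> \<in> partial_isos M R \<and> dom \<eta> \<subseteq> X 0 \<and> ran \<eta> \<subseteq> X i \<and> X 0 - dom \<eta> \<in> null_sets M"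
    proof (cases "i < N")
      case True
      then have "emeasure M (X 0) = emeasure M (X i)" using X(2) N by simp
      then obtain \<eta> where "\<eta> \<in> partial_isos M R" "dom \<eta> \<subseteq> X 0" "ran \<eta> \<subseteq> X i" "X 0 - dom \<eta> \<in> null_sets M"
        by (rule ergodic_transport[OF erg e X(1) X(1)])
      then show ?thesis by blast
    qed simp
  qed
  then obtain \<eta> where "\<forall>i. i < N \<longrightarrow> \<eta> i \<in> partial_isos M R \<and> dom (\<eta> i) \<subseteq> X 0 \<and> ran (\<eta> i) \<subseteq> X i
      \<and> X 0 - dom (\<eta> i) \<in> null_sets M" by (rule choice[THEN exE])
  then have \<eta>: "\<And>i. i < N \<Longrightarrow> \<eta> i \<in> partial_isos M R" "\<And>i. i < N \<Longrightarrow> dom (\<eta> i) \<subseteq> X 0"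
    "\<And>i. i < N \<Longrightarrow> ran (\<eta> i) \<subseteq> X i" "\<And>i. i < N \<Longrightarrow> X 0 - dom (\<eta> i) \<in> null_sets M"
    by simp_all
  define Z where "Z = (\<Union>i<N. X 0 - dom (\<eta> i))"
  have Z: "Z \<in> null_sets M"
    unfolding Z_def using \<eta>(4) by (intro null_sets_UN') auto
  define Y where "Y = X 0 - Z"
  have Ym: "Y \<in> sets M" unfolding Y_def using X(1) Z by auto
  have Yd: "Y \<subseteq> dom (\<eta> i)" if "i < N" for i using that by (auto simp: Y_def Z_def)
  \<comment> \<open>Index 0 is the identity, so that \<open>Y\<close> itself is one of the
    pieces.\<close>
  define \<theta> where "\<theta> i = (if i = 0 then (Some |` space M) |` Y else if i < N then \<eta> i |` Y else Map.empty)"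
    for i
  have Ysp: "Y \<subseteq> space M" using sets.sets_into_space[OF Ym] .
  show thesis
  proof (rule that[of \<theta> Y])
    show "\<theta> i \<in> partial_isos M R" for i
      unfolding \<theta>_def using piso_restrict[OF piso_id Ym] piso_restrict[OF \<eta>(1) Ym] piso_empty by simp
    show "dom (\<theta> i) = Y" if "i < N" for i
      unfolding \<theta>_def using that Yd Ysp by auto
    have r: "ran (\<theta> i) \<subseteq> X i" if "i < N" for i
    proof (cases "i = 0")
      case True
      then show ?thesis by (auto simp: \<theta>_def ran_def restrict_map_def Y_def split: if_splits)
    next
      case False
      have "ran (\<eta> i |` Y) \<subseteq> ran (\<eta> i)" by (auto simp: ran_def restrict_map_def split: if_splits)
      then show ?thesis using False \<eta>(3)[OF that] that by (auto simp: \<theta>_def)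
    qed
    show "ran (\<theta> i) \<inter> ran (\<theta> j) = {}" if "i < N" "j < N" "i \<noteq> j" for i j
      using r[OF that(1)] r[OF that(2)] X(3)[OF that] by blast
    show "\<theta> 0 y = Some y" if "y \<in> Y" for y
      using that Ysp by (auto simp: \<theta>_def restrict_map_def)
    show "Y \<in> sets M" by (rule Ym)
    show "emeasure M Y = ennreal (1 / real N)"
      unfolding Y_def using X(2)[OF N] emeasure_Diff_null_set[OF Z X(1)] by simp
  qed
qed

text \<open>The piece of index i is shifted by j modulo \<open>N\<close> over the same base point
  \<open>y\<close>. The identity on the remaining set completes the map, since an element of the
  full group must be defined at every point.\<close>

lemma rotation_full_group:
  fixes \<theta> :: "nat \<Rightarrow> 'a \<rightharpoonup> 'a"
  assumes \<theta>: "\<And>i. \<theta> i \<in> partial_isos M R" "\<And>i. i < N \<Longrightarrow> dom (\<theta> i) = Y"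
    "\<And>i j. i < N \<Longrightarrow> j < N \<Longrightarrow> i \<noteq> j \<Longrightarrow> ran (\<theta> i) \<inter> ran (\<theta> j) = {}"
    and j: "j < N"
  obtains \<phi> where "\<phi> \<in> full_group M R"
    "\<And>i y. i < N \<Longrightarrow> y \<in> Y \<Longrightarrow>
       \<phi> (tot (\<theta> i) y) = Some (tot (\<theta> (if i + j < N then i + j else i + j - N)) y)"
proof -
  define r where "r i = (if i + j < N then i + j else i + j - N)" for i
  have r: "r i < N" if "i < N" for i using that j by (auto simp: r_def)
  have r_inj: "r i \<noteq> r i'" if "i < N" "i' < N" "i \<noteq> i'" for i i' using that by (auto simp: r_def)
  have r_surj: "\<exists>i<N. r i = i'" if "i' < N" for i'
  proof
    show "(if j \<le> i' then i' - j else i' + N - j) < N \<and> r (if j \<le> i' then i' - j else i' + N - j) = i'"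
      using that j by (auto simp: r_def)
  qed
  define X' where "X' = (\<Union>i<N. ran (\<theta> i))"
  have X'm: "X' \<in> sets M" unfolding X'_def using piso_ran[OF \<theta>(1)] by auto
  have inj: "pinj (\<theta> i)" for i by (rule piso_inj[OF \<theta>(1)])
  define C where "C = space M - X'"
  have Cm: "C \<in> sets M" unfolding C_def using X'm by auto
  \<comment> \<open>Index \<open>N\<close> carries the leftover set and later indices are empty,
    which turns finitely many parts into a sequence for \<open>iso_glue\<close>.\<close>
  define k where "k i = (if i < N then \<theta> (r i) \<circ>\<^sub>m pinv (\<theta> i)
      else if i = N then (Some |` space M) |` C else Map.empty)" for i
  have pk: "k i \<in> partial_isos M R" for i
    unfolding k_def using piso_comp[OF piso_pinv[OF \<theta>(1)] \<theta>(1)] piso_restrict[OF piso_id Cm] piso_empty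
    by simp
  have k1: "k i x = Some z \<longleftrightarrow> (\<exists>y. \<theta> i y = Some x \<and> \<theta> (r i) y = Some z)" if "i < N" for i x z
    using that by (auto simp: k_def map_comp_Some_iff pinv_iff[OF inj])
  have k2: "k N x = Some z \<longleftrightarrow> x \<in> C \<and> z = x" for x z
    by (auto simp: k_def restrict_map_def C_def)
  have \<theta>e: "\<exists>z. \<theta> i y = Some z" if "i < N" "\<theta> i' y = Some x" "i' < N" for i i' x y
    using that \<theta>(2)[of i] \<theta>(2)[of i'] by (metis domD domI)
  have dk: "dom (k i) = ran (\<theta> i)" "ran (k i) = ran (\<theta> (r i))" if i: "i < N" for i
  proof -
    have 1: "\<exists>z. k i x = Some z" if y: "\<theta> i y = Some x" for x y
    proof -
      obtain z where "\<theta> (r i) y = Some z" using \<theta>e[OF r[OF i] y i] by (rule exE)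
      with y have "k i x = Some z" unfolding k1[OF i] by (intro exI conjI)
      then show ?thesis by (rule exI)
    qed
    have 2: "\<exists>x. k i x = Some z" if y: "\<theta> (r i) y = Some z" for z y
    proof -
      obtain x where "\<theta> i y = Some x" using \<theta>e[OF i y r[OF i]] by (rule exE)
      then have "k i x = Some z" unfolding k1[OF i] using y by (intro exI conjI)
      then show ?thesis by (rule exI)
    qed
    show "dom (k i) = ran (\<theta> i)"
    proof (intro set_eqI iffI)
      fix x assume "x \<in> dom (k i)"
      then show "x \<in> ran (\<theta> i)" using k1[OF i] by (auto intro: ranI)
    next
      fix x assume "x \<in> ran (\<theta> i)"
      then obtain y where "\<theta> i y = Some x" by (auto simp: ran_def)
      from 1[OF this] show "x \<in> dom (k i)" by (auto intro: domI)
    qed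
    show "ran (k i) = ran (\<theta> (r i))"
    proof (intro set_eqI iffI)
      fix z assume "z \<in> ran (k i)"
      then show "z \<in> ran (\<theta> (r i))" using k1[OF i] by (auto simp: ran_def)
    next
      fix z assume "z \<in> ran (\<theta> (r i))"
      then obtain y where "\<theta> (r i) y = Some z" by (auto simp: ran_def)
      from 2[OF this] show "z \<in> ran (k i)" by (auto intro: ranI)
    qed
  qed
  have dkN: "dom (k N) = C" "ran (k N) = C" by (auto simp: ran_def k2 dom_def)
  have dk0: "k i = Map.empty" if "i > N" for i using that by (simp add: k_def)
  have sub: "ran (\<theta> i) \<inter> C = {}" if "i < N" for i using that by (auto simp: C_def X'_def)
  have disj: "dom (k m) \<inter> dom (k n) = {}" "ran (k m) \<inter> ran (k n) = {}" if "m < n" for m n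
  proof -
    consider "n < N" | "n = N" | "n > N" by linarith
    then have "dom (k m) \<inter> dom (k n) = {} \<and> ran (k m) \<inter> ran (k n) = {}"
    proof cases
      case 1
      then show ?thesis using that dk \<theta>(3)[of m n] \<theta>(3)[of "r m" "r n"] r r_inj[of m n] by simp
    next
      case 2
      then show ?thesis using that dk dkN sub r by simp
    qed (simp add: dk0)
    then show "dom (k m) \<inter> dom (k n) = {}" "ran (k m) \<inter> ran (k n) = {}" by auto
  qed
  have disj': "dom (k m) \<inter> dom (k n) = {}" "ran (k m) \<inter> ran (k n) = {}" if "m \<noteq> n" for m n
    using disj[of m n] disj[of n m] that by (auto simp: neq_iff)
  obtain \<phi> where \<phi>: "partial_borel_iso M \<phi>" "\<And>x y. \<phi> x = Some y \<longleftrightarrow> (\<exists>n. k n x = Some y)"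
    by (rule iso_glue[of M k, OF pisoD(1)[OF pk] disj']) (simp, simp, rule that)
  have p\<phi>: "\<phi> \<in> partial_isos M R"
    by (rule pisoI[OF \<phi>(1)]) (use \<phi>(2) pisoD(2)[OF pk] in blast)
  have sp: "space M = X' \<union> C" using sets.sets_into_space[OF X'm] by (auto simp: C_def)
  have "space M \<subseteq> dom \<phi>"
  proof
    fix x assume x: "x \<in> space M"
    have "\<exists>n. x \<in> dom (k n)"
    proof (cases "x \<in> C")
      case False
      then obtain i where "i < N" "x \<in> ran (\<theta> i)" using x sp by (auto simp: X'_def)
      then show ?thesis using dk by blast
    qed (use dkN in blast)
    then obtain n z where "k n x = Some z" by blast
    then have "\<phi> x = Some z" unfolding \<phi>(2) by (rule exI)
    then show "x \<in> dom \<phi>" by (rule domI)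
  qed
  moreover have "space M \<subseteq> ran \<phi>"
  proof
    fix x assume x: "x \<in> space M"
    have "\<exists>n. x \<in> ran (k n)"
    proof (cases "x \<in> C")
      case False
      then obtain i' where i': "i' < N" "x \<in> ran (\<theta> i')" using x sp by (auto simp: X'_def)
      then obtain i where "i < N" "r i = i'" using r_surj by blast
      then show ?thesis using dk i' by blast
    qed (use dkN in blast)
    then obtain n z where "k n z = Some x" by (auto simp: ran_def)
    then have "\<phi> z = Some x" unfolding \<phi>(2) by (rule exI)
    then show "x \<in> ran \<phi>" by (rule ranI)
  qed
  moreover have "dom \<phi> \<subseteq> space M" "ran \<phi> \<subseteq> space M"
    using sets.sets_into_space piso_dom[OF p\<phi>] piso_ran[OF p\<phi>] by auto
  ultimately have "\<phi> \<in> full_group M R" using p\<phi> by (auto simp: full_group_def)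
  moreover have "\<phi> (tot (\<theta> i) y) = Some (tot (\<theta> (r i)) y)" if "i < N" "y \<in> Y" for i y
  proof -
    have "y \<in> dom (\<theta> i)" "y \<in> dom (\<theta> (r i))"
      using that \<theta>(2)[of i] \<theta>(2)[of "r i"] r[of i] by simp_all
    from this[THEN dom_tot]
    have "k i (tot (\<theta> i) y) = Some (tot (\<theta> (r i)) y)" unfolding k1[OF that(1)] by (intro exI conjI)
    then show ?thesis unfolding \<phi>(2) by (rule exI)
  qed
  ultimately show thesis by (rule that[unfolded r_def[symmetric]])
qed

text \<open>\<open>\<pi>\<close> slides points along parent edges to a root in \<open>Y\<close>.
  Parent edges collapse and drop out, one for almost every point outside \<open>Y\<close>; the other
  edges are carried to edges between roots without raising the cost.\<close>

lemma contraction: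
  assumes erg: "ergodic_rel M R" and e: "gen_seq e" and Y: "Y \<in> sets M" "emeasure M Y \<noteq> 0"
  obtains \<pi> \<Psi> where "\<And>n::nat. \<Psi> n \<in> partial_isos M R" "\<And>y. y \<in> Y \<Longrightarrow> \<pi> y = y"
    "\<And>y z. (y, z) \<in> sym_graph e \<Longrightarrow> (\<pi> y, \<pi> z) \<in> (sym_graph \<Psi>)\<^sup>*"
    "(\<Sum>n. emeasure M (dom (\<Psi> n))) + (1 - emeasure M Y) \<le> (\<Sum>n. emeasure M (dom (e n)))"
proof -
  note pe = gen_seq_piso[OF e]
  note inj = piso_inj[OF pe]
  define q where "q = interleave_inverses e"
  have pq: "q n \<in> partial_isos M R" for n unfolding q_def by (rule interleave_piso[of e, OF pe])
  have q2: "q (2 * n) = e n" "q (Suc (2 * n)) = pinv (e n)" for n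
    unfolding q_def by (rule interleave_even interleave_odd)+
  have sg: "sym_graph e = (\<Union>n. Map.graph (q n))"
    unfolding q_def by (rule sym_graph_interleave[of e, OF inj])

  \<comment> \<open>Distance to \<open>Y\<close> and choice of a parent edge\<close>
  define B where "B = rec_nat Y (\<lambda>k S. S \<union> (\<Union>n. {x \<in> dom (q n). tot (q n) x \<in> S}))"
  have B0: "B 0 = Y" by (simp add: B_def)
  have BS: "B (Suc k) = B k \<union> (\<Union>n. {x \<in> dom (q n). tot (q n) x \<in> B k})" for k by (simp add: B_def)
  have Bm: "B k \<in> sets M" for k
  proof (induction k)
    case (Suc k)
    have "(\<Union>n. {x \<in> dom (q n). tot (q n) x \<in> B k}) \<in> sets M"
      using iso_pre[OF pisoD(1)[OF pq] Suc] by blast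
    then show ?case unfolding BS using Suc by (rule sets.Un[rotated])
  qed (simp add: B0 Y)
  have Bmono: "B k \<subseteq> B k'" if "k \<le> k'" for k k'
    using that by (induction k' rule: dec_induct) (auto simp: BS)
  \<comment> \<open>The points at distance k + 1 from \<open>Y\<close> for which \<open>q n\<close>
    is the first map leading into \<open>B k\<close>; this map gives the parent edge.\<close>
  define P where "P k n = ({x \<in> dom (q n). tot (q n) x \<in> B k} - (\<Union>m<n. {x \<in> dom (q m). tot (q m) x \<in> B k})) - B k"
    for k n
  have Pm: "P k n \<in> sets M" for k n
    unfolding P_def using iso_pre[OF pisoD(1)[OF pq] Bm] Bm by (intro sets.Diff sets.finite_UN) auto
  have P_B: "P k n \<subseteq> B (Suc k) - B k" for k n by (auto simp: P_def BS)
  have P_disj: "k = k' \<and> n = n'" if "x \<in> P k n" "x \<in> P k' n'" for x k k' n n'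
  proof -
    have "k = k'"
    proof (rule ccontr)
      assume "k \<noteq> k'"
      then have "Suc k \<le> k' \<or> Suc k' \<le> k" by linarith
      then show False using P_B[of k n] P_B[of k' n'] that Bmono[of "Suc k" k'] Bmono[of "Suc k'" k] by blast
    qed
    moreover have "n = n'"
    proof (rule ccontr)
      assume "n \<noteq> n'"
      then show False using that \<open>k = k'\<close> by (cases "n < n'") (auto simp: P_def)
    qed
    ultimately show ?thesis by simp
  qed
  define T where "T n = (\<Union>k. P k n)" for n
  have Tm: "T n \<in> sets M" for n unfolding T_def using Pm by blast
  have T_disj: "n = n'" if "x \<in> T n" "x \<in> T n'" for x n n' using that P_disj by (auto simp: T_def)
  have Tdom: "x \<in> dom (q n)" if "x \<in> T n" for x n using that by (auto simp: T_def P_def)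
  have Tinf: "(\<Union>n. T n) = (\<Union>k. B k) - Y"
  proof
    show "(\<Union>n. T n) \<subseteq> (\<Union>k. B k) - Y"
    proof
      fix x assume "x \<in> (\<Union>n. T n)"
      then obtain n k where x: "x \<in> P k n" by (auto simp: T_def)
      have "Y \<subseteq> B k" using Bmono[of 0 k] by (simp add: B0)
      then show "x \<in> (\<Union>k. B k) - Y" using x P_B[of k n] by blast
    qed
    show "(\<Union>k. B k) - Y \<subseteq> (\<Union>n. T n)"
    proof
      fix x assume x: "x \<in> (\<Union>k. B k) - Y"
      then have ex: "\<exists>k. x \<in> B k" by blast
      define k where "k = (LEAST k. x \<in> B k)"
      have k: "x \<in> B k" unfolding k_def by (rule LeastI_ex[OF ex])
      have "k \<noteq> 0" using k x B0 by (metis DiffD2)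
      then obtain k' where k': "k = Suc k'" using not0_implies_Suc by blast
      then have nk': "x \<notin> B k'" using not_less_Least[of k' "\<lambda>k. x \<in> B k"] k_def by simp
      then have ex': "\<exists>n. x \<in> dom (q n) \<and> tot (q n) x \<in> B k'" using k unfolding k' BS by blast
      define n where "n = (LEAST n. x \<in> dom (q n) \<and> tot (q n) x \<in> B k')"
      have "x \<in> dom (q n) \<and> tot (q n) x \<in> B k'" unfolding n_def by (rule LeastI_ex[OF ex'])
      moreover have "\<not> (x \<in> dom (q m) \<and> tot (q m) x \<in> B k')" if "m < n" for m
        using that unfolding n_def by (rule not_less_Least)
      ultimately have "x \<in> P k' n" using nk' by (simp add: P_def)
      then show "x \<in> (\<Union>n. T n)" by (auto simp: T_def)
    qed
  qed
  define idx where "idx x = (LEAST n. x \<in> T n)" for x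
  have idx: "idx x = n" if "x \<in> T n" for x n
  proof -
    have "x \<in> T (idx x)" unfolding idx_def using that by (rule LeastI)
    then show ?thesis using that by (rule T_disj)
  qed
  define p where "p x = (if x \<in> (\<Union>n. T n) then tot (q (idx x)) x else x)" for x
  have p_T: "q n x = Some (p x)" if "x \<in> T n" for x n
    using dom_tot[OF Tdom[OF that]] that idx[OF that] by (auto simp: p_def)
  have tot_qp: "tot (q n) x = p x" if "x \<in> T n" for x n
    using p_T[OF that] by (rule tot_Some)
  have p_fix: "p x = x" if "x \<notin> (\<Union>n. T n)" for x using that by (simp add: p_def)
  have predI: "Measurable.pred M Q" if "{x \<in> space M. Q x} \<in> sets M" for Q
    using that by (simp only: pred_def)
  have pred_mem: "Measurable.pred M (\<lambda>x. x \<in> S)" if "S \<in> sets M" for S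
  proof (rule predI)
    have "{x \<in> space M. x \<in> S} = S" using sets.sets_into_space[OF that] by auto
    then show "{x \<in> space M. x \<in> S} \<in> sets M" using that by simp
  qed
  have idxm: "idx \<in> measurable M (count_space UNIV)"
    unfolding idx_def[abs_def] by (intro measurable_Least pred_mem Tm)
  have pm: "p \<in> measurable M M"
    unfolding p_def[abs_def]
  proof (rule measurable_If_set)
    show "(\<lambda>x. tot (q (idx x)) x) \<in> measurable M M"
      by (rule measurable_compose_countable[OF piso_tot[OF pq] idxm])
    show "(\<lambda>x. x) \<in> measurable M M" by (rule measurable_ident_sets[OF refl])
    show "(\<Union>n. T n) \<inter> space M \<in> sets M" using Tm by (intro sets.Int sets.countable_nat_UN) auto
  qed
  have p_B: "p x \<in> B k" if "x \<in> B (Suc k)" for x k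
  proof (cases "x \<in> (\<Union>n. T n)")
    case True
    then obtain n k' where x: "x \<in> P k' n" by (auto simp: T_def)
    then have xT: "x \<in> T n" by (auto simp: T_def)
    have "tot (q n) x \<in> B k'" using x by (simp add: P_def)
    then have "p x \<in> B k'" using tot_qp[OF xT] by simp
    moreover have "k' \<le> k"
    proof (rule ccontr)
      assume "\<not> k' \<le> k"
      then have "B (Suc k) \<subseteq> B k'" by (intro Bmono) simp
      then show False using that P_B[of k' n] x by blast
    qed
    ultimately show ?thesis using Bmono by blast
  next
    case False
    then have "x \<in> Y" using that unfolding Tinf by blast
    then show ?thesis using Bmono[of 0 k] p_fix[OF False] by (auto simp: B0)
  qed

  \<comment> \<open>The retraction onto the roots\<close>
  have p_Y: "p y = y" if "y \<in> Y" for y by (rule p_fix) (use that Tinf in blast)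
  have pow_Y: "(p ^^ k) y = y" if "y \<in> Y" for y k
    using that by (induction k) (simp_all add: p_Y)
  have pow_B: "(p ^^ k) x \<in> Y" if "x \<in> B k" for x k
    using that
  proof (induction k arbitrary: x)
    case (Suc k)
    then show ?case using p_B by (simp add: funpow_swap1)
  qed (simp add: B0)
  \<comment> \<open>Outside all \<open>B k\<close> the least index is an unspecified number; this is
    harmless, since \<open>p\<close> and all its powers fix such points.\<close>
  define lv where "lv x = (LEAST k. x \<in> B k)" for x
  define \<pi> where "\<pi> x = (p ^^ lv x) x" for x
  have lvm: "lv \<in> measurable M (count_space UNIV)"
    unfolding lv_def[abs_def] by (intro measurable_Least pred_mem Bm)
  have powm: "(p ^^ k) \<in> measurable M M" for k
  proof (induction k)
    case 0
    show ?case by (simp add: id_def measurable_ident_sets)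
  next
    case (Suc k)
    show ?case unfolding funpow.simps by (rule measurable_comp[OF Suc pm])
  qed
  have \<pi>m: "\<pi> \<in> measurable M M"
    unfolding \<pi>_def[abs_def] by (rule measurable_compose_countable[OF powm lvm])
  have \<pi>_B: "\<pi> x = (p ^^ k) x" if "x \<in> B k" for x k
  proof -
    have "x \<in> B (lv x)" unfolding lv_def using that by (rule LeastI)
    then have y: "(p ^^ lv x) x \<in> Y" by (rule pow_B)
    have "lv x \<le> k" unfolding lv_def using that by (rule Least_le)
    then have "(p ^^ k) x = (p ^^ (k - lv x)) ((p ^^ lv x) x)"
      by (metis comp_apply funpow_add le_add_diff_inverse2)
    then show ?thesis using pow_Y[OF y] by (simp add: \<pi>_def)
  qed
  have \<pi>_p: "\<pi> (p x) = \<pi> x" for x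
  proof (cases "x \<in> (\<Union>n. T n)")
    case True
    then obtain k where "x \<in> B k" unfolding Tinf by blast
    then have x: "x \<in> B (Suc k)" using Bmono[of k "Suc k"] by auto
    have "\<pi> x = (p ^^ k) (p x)" unfolding \<pi>_B[OF x] by (simp add: funpow_swap1)
    then show ?thesis using \<pi>_B[OF p_B[OF x]] by simp
  qed (simp add: p_fix)
  have \<pi>_Y: "\<pi> y = y" if "y \<in> Y" for y by (simp add: \<pi>_def pow_Y[OF that])
  have p_path: "(x, p x) \<in> (sym_graph e)\<^sup>*" for x
  proof (cases "x \<in> (\<Union>n. T n)")
    case True
    then obtain n where "x \<in> T n" by blast
    then have "(x, p x) \<in> sym_graph e" unfolding sg using p_T by (auto simp: graph_iff)
    then show ?thesis by (rule r_into_rtrancl)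
  qed (simp add: p_fix)
  have \<pi>_path: "(x, \<pi> x) \<in> (sym_graph e)\<^sup>*" for x
  proof -
    have "(x, (p ^^ k) x) \<in> (sym_graph e)\<^sup>*" for k
    proof (induction k)
      case (Suc k)
      then show ?case using p_path[of "(p ^^ k) x"] by (simp add: rtrancl_trans)
    qed simp
    then show ?thesis by (simp add: \<pi>_def)
  qed
  \<comment> \<open>\<open>\<pi>\<close> is not injective, but on each level set of \<open>c\<close>
    it agrees with a single walk, which is.\<close>
  define c where "c x = (LEAST i. walk e i x = Some (\<pi> x))" for x
  have c: "walk e (c x) x = Some (\<pi> x)" if "x \<in> space M" for x
    unfolding c_def by (rule LeastI_ex[OF path_walk[OF e \<pi>_path that]])
  have wm: "{x \<in> space M. walk e i x = Some (\<pi> x)} \<in> sets M" for i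
  proof -
    have "{x \<in> space M. walk e i x = Some (\<pi> x)} = dom (walk e i) \<inter> {x \<in> space M. tot (walk e i) x = \<pi> x}"
      using sets.sets_into_space[OF piso_dom[OF walk_piso[OF e]]]
      by (auto simp: tot_def split: option.splits)
    then show ?thesis
      using sets.Int[OF piso_dom[OF walk_piso[OF e]] eq_set[OF piso_tot[OF walk_piso[OF e]] \<pi>m]] by simp
  qed
  have cm: "c \<in> measurable M (count_space UNIV)"
    unfolding c_def[abs_def] by (intro measurable_Least predI wm)

  \<comment> \<open>The edges of the forest and the measure they save\<close>
  define E1 where "E1 n = {y \<in> dom (e n). tot (e n) y \<in> T (Suc (2 * n))}" for n
  have E1m: "E1 n \<in> sets M" for n
    unfolding E1_def by (rule iso_pre[OF pisoD(1)[OF pe] Tm])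
  have T2: "T (2 * n) \<subseteq> dom (e n)" for n using Tdom[of _ "2 * n"] by (auto simp: q2)
  \<comment> \<open>An odd index means that \<open>e n\<close> is traversed backwards: the image of
    \<open>y\<close> has \<open>y\<close> as its parent.\<close>
  have E1p: "p (tot (e n) y) = y" if "y \<in> E1 n" for y n
  proof -
    have y: "e n y = Some (tot (e n) y)" "tot (e n) y \<in> T (Suc (2 * n))"
      using that dom_tot[of y "e n"] by (simp_all add: E1_def)
    then have "pinv (e n) (tot (e n) y) = Some y" by (simp add: pinv_iff[OF inj])
    then show ?thesis using p_T[OF y(2)] by (simp add: q2)
  qed
  \<comment> \<open>If an edge of \<open>e n\<close> were the parent edge of both its ends,
    \<open>p\<close> would alternate between them and never reach \<open>Y\<close>.\<close>
  have E1_T: "E1 n \<inter> T (2 * n) = {}" for n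
  proof (rule equals0I)
    fix y assume "y \<in> E1 n \<inter> T (2 * n)"
    then have y: "y \<in> E1 n" "y \<in> T (2 * n)" by auto
    define x where "x = tot (e n) y"
    have px: "p x = y" using E1p[OF y(1)] by (simp add: x_def)
    have py: "p y = x" using tot_qp[OF y(2)] by (simp add: q2 x_def)
    have xT: "x \<in> T (Suc (2 * n))" using y(1) by (simp add: E1_def x_def)
    have "\<pi> y \<in> Y"
    proof -
      have "y \<in> (\<Union>k. B k) - Y" using y(2) Tinf by blast
      then show ?thesis using \<pi>_B pow_B by fastforce
    qed
    have "(p ^^ k) y \<in> {x, y}" for k
    proof (induction k)
      case (Suc k)
      then show ?case by (cases "(p ^^ k) y = x") (simp_all add: px py)
    qed simp
    then have "\<pi> y \<in> {x, y}" unfolding \<pi>_def by blast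
    then have "x \<in> Y \<or> y \<in> Y" using \<open>\<pi> y \<in> Y\<close> by auto
    moreover have "x \<in> (\<Union>n. T n)" "y \<in> (\<Union>n. T n)" using xT y(2) by blast+
    ultimately show False unfolding Tinf by blast
  qed
  have E1_meas: "emeasure M (E1 n) = emeasure M (T (Suc (2 * n)))" for n
  proof -
    have "tot (e n) ` E1 n = T (Suc (2 * n))"
    proof
      show "tot (e n) ` E1 n \<subseteq> T (Suc (2 * n))" by (auto simp: E1_def)
      show "T (Suc (2 * n)) \<subseteq> tot (e n) ` E1 n"
      proof
        fix x assume x: "x \<in> T (Suc (2 * n))"
        then have "pinv (e n) x = Some (p x)" using p_T[OF x] by (simp add: q2)
        then have "e n (p x) = Some x" by (simp add: pinv_iff[OF inj])
        then have "p x \<in> E1 n" "tot (e n) (p x) = x" using x by (auto simp: E1_def tot_Some)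
        then show "x \<in> tot (e n) ` E1 n" by force
      qed
    qed
    moreover have "E1 n \<subseteq> dom (e n)" by (auto simp: E1_def)
    ultimately show ?thesis using piso_image_measure[OF pe E1m, of n n] by simp
  qed
  \<comment> \<open>What is left of \<open>e n\<close> without its parent edges in either direction.
    A parent edge also produced by another map is taken out only of the chosen one.\<close>
  define D where "D n = dom (e n) - (T (2 * n) \<union> E1 n)" for n
  have Dm: "D n \<in> sets M" for n
    unfolding D_def by (intro sets.Diff sets.Un piso_dom[OF pe] Tm E1m)
  have split_dom: "emeasure M (dom (e n)) = emeasure M (D n) + emeasure M (T (2 * n) \<union> T (Suc (2 * n)))" for n
  proof -
    have "E1 n \<subseteq> dom (e n)" by (auto simp: E1_def)
    then have "dom (e n) = D n \<union> (T (2 * n) \<union> E1 n)" using T2[of n] by (auto simp: D_def)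
    moreover have "emeasure M (D n \<union> (T (2 * n) \<union> E1 n)) = emeasure M (D n) + emeasure M (T (2 * n) \<union> E1 n)"
      by (rule plus_emeasure[symmetric, OF Dm sets.Un[OF Tm E1m]]) (auto simp: D_def)
    moreover have "emeasure M (T (2 * n) \<union> E1 n) = emeasure M (T (2 * n)) + emeasure M (E1 n)"
      by (rule plus_emeasure[symmetric, OF Tm E1m]) (use E1_T in blast)
    moreover have "T (2 * n) \<inter> T (Suc (2 * n)) = {}" using T_disj[of _ "2 * n" "Suc (2 * n)"] by auto
    then have "emeasure M (T (2 * n) \<union> T (Suc (2 * n))) = emeasure M (T (2 * n)) + emeasure M (T (Suc (2 * n)))"
      by (rule plus_emeasure[symmetric, OF Tm Tm])
    ultimately show ?thesis by (simp add: E1_meas)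
  qed
  \<comment> \<open>By ergodicity almost every point has a path to \<open>Y\<close>, so the disjoint
    sets \<open>T n\<close> fill the complement of \<open>Y\<close> up to a null set.\<close>
  have removed: "(\<Sum>n. emeasure M (T (2 * n) \<union> T (Suc (2 * n)))) = 1 - emeasure M Y"
  proof -
    have "disjoint_family (\<lambda>n. T (2 * n) \<union> T (Suc (2 * n)))"
    proof (unfold disjoint_family_on_def, intro ballI impI equals0I)
      fix m n :: nat and x
      assume mn: "m \<noteq> n" and x: "x \<in> (T (2 * m) \<union> T (Suc (2 * m))) \<inter> (T (2 * n) \<union> T (Suc (2 * n)))"
      obtain m' n' :: nat where "x \<in> T m'" "x \<in> T n'" "m' div 2 = m" "n' div 2 = n"
        using x by (elim IntE UnE) fastforce+
      then show False using T_disj mn by blast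
    qed
    then have "(\<Sum>n. emeasure M (T (2 * n) \<union> T (Suc (2 * n)))) = emeasure M (\<Union>n. T (2 * n) \<union> T (Suc (2 * n)))"
      using Tm by (intro suminf_emeasure) auto
    also have "(\<Union>n. T (2 * n) \<union> T (Suc (2 * n))) = (\<Union>n. T n)"
    proof
      show "(\<Union>n. T n) \<subseteq> (\<Union>n. T (2 * n) \<union> T (Suc (2 * n)))"
      proof
        fix x assume "x \<in> (\<Union>n. T n)"
        then obtain n where n: "x \<in> T n" by blast
        have "n = 2 * (n div 2) \<or> n = Suc (2 * (n div 2))" by linarith
        then have "x \<in> T (2 * (n div 2)) \<union> T (Suc (2 * (n div 2)))" using n by (metis UnCI)
        then show "x \<in> (\<Union>n. T (2 * n) \<union> T (Suc (2 * n)))" by blast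
      qed
    qed blast
    also have "emeasure M (\<Union>n. T n) = emeasure M (\<Union>k. B k) - emeasure M Y"
      unfolding Tinf
    proof (rule emeasure_Diff)
      show "emeasure M Y \<noteq> \<infinity>" by simp
      show "(\<Union>k. B k) \<in> sets M" using Bm by blast
      show "Y \<subseteq> (\<Union>k. B k)" using B0 by blast
    qed (rule Y)
    also have "emeasure M (\<Union>k. B k) = 1"
    proof -
      have reach: "x \<in> (\<Union>k. B k)" if "(x, y) \<in> (sym_graph e)\<^sup>*" "y \<in> Y" for x y
        using that
      proof (induction rule: converse_rtrancl_induct)
        case base
        then show ?case using B0 by blast
      next
        case (step x z)
        then obtain k where k: "z \<in> B k" by blast
        obtain n where "q n x = Some z" using step.hyps(1) unfolding sg by (auto simp: graph_iff)
        then have "x \<in> B (Suc k)" using k unfolding BS by (auto simp: tot_Some)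
        then show ?case by blast
      qed
      have "AE x in M. x \<in> (\<Union>k. B k)"
        using ergodic_saturation[OF erg e Y]
      proof eventually_elim
        case (elim x)
        then obtain i y where "walk e i x = Some y" "y \<in> Y" by blast
        then show ?case using reach[OF walk_path[OF e]] by blast
      qed
      moreover have "(\<Union>k. B k) \<in> sets M" using Bm by blast
      ultimately show ?thesis by (rule emeasure_eq_1_AE[rotated])
    qed
    finally show ?thesis .
  qed

  \<comment> \<open>Carrying the surviving edges to the roots\<close>
  define col where "col n y = prod_encode (c y, c (tot (e n) y))" for n y
  have colm: "col n \<in> measurable M (count_space UNIV)" for n
  proof -
    have 1: "(\<lambda>y. c (tot (e n) y)) \<in> measurable M (count_space UNIV)"
      by (rule measurable_compose[OF piso_tot[OF pe] cm])
    have "(\<lambda>y. prod_encode (i, c (tot (e n) y))) \<in> measurable M (count_space UNIV)" for i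
      by (rule measurable_compose[OF 1]) simp
    from measurable_compose_countable[OF this cm] show ?thesis unfolding col_def[abs_def] .
  qed
  \<comment> \<open>A colour records the walks that take the two ends of the edge to their roots; on
    one colour both are fixed injective maps.\<close>
  define Dc where "Dc n i = D n \<inter> (col n -` {i} \<inter> space M)" for n i
  have Dcm: "Dc n i \<in> sets M" for n i
    unfolding Dc_def by (rule sets.Int[OF Dm measurable_sets[OF colm]]) simp
  have Dsp: "D n \<subseteq> space M" for n using sets.sets_into_space[OF Dm] .
  have Dc_sum: "(\<Sum>i. emeasure M (Dc n i)) = emeasure M (D n)" for n
  proof -
    have "(\<Sum>i. emeasure M (Dc n i)) = emeasure M (\<Union>i. Dc n i)"
      using Dcm by (intro suminf_emeasure) (auto simp: disjoint_family_on_def Dc_def)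
    moreover have "(\<Union>i. Dc n i) = D n" using Dsp[of n] by (auto simp: Dc_def)
    ultimately show ?thesis by simp
  qed
  \<comment> \<open>Back from the root along the first walk, across the edge, forward along the
    second walk. The domain has at most the measure of \<open>Dc n i\<close>, and these measures add
    up to that of \<open>D n\<close>.\<close>
  define \<Psi>' where "\<Psi>' n i = walk e (snd (prod_decode i)) \<circ>\<^sub>m
      (e n \<circ>\<^sub>m pinv (walk e (fst (prod_decode i)) |` Dc n i))" for n i
  have pwr: "walk e j |` Dc n i \<in> partial_isos M R" for j n i
    by (rule piso_restrict[OF walk_piso[OF e] Dcm])
  have p\<Psi>': "\<Psi>' n i \<in> partial_isos M R" for n i
    unfolding \<Psi>'_def by (intro piso_comp piso_pinv pwr pe walk_piso[OF e])
  have \<Psi>'_dom: "emeasure M (dom (\<Psi>' n i)) \<le> emeasure M (Dc n i)" for n i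
  proof -
    let ?w = "walk e (fst (prod_decode i)) |` Dc n i"
    have "dom (\<Psi>' n i) \<subseteq> dom (pinv ?w)"
      unfolding \<Psi>'_def by (auto simp: map_comp_def split: option.splits)
    then have "dom (\<Psi>' n i) \<subseteq> ran ?w" by (simp only: dom_pinv)
    then have "emeasure M (dom (\<Psi>' n i)) \<le> emeasure M (ran ?w)"
      by (rule emeasure_mono[OF _ piso_ran[OF pwr]])
    also have "\<dots> = emeasure M (dom ?w)" by (rule piso_ran_measure[OF pwr])
    also have "\<dots> \<le> emeasure M (Dc n i)" by (rule emeasure_mono[OF _ Dcm]) simp
    finally show ?thesis .
  qed
  have \<Psi>'_val: "\<Psi>' n (col n y) (\<pi> y) = Some (\<pi> (tot (e n) y))" if y: "y \<in> D n" for n y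
  proof -
    have ysp: "y \<in> space M" using y Dsp by blast
    have ey: "e n y = Some (tot (e n) y)" using y by (intro dom_tot) (simp add: D_def)
    then have "tot (e n) y \<in> space M" using measurable_space[OF piso_tot[OF pe] ysp] by blast
    then have 2: "walk e (c (tot (e n) y)) (tot (e n) y) = Some (\<pi> (tot (e n) y))" by (rule c)
    have "y \<in> Dc n (col n y)" using y ysp by (simp add: Dc_def)
    then have "(walk e (c y) |` Dc n (col n y)) y = Some (\<pi> y)"
      using c[OF ysp] by (simp add: restrict_map_def)
    then have "pinv (walk e (c y) |` Dc n (col n y)) (\<pi> y) = Some y"
      by (simp add: pinv_iff[OF piso_inj[OF pwr]])
    then show ?thesis using ey 2 by (simp add: \<Psi>'_def col_def map_comp_Some_iff)
  qed
  define \<Psi> where "\<Psi> m = \<Psi>' (fst (prod_decode m)) (snd (prod_decode m))" for m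
  show thesis
  proof (rule that[of \<Psi> \<pi>])
    show "\<Psi> n \<in> partial_isos M R" for n unfolding \<Psi>_def by (rule p\<Psi>')
    show "\<pi> y = y" if "y \<in> Y" for y by (rule \<pi>_Y[OF that])
    have edge: "(\<pi> y, \<pi> z) \<in> (sym_graph \<Psi>)\<^sup>* \<and> (\<pi> z, \<pi> y) \<in> (sym_graph \<Psi>)\<^sup>*" if yz: "e n y = Some z" for n y z
    proof -
      have z: "z = tot (e n) y" "y \<in> dom (e n)" using yz by (auto simp: tot_Some)
      consider "y \<in> T (2 * n)" | "y \<in> E1 n" | "y \<in> D n" using z(2) by (auto simp: D_def)
      then show ?thesis
      proof cases
        case 1
        then have "p y = z" using p_T[OF 1] yz by (simp add: q2)
        then have "\<pi> z = \<pi> y" using \<pi>_p[of y] by simp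
        then show ?thesis by simp
      next
        case 2
        then have "p z = y" using E1p[OF 2] z by simp
        then have "\<pi> z = \<pi> y" using \<pi>_p[of z] by simp
        then show ?thesis by simp
      next
        case 3
        have "\<Psi> (prod_encode (n, col n y)) (\<pi> y) = Some (\<pi> z)"
          using \<Psi>'_val[OF 3] z by (simp add: \<Psi>_def)
        then have "(\<pi> y, \<pi> z) \<in> sym_graph \<Psi>" "(\<pi> z, \<pi> y) \<in> sym_graph \<Psi>"
          by (auto simp: sym_graph_def graph_iff)
        then show ?thesis by auto
      qed
    qed
    show "(\<pi> y, \<pi> z) \<in> (sym_graph \<Psi>)\<^sup>*" if "(y, z) \<in> sym_graph e" for y z
    proof -
      have "\<exists>n. e n y = Some z \<or> e n z = Some y"
        using that by (auto simp: sym_graph_def graph_iff)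
      then show ?thesis using edge by blast
    qed
    have "(\<Sum>n. emeasure M (dom (\<Psi> n))) = (\<Sum>m. case prod_decode m of (n, i) \<Rightarrow> emeasure M (dom (\<Psi>' n i)))"
      by (simp add: \<Psi>_def split_beta)
    also have "\<dots> = (\<Sum>n. \<Sum>i. emeasure M (dom (\<Psi>' n i)))"
      by (rule suminf_ennreal_2dimen) simp
    also have "\<dots> \<le> (\<Sum>n. \<Sum>i. emeasure M (Dc n i))"
      by (intro suminf_le \<Psi>'_dom summableI)
    also have "\<dots> = (\<Sum>n. emeasure M (D n))" by (simp only: Dc_sum)
    finally have "(\<Sum>n. emeasure M (dom (\<Psi> n))) + (1 - emeasure M Y)
        \<le> (\<Sum>n. emeasure M (D n)) + (\<Sum>n. emeasure M (T (2 * n) \<union> T (Suc (2 * n))))"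
      unfolding removed by (rule add_right_mono)
    also have "\<dots> = (\<Sum>n. emeasure M (dom (e n)))"
      unfolding split_dom by (rule suminf_add) (rule summableI)+
    finally show "(\<Sum>n. emeasure M (dom (\<Psi> n))) + (1 - emeasure M Y) \<le> (\<Sum>n. emeasure M (dom (e n)))" .
  qed
qed

end

section \<open>Cost and isoperimetric constant\<close>

text \<open>Graphs may overlap here: several maps producing the same pair give a single edge, and
  the inequality goes in the direction needed.\<close>

lemma count_UN_graph_le:
  fixes k :: "nat \<Rightarrow> 'a \<rightharpoonup> 'a"
  shows "count {z. (y, z) \<in> (\<Union>n. Map.graph (k n))} \<le> (\<Sum>n. indicator (dom (k n)) y)"
proof -
  have "count (\<Union>n. {z. k n y = Some z}) \<le> (\<Sum>n. count {z. k n y = Some z})"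
    by (intro emeasure_subadditive_countably) auto
  moreover have "{z. (y, z) \<in> (\<Union>n. Map.graph (k n))} = (\<Union>n. {z. k n y = Some z})"
    by (auto simp: graph_iff)
  ultimately show ?thesis by (simp add: count_dom)
qed

context pmp_rel
begin

text \<open>\<open>s\<close> is the cost of the contracted maps alone. The transports help to
  generate but do not cross the boundary, so the isoperimetric ratio sees only \<open>s\<close>; the
  second bound records the measure of the contracted forest.\<close>

lemma isoperimetric_constant_le:
  assumes erg: "ergodic_rel M R" and e: "gen_seq e" and atomless: "atomless M" and N: "N > 0"
  obtains s where "isoperimetric_constant M R \<le> 2 * s"
    "s + ennreal (1 - 1 / real N) \<le> (\<Sum>n. emeasure M (dom (e n)))"
proof -
  obtain \<theta> Y where \<theta>: "\<And>i::nat. \<theta> i \<in> partial_isos M R" "\<And>i. i < N \<Longrightarrow> dom (\<theta> i) = Y"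
    "\<And>i j. i < N \<Longrightarrow> j < N \<Longrightarrow> i \<noteq> j \<Longrightarrow> ran (\<theta> i) \<inter> ran (\<theta> j) = {}"
    and \<theta>0: "\<And>y. y \<in> Y \<Longrightarrow> \<theta> 0 y = Some y" and Y: "Y \<in> sets M" "emeasure M Y = ennreal (1 / real N)"
    by (rule ergodic_rotations[OF erg e atomless N]) (rule that)
  have "emeasure M Y \<noteq> 0" using Y(2) N by simp
  then obtain \<pi> \<Psi> where \<Psi>: "\<And>n::nat. \<Psi> n \<in> partial_isos M R" and \<pi>Y: "\<And>y. y \<in> Y \<Longrightarrow> \<pi> y = y"
    and \<pi>_edge: "\<And>y z. (y, z) \<in> sym_graph e \<Longrightarrow> (\<pi> y, \<pi> z) \<in> (sym_graph \<Psi>)\<^sup>*"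
    and \<Psi>_cost: "(\<Sum>n. emeasure M (dom (\<Psi> n))) + (1 - emeasure M Y) \<le> (\<Sum>n. emeasure M (dom (e n)))"
    by (rule contraction[OF erg e Y(1)]) (rule that)
  define s where "s = (\<Sum>n. emeasure M (dom (\<Psi> n)))"
  define X' where "X' = (\<Union>i<N. ran (\<theta> i))"
  have X'm: "X' \<in> sets M" unfolding X'_def using piso_ran[OF \<theta>(1)] by auto
  have "emeasure M X' = (\<Sum>i<N. emeasure M (ran (\<theta> i)))"
    unfolding X'_def using piso_ran[OF \<theta>(1)] \<theta>(3)
    by (intro sum_emeasure[symmetric]) (auto simp: disjoint_family_on_def)
  also have "\<dots> = (\<Sum>i<N. ennreal (1 / real N))"
    by (intro sum.cong refl) (simp add: piso_ran_measure[OF \<theta>(1)] \<theta>(2) Y(2))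
  also have "\<dots> = ennreal (\<Sum>i<N. 1 / real N)" by (rule sum_ennreal) simp
  also have "\<dots> = 1" using N by simp
  finally have X'1: "emeasure M X' = 1" .
  then have X'AE: "AE x in M. x \<in> X'" by (intro AE_prob_1) (simp add: measure_def)
  have X'null: "space M - X' \<in> null_sets M"
  proof -
    have "emeasure M (space M - X') = 0"
      using emeasure_compl[OF X'm] X'1 by (simp add: emeasure_space_1)
    then show ?thesis using X'm by (auto simp: null_sets_def)
  qed
  have X'D: "\<exists>i y. i < N \<and> y \<in> Y \<and> x = tot (\<theta> i) y \<and> \<theta> i y = Some x" if "x \<in> X'" for x
  proof -
    from that obtain i y where i: "i < N" "\<theta> i y = Some x" by (auto simp: X'_def ran_def)
    then have "y \<in> Y" using \<theta>(2)[OF i(1)] by (metis domI)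
    then show ?thesis using i tot_Some[of "\<theta> i" y x] by blast
  qed
  have \<theta>S: "\<theta> i y = Some (tot (\<theta> i) y)" if "i < N" "y \<in> Y" for i y
    by (rule dom_tot) (use that \<theta>(2) in simp)
  have \<theta>_ne: "tot (\<theta> i) y \<noteq> tot (\<theta> i') y'" if "i < N" "i' < N" "i \<noteq> i'" "y \<in> Y" "y' \<in> Y" for i i' y y'
  proof -
    have "tot (\<theta> i) y \<in> ran (\<theta> i)" "tot (\<theta> i') y' \<in> ran (\<theta> i')"
      using \<theta>S[OF that(1,4)] \<theta>S[OF that(2,5)] by (auto intro: ranI)
    then show ?thesis using \<theta>(3)[OF that(1-3)] by auto
  qed
  define r where "r i j = (if i + j < N then i + j else i + j - N)" for i j :: nat
  have r: "r i j < N" if "i < N" "j < N" for i j using that by (auto simp: r_def)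
  have r_inj: "r i j \<noteq> r i j'" if "j < N" "j' < N" "j \<noteq> j'" "i < N" for i j j'
    using that by (auto simp: r_def)
  have r_surj: "\<exists>j<N. r i j = i'" if "i < N" "i' < N" for i i'
  proof
    show "(if i \<le> i' then i' - i else i' + N - i) < N \<and> r i (if i \<le> i' then i' - i else i' + N - i) = i'"
      using that by (auto simp: r_def)
  qed
  have "\<forall>j. \<exists>\<phi>. j < N \<longrightarrow> \<phi> \<in> full_group M R \<and>
      (\<forall>i<N. \<forall>y\<in>Y. \<phi> (tot (\<theta> i) y) = Some (tot (\<theta> (r i j)) y))"
  proof
    fix j
    show "\<exists>\<phi>. j < N \<longrightarrow> \<phi> \<in> full_group M R \<and>
      (\<forall>i<N. \<forall>y\<in>Y. \<phi> (tot (\<theta> i) y) = Some (tot (\<theta> (r i j)) y))"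
    proof (cases "j < N")
      case True
      then obtain \<phi> where "\<phi> \<in> full_group M R"
        "\<And>i y. i < N \<Longrightarrow> y \<in> Y \<Longrightarrow> \<phi> (tot (\<theta> i) y) = Some (tot (\<theta> (r i j)) y)"
        using rotation_full_group[of \<theta> N Y j, OF \<theta>(1) \<theta>(2) \<theta>(3)] unfolding r_def by blast
      then show ?thesis by blast
    qed simp
  qed
  then obtain a where "\<forall>j. j < N \<longrightarrow> a j \<in> full_group M R \<and>
      (\<forall>i<N. \<forall>y\<in>Y. a j (tot (\<theta> i) y) = Some (tot (\<theta> (r i j)) y))" by (rule choice[THEN exE])
  then have a: "\<And>j. j < N \<Longrightarrow> a j \<in> full_group M R"
    and a_val: "\<And>j i y. j < N \<Longrightarrow> i < N \<Longrightarrow> y \<in> Y \<Longrightarrow> a j (tot (\<theta> i) y) = Some (tot (\<theta> (r i j)) y)"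
    by simp_all
  have a_ne: "a j x \<noteq> a j' x" if x: "x \<in> X'" and j: "j < N" "j' < N" "j \<noteq> j'" for j j' x
  proof -
    obtain i y where i: "i < N" "y \<in> Y" "x = tot (\<theta> i) y" using X'D[OF x] by blast
    have "tot (\<theta> (r i j)) y \<noteq> tot (\<theta> (r i j')) y"
      using \<theta>_ne[OF r[OF i(1) j(1)] r[OF i(1) j(2)] r_inj[OF j i(1)] i(2) i(2)] .
    then show ?thesis using a_val[OF j(1) i(1,2)] a_val[OF j(2) i(1,2)] i(3) by simp
  qed

  \<comment> \<open>The rotations as a set of symmetric vertices\<close>
  define A where "A = a ` {..<N}"
  have "X' \<noteq> {}" using X'1 by auto
  then obtain x0 where "x0 \<in> X'" by blast
  \<comment> \<open>The values at a single point of \<open>X'\<close> already tell all rotations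
    apart.\<close>
  then have "inj_on a {..<N}"
    using a_ne by (intro inj_onI) (metis lessThan_iff)
  then have cardA: "card A = N" by (simp add: A_def card_image)
  have "disjoint_vertices M R (a j) (a j')" if j: "j < N" "j' < N" "j \<noteq> j'" for j j'
  proof -
    have "AE x in M. count (Map.graph (a j) \<inter> Map.graph (a j') \<inter> fibre R x) = 0"
      using X'AE
    proof eventually_elim
      case (elim x)
      have "Map.graph (a j) \<inter> Map.graph (a j') \<inter> fibre R x = {}"
        using a_ne[OF elim j] by (auto simp: fibre_def graph_iff)
      then show ?case by simp
    qed
    then have "rel_measure M R (Map.graph (a j) \<inter> Map.graph (a j')) = (\<integral>\<^sup>+ x. 0 \<partial>M)"
      unfolding rel_measure_def by (rule nn_integral_cong_AE)
    then show ?thesis by (simp add: disjoint_vertices_def)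
  qed
  then have "pairwise (disjoint_vertices M R) A"
    unfolding pairwise_def A_def by blast
  then have AV: "A \<in> vertex_sets M R"
    using N a by (auto simp: vertex_sets_def A_def)

  \<comment> \<open>The system made of contracted maps and transports\<close>
  define c where "c n = (if even n then \<Psi> (n div 2)
      else if n div 2 < N then \<theta> (n div 2) else Map.empty)" for n
  have c\<Psi>: "c (2 * n) = \<Psi> n" and c\<theta>: "n < N \<Longrightarrow> c (Suc (2 * n)) = \<theta> n" for n
    by (simp_all add: c_def)
  have c_cases: "(\<exists>m. c n = \<Psi> m) \<or> (\<exists>i<N. c n = \<theta> i) \<or> c n = Map.empty" for n
    by (auto simp: c_def)
  have pc: "c n \<in> partial_isos M R" for n
    by (simp add: c_def \<Psi> \<theta>(1) piso_empty)
  have \<Psi>C: "sym_graph \<Psi> \<subseteq> sym_graph c"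
  proof
    fix p assume "p \<in> sym_graph \<Psi>"
    then obtain n where "p \<in> Map.graph (c (2 * n)) \<union> (Map.graph (c (2 * n)))\<inverse>"
      by (auto simp: sym_graph_def c\<Psi>)
    then show "p \<in> sym_graph c" unfolding sym_graph_def by blast
  qed
  have \<theta>C: "(y, tot (\<theta> i) y) \<in> sym_graph c" "(tot (\<theta> i) y, y) \<in> sym_graph c"
    if "i < N" "y \<in> Y" for i y
  proof -
    have "(y, tot (\<theta> i) y) \<in> Map.graph (c (Suc (2 * i)))"
      using \<theta>S[OF that] that by (simp add: c\<theta> graph_iff)
    then show "(y, tot (\<theta> i) y) \<in> sym_graph c" "(tot (\<theta> i) y, y) \<in> sym_graph c"
      unfolding sym_graph_def by blast+
  qed
  have \<pi>_path: "(\<pi> y, \<pi> z) \<in> (sym_graph \<Psi>)\<^sup>*" if "(y, z) \<in> (sym_graph e)\<^sup>*" for y z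
    using that
  proof (induction rule: rtrancl_induct)
    case (step w z)
    then show ?case using \<pi>_edge[OF step.hyps(2)] by (simp add: rtrancl_trans)
  qed simp
  obtain X0 where X0: "X0 \<in> sets M" "space M - X0 \<in> null_sets M" "X0 \<inter> (space M - X') = {}"
    "\<And>x y. x \<in> X0 \<Longrightarrow> (x, y) \<in> R \<Longrightarrow> y \<in> X0"
    "\<And>x y. x \<in> X0 \<Longrightarrow> (x, y) \<in> R \<Longrightarrow> (x, y) \<in> (sym_graph e)\<^sup>*"
    by (rule conull_invariant[OF e X'null]) (rule that)
  have X0X': "x \<in> X'" if "x \<in> X0" for x using that X0(3) sets.sets_into_space[OF X0(1)] by blast
  have gc: "gen_seq c"
    unfolding gen_seq_def
  proof
    have "AE x in M. x \<notin> space M - X0" using X0(2) by (rule AE_not_in)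
    then show "AE x in M. \<forall>y. (x, y) \<in> R \<longrightarrow> (x, y) \<in> (sym_graph c)\<^sup>*"
      using AE_space
    proof eventually_elim
      case (elim x)
      then have x: "x \<in> X0" by simp
      show ?case
      proof (intro allI impI)
        fix y assume xy: "(x, y) \<in> R"
        obtain i u where u: "i < N" "u \<in> Y" "x = tot (\<theta> i) u" "\<theta> i u = Some x"
          using X'D[OF X0X'[OF x]] by blast
        obtain j v where v: "j < N" "v \<in> Y" "y = tot (\<theta> j) v" "\<theta> j v = Some y"
          using X'D[OF X0X'[OF X0(4)[OF x xy]]] by blast
        have xu: "(x, u) \<in> R" and yv: "(y, v) \<in> R"
          using R_sym[OF pisoD(2)[OF \<theta>(1) u(4)]] R_sym[OF pisoD(2)[OF \<theta>(1) v(4)]] .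
        have "(u, v) \<in> R" using R_trans[OF R_sym[OF xu] R_trans[OF xy yv]] .
        then have "(u, v) \<in> (sym_graph e)\<^sup>*" using X0(5)[OF X0(4)[OF x xu]] by blast
        \<comment> \<open>\<open>u\<close> and \<open>v\<close> lie in \<open>Y\<close>, where
          \<open>\<pi>\<close> is the identity, so an \<open>e\<close>-path between them projects to
          a \<open>\<Psi>\<close>-path between the same points.\<close>
        then have "(u, v) \<in> (sym_graph \<Psi>)\<^sup>*" using \<pi>_path[of u v] \<pi>Y u(2) v(2) by simp
        then have uv: "(u, v) \<in> (sym_graph c)\<^sup>*" using rtrancl_mono[OF \<Psi>C] by blast
        have "(x, u) \<in> sym_graph c" "(v, y) \<in> sym_graph c"
          using \<theta>C[OF u(1,2)] \<theta>C[OF v(1,2)] u(3) v(3) by simp_all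
        then show "(x, y) \<in> (sym_graph c)\<^sup>*"
          using uv by (meson converse_rtrancl_into_rtrancl rtrancl.rtrancl_into_rtrancl)
      qed
    qed
  qed (use pc in blast)

  \<comment> \<open>Estimate of the boundary\<close>
  define G where "G = (\<Union>n. Map.graph (\<Psi> n))"
  define deg where "deg y = (\<Sum>n. indicator (dom (\<Psi> n)) y) + (\<Sum>n. indicator (ran (\<Psi> n)) y :: ennreal)" for y
  have dm: "(\<lambda>y. indicator (dom (\<Psi> n)) y :: ennreal) \<in> borel_measurable M"
    and rm: "(\<lambda>y. indicator (ran (\<Psi> n)) y :: ennreal) \<in> borel_measurable M" for n
    using piso_dom[OF \<Psi>] piso_ran[OF \<Psi>] by (auto intro: borel_measurable_indicator)
  have degm: "deg \<in> borel_measurable M"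
    unfolding deg_def[abs_def]
    by (intro borel_measurable_add borel_measurable_suminf_order dm rm)
  have "(\<integral>\<^sup>+ y. deg y \<partial>M) = (\<Sum>n. emeasure M (dom (\<Psi> n))) + (\<Sum>n. emeasure M (ran (\<Psi> n)))"
    unfolding deg_def
    by (simp add: nn_integral_add nn_integral_suminf dm rm borel_measurable_suminf_order
        nn_integral_indicator piso_dom[OF \<Psi>] piso_ran[OF \<Psi>])
  then have degint: "(\<integral>\<^sup>+ y. deg y \<partial>M) = 2 * s"
    by (simp add: piso_ran_measure[OF \<Psi>] mult_2 s_def)
  have pw: "count (edge_boundary (cayley_edges R (range c) x) (\<Union>\<phi>\<in>A. fibre (Map.graph \<phi>) x))
      \<le> (\<Sum>\<phi>\<in>A. deg (tot \<phi> x))" if x: "x \<in> X'" for x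
  proof -
    have xsp: "x \<in> space M" using x sets.sets_into_space[OF X'm] by blast
    obtain i y where i: "i < N" "y \<in> Y" "x = tot (\<theta> i) y" using X'D[OF x] by blast
    define V where "V = (\<lambda>\<phi>. tot \<phi> x) ` A"
    have "tot (a j) x = tot (\<theta> (r i j)) y" if "j < N" for j
      using a_val[OF that i(1,2)] i(3) by (simp add: tot_Some)
    then have "V = (\<lambda>j. tot (\<theta> (r i j)) y) ` {..<N}"
      unfolding V_def A_def image_image by (intro image_cong) auto
    \<comment> \<open>Whichever piece contains \<open>x\<close>, the rotations carry it through all
      \<open>N\<close> pieces over the same base point \<open>y\<close>.\<close>
    also have "\<dots> = (\<lambda>i'. tot (\<theta> i') y) ` {..<N}"
    proof
      show "(\<lambda>j. tot (\<theta> (r i j)) y) ` {..<N} \<subseteq> (\<lambda>i'. tot (\<theta> i') y) ` {..<N}"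
        using r[OF i(1)] by auto
      show "(\<lambda>i'. tot (\<theta> i') y) ` {..<N} \<subseteq> (\<lambda>j. tot (\<theta> (r i j)) y) ` {..<N}"
      proof
        fix z assume "z \<in> (\<lambda>i'. tot (\<theta> i') y) ` {..<N}"
        then obtain i' where i': "i' < N" "z = tot (\<theta> i') y" by auto
        obtain j where "j < N" "r i j = i'" using r_surj[OF i(1) i'(1)] by blast
        then show "z \<in> (\<lambda>j. tot (\<theta> (r i j)) y) ` {..<N}" using i'(2) by auto
      qed
    qed
    finally have V: "V = (\<lambda>i'. tot (\<theta> i') y) ` {..<N}" .
    have finV: "finite V" by (simp add: V)
    have "fibre (Map.graph \<phi>) x = {(x, tot \<phi> x)}" if "\<phi> \<in> A" for \<phi>
    proof -
      have "\<phi> \<in> full_group M R" using that a by (auto simp: A_def)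
      then have "\<phi> x = Some (tot \<phi> x)" using full_group_tot(2) xsp by blast
      then show ?thesis by (auto simp: fibre_def graph_iff)
    qed
    then have fib: "(\<Union>\<phi>\<in>A. fibre (Map.graph \<phi>) x) = {x} \<times> V"
      by (auto simp: V_def)
    have tot0: "tot (\<theta> 0) w = w" if "w \<in> Y" for w using \<theta>0[OF that] by (rule tot_Some)
    \<comment> \<open>\<open>Y\<close> is the piece of index 0 and the pieces are disjoint, so
      \<open>V\<close> meets \<open>Y\<close> only in the base point.\<close>
    have VY: "u = y" if "u \<in> V" "u \<in> Y" for u
    proof -
      from that(1) obtain i' where i': "i' < N" "u = tot (\<theta> i') y" unfolding V by auto
      have "i' = 0"
        using \<theta>_ne[OF i'(1) N _ i(2) that(2)] i'(2) tot0[OF that(2)] by auto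
      then show ?thesis using i'(2) tot0[OF i(2)] by simp
    qed
    have yV: "tot (\<theta> i') y \<in> V" if "i' < N" for i' using that by (auto simp: V)
    \<comment> \<open>\<open>V\<close> consists of all images of one base point, so an edge of a
      transport has both ends in \<open>V\<close> or none.\<close>
    have \<theta>V: "u \<in> V \<longleftrightarrow> v \<in> V" if uv: "\<theta> l u = Some v" and l: "l < N" for l u v
    proof -
      have u: "u \<in> Y" using domI[of "\<theta> l" u v] uv \<theta>(2)[OF l] by simp
      have v: "v = tot (\<theta> l) u" using tot_Some[of "\<theta> l" u v] uv by simp
      show ?thesis
      proof
        assume "u \<in> V"
        then have "u = y" using u by (rule VY)
        then show "v \<in> V" using yV[OF l] v by simp
      next
        assume "v \<in> V"
        then obtain i' where i': "i' < N" "v = tot (\<theta> i') y" unfolding V by auto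
        have "i' = l" using \<theta>_ne[OF i'(1) l _ i(2) u] i'(2) v by auto
        then have "\<theta> l y = Some v" using \<theta>S[OF i'(1) i(2)] i'(2) by simp
        then have "u = y" using uv piso_inj[OF \<theta>(1), of l] unfolding pinj_def by blast
        then show "u \<in> V" using yV[OF N] tot0[OF i(2)] by simp
      qed
    qed
    let ?B = "edge_boundary (cayley_edges R (range c) x) ({x} \<times> V)"
    define g where "g p = ((x, fst p), (x, snd p))" for p :: "'a \<times> 'a"
    \<comment> \<open>Only pairs from \<open>\<Psi>\<close> remain. Each has an end in
      \<open>V\<close> and is counted in the degree of that end, as a source or as a target.\<close>
    have "?B \<subseteq> g ` {p \<in> G. fst p \<in> V \<or> snd p \<in> V}"
    proof
      fix q assume q: "q \<in> ?B"
      then have "q \<in> cayley_edges R (range c) x" by (simp add: edge_boundary_def)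
      then obtain u v n where uv: "q = ((x, u), (x, v))" "c n u = Some v"
        unfolding cayley_edges_def by (auto simp: graph_iff)
      have bd: "(u \<in> V) \<noteq> (v \<in> V)" using q by (auto simp: edge_boundary_def uv(1))
      consider m where "c n = \<Psi> m" | l where "l < N" "c n = \<theta> l" | "c n = Map.empty"
        using c_cases[of n] by blast
      then show "q \<in> g ` {p \<in> G. fst p \<in> V \<or> snd p \<in> V}"
      proof cases
        case (1 m)
        then have "(u, v) \<in> G" using uv(2) by (auto simp: G_def graph_iff)
        then have "(u, v) \<in> {p \<in> G. fst p \<in> V \<or> snd p \<in> V}" using bd by auto
        moreover have "q = g (u, v)" by (simp add: g_def uv(1))
        ultimately show ?thesis by blast
      next
        case (2 l)
        then show ?thesis using \<theta>V[of l u v] uv(2) bd by simp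
      qed (use uv(2) in simp)
    qed
    then have "count ?B \<le> count (g ` {p \<in> G. fst p \<in> V \<or> snd p \<in> V})" by (rule count_mono)
    also have "\<dots> = count {p \<in> G. fst p \<in> V \<or> snd p \<in> V}"
      by (rule count_image) (auto simp: inj_on_def g_def prod_eq_iff)
    also have "\<dots> \<le> count ({p \<in> G. fst p \<in> V} \<union> prod.swap ` {p \<in> G\<inverse>. fst p \<in> V})"
    proof (rule count_mono, rule subsetI)
      fix p assume p: "p \<in> {p \<in> G. fst p \<in> V \<or> snd p \<in> V}"
      then show "p \<in> {p \<in> G. fst p \<in> V} \<union> prod.swap ` {p \<in> G\<inverse>. fst p \<in> V}"
        by (cases p) (auto simp: image_iff)
    qed
    also have "\<dots> \<le> count {p \<in> G. fst p \<in> V} + count (prod.swap ` {p \<in> G\<inverse>. fst p \<in> V})"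
      by (rule count_Un)
    also have "count (prod.swap ` {p \<in> G\<inverse>. fst p \<in> V}) = count {p \<in> G\<inverse>. fst p \<in> V}"
      by (rule count_image) (auto simp: inj_on_def)
    also have "count {p \<in> G. fst p \<in> V} + count {p \<in> G\<inverse>. fst p \<in> V}
        = (\<Sum>y\<in>V. count {z. (y, z) \<in> G} + count {z. (y, z) \<in> G\<inverse>})"
      unfolding sum.distrib by (simp only: sum_degree[OF finV])
    also have "\<dots> \<le> (\<Sum>y\<in>V. deg y)"
    proof (rule sum_mono)
      fix w
      have "count {z. (w, z) \<in> G} \<le> (\<Sum>n. indicator (dom (\<Psi> n)) w)"
        unfolding G_def by (rule count_UN_graph_le)
      moreover have "count {z. (w, z) \<in> G\<inverse>} \<le> (\<Sum>n. indicator (ran (\<Psi> n)) w)"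
      proof -
        have "G\<inverse> = (\<Union>n. Map.graph (pinv (\<Psi> n)))"
          unfolding G_def graph_pinv[OF piso_inj[OF \<Psi>]] by auto
        then show ?thesis using count_UN_graph_le[of w "\<lambda>n. pinv (\<Psi> n)"] by (simp only: dom_pinv)
      qed
      ultimately show "count {z. (w, z) \<in> G} + count {z. (w, z) \<in> G\<inverse>} \<le> deg w"
        unfolding deg_def by (rule add_mono)
    qed
    also have "\<dots> \<le> (\<Sum>\<phi>\<in>A. deg (tot \<phi> x))"
      unfolding V_def by (rule sum_image_le[unfolded comp_def]) (simp_all add: A_def)
    finally show ?thesis by (simp only: fib)
  qed
  have AG: "\<phi> \<in> full_group M R" if "\<phi> \<in> A" for \<phi> using that a by (auto simp: A_def)
  have Dm: "(\<lambda>x. deg (tot \<phi> x)) \<in> borel_measurable M" if "\<phi> \<in> A" for \<phi>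
    by (rule measurable_compose[OF piso_tot[OF full_group_tot(1)[OF AG[OF that]]] degm])
  have "boundary_measure M R (range c) A \<le> (\<integral>\<^sup>+ x. (\<Sum>\<phi>\<in>A. deg (tot \<phi> x)) \<partial>M)"
    unfolding boundary_measure_def
  proof (rule nn_integral_mono_AE)
    show "AE x in M. count (edge_boundary (cayley_edges R (range c) x) (\<Union>\<phi>\<in>A. fibre (Map.graph \<phi>) x))
      \<le> (\<Sum>\<phi>\<in>A. deg (tot \<phi> x))"
      using X'AE by eventually_elim (rule pw)
  qed
  also have "\<dots> = (\<Sum>\<phi>\<in>A. \<integral>\<^sup>+ x. deg (tot \<phi> x) \<partial>M)" by (rule nn_integral_sum) (rule Dm)
  also have "\<dots> = of_nat N * (2 * s)"
    using full_group_nn_integral[OF AG degm] by (simp add: degint cardA)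
  finally have bound: "boundary_measure M R (range c) A \<le> of_nat N * (2 * s)" .
  have "isoperimetric_constant M R \<le> graph_isoperimetric M R (range c)"
    unfolding isoperimetric_constant_def
    by (rule INF_lower) (simp add: gen_seq_generating[OF gc])
  also have "\<dots> \<le> boundary_measure M R (range c) A / of_nat (card A)"
    unfolding graph_isoperimetric_def by (rule INF_lower[OF AV])
  also have "\<dots> \<le> of_nat N * (2 * s) / of_nat N"
    unfolding cardA by (rule divide_right_mono_ennreal[OF bound])
  also have "\<dots> = 2 * s"
    using N ennreal_mult_divide_eq[of "of_nat N" "2 * s"] by (simp add: mult.commute)
  finally have 1: "isoperimetric_constant M R \<le> 2 * s" .
  have "1 - emeasure M Y = ennreal (1 - 1 / real N)"
    unfolding Y(2) using N by (simp add: ennreal_minus flip: ennreal_1)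
  then have "s + ennreal (1 - 1 / real N) \<le> (\<Sum>n. emeasure M (dom (e n)))"
    using \<Psi>_cost by (simp add: s_def)
  with 1 show thesis by (rule that)
qed

end

theorem mainTheorem1:
  fixes M :: "'a measure" and R :: "('a \<times> 'a) set"
  assumes "prob_space M" and "standard_borel M" and "atomless M"
    and "ergodic_II1_rel M R"
    and "cost M R < \<infinity>"
  shows "cost M R = 1 + 1 / 2 * isoperimetric_constant M R"
proof (rule antisym)
  obtain f :: "'a \<Rightarrow> real" where f: "f \<in> borel_measurable M" "inj_on f (space M)"
    using assms(2) by (rule standard_borel_real_injection)
  interpret prob_space M by (rule assms(1))
  interpret pmp_rel M R f
    by unfold_locales (use f assms(4) in \<open>auto simp: ergodic_II1_rel_def\<close>)
  have erg: "ergodic_rel M R" using assms(4) by (simp add: ergodic_II1_rel_def)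
  \<comment> \<open>A real value allows the subtraction in 2 C - 2; its image under
    \<open>ennreal\<close> is 0 when C is below 1.\<close>
  define C where "C = enn2real (cost M R)"
  have C: "cost M R = ennreal C" "0 \<le> C" using assms(5) by (simp_all add: C_def)
  have "ennreal (2 * C - 2) \<le> isoperimetric_constant M R"
    unfolding isoperimetric_constant_def graph_isoperimetric_def
  proof (intro INF_greatest)
    fix \<Phi> A assume "\<Phi> \<in> {\<Phi>. generating_system M R \<Phi>}" and A: "A \<in> vertex_sets M R"
    then have "generating_system M R \<Phi>" by simp
    then obtain e where e: "gen_seq e" "(\<Union>n. Map.graph (e n)) = (\<Union>\<phi>\<in>\<Phi>. Map.graph \<phi>)"
      by (rule generating_seq) (rule that)
    define n where "n = card A"
    have n: "n > 0" using A by (auto simp: n_def vertex_sets_def card_gt_0_iff)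
    have le: "of_nat n * (2 * ennreal C) \<le> 2 * of_nat n + boundary_measure M R \<Phi> A"
      using cost_le_boundary[OF e A] by (simp add: n_def C)
    show "ennreal (2 * C - 2) \<le> boundary_measure M R \<Phi> A / of_nat (card A)"
    proof (cases "boundary_measure M R \<Phi> A")
      case (real b)
      have "ennreal (real n * (2 * C)) \<le> ennreal (2 * real n + b)"
        using le real C(2) by (simp add: ennreal_mult ennreal_plus ennreal_of_nat_eq_real_of_nat)
      then have "real n * (2 * C) \<le> 2 * real n + b"
        using real by (subst (asm) ennreal_le_iff) simp_all
      then have "2 * C - 2 \<le> b / real n"
        using n by (simp add: field_simps)
      then have "ennreal (2 * C - 2) \<le> ennreal (b / real n)" by (rule ennreal_leI)
      also have "\<dots> = ennreal b / of_nat n"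
        using n real by (simp add: divide_ennreal ennreal_of_nat_eq_real_of_nat)
      finally show ?thesis using real by (simp add: n_def)
    next
      case top
      then show ?thesis using n by (simp add: ennreal_top_divide n_def)
    qed
  qed
  then have "1 / 2 * ennreal (2 * C - 2) \<le> 1 / 2 * isoperimetric_constant M R"
    by (rule mult_left_mono) simp
  moreover have "1 / 2 * ennreal (2 * C - 2) = ennreal (C - 1)"
  proof -
    have "ennreal 1 / ennreal 2 = ennreal (1 / 2)" by (rule divide_ennreal) simp_all
    then have "(1 / 2 :: ennreal) = ennreal (1 / 2)" unfolding ennreal_1 ennreal_numeral .
    moreover have "ennreal (1 / 2) * ennreal (2 * C - 2) = ennreal (1 / 2 * (2 * C - 2))"
      by (rule ennreal_mult'[symmetric]) simp
    moreover have "1 / 2 * (2 * C - 2) = C - 1" by (simp add: field_simps)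
    ultimately show ?thesis by (simp only:)
  qed
  moreover have "cost M R \<le> 1 + ennreal (C - 1)"
  proof -
    \<comment> \<open>For C below 1 the term \<open>ennreal (C - 1)\<close> vanishes and the summand
      1 alone is large enough.\<close>
    have "ennreal C \<le> ennreal (1 + max 0 (C - 1))" by (rule ennreal_leI) simp
    also have "\<dots> = 1 + ennreal (max 0 (C - 1))" by (simp add: ennreal_plus)
    also have "ennreal (max 0 (C - 1)) = ennreal (C - 1)" by (simp add: max_def ennreal_neg)
    finally show ?thesis by (simp add: C)
  qed
  ultimately show "cost M R \<le> 1 + 1 / 2 * isoperimetric_constant M R"
    by (metis add_left_mono order.trans)
  show "1 + 1 / 2 * isoperimetric_constant M R \<le> cost M R"
    unfolding cost_def
  proof (rule INF_greatest)
    fix \<Phi> assume "\<Phi> \<in> {\<Phi>. generating_system M R \<Phi>}"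
    then have "generating_system M R \<Phi>" by simp
    then obtain e where e: "gen_seq e" and c: "(\<Sum>n. emeasure M (dom (e n))) = system_cost M \<Phi>"
      by (rule generating_seq) (rule that)
    \<comment> \<open>The number of pieces is \<open>Suc n\<close>. The generating system stays
      fixed while n grows, and the term 1 / N disappears in the limit.\<close>
    have bound: "1 / 2 * isoperimetric_constant M R + ennreal (1 - 1 / real (Suc n)) \<le> system_cost M \<Phi>" for n
    proof -
      obtain s where s: "isoperimetric_constant M R \<le> 2 * s"
        "s + ennreal (1 - 1 / real (Suc n)) \<le> system_cost M \<Phi>"
        by (rule isoperimetric_constant_le[OF erg e assms(3), of "Suc n", unfolded c]) (simp, rule that)
      have "1 / 2 * isoperimetric_constant M R \<le> 1 / 2 * (2 * s)"
        by (rule mult_left_mono[OF s(1)]) simp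
      also have "\<dots> = s"
      proof -
        have "(2 :: ennreal) / 2 = 1" by (rule ennreal_divide_self) simp_all
        then show ?thesis by (simp only: mult.assoc[symmetric] ennreal_divide_times mult_1_left)
      qed
      finally show ?thesis using s(2) by (meson add_right_mono order.trans)
    qed
    have "(\<lambda>n. 1 / 2 * isoperimetric_constant M R + ennreal (1 - 1 / real (Suc n)))
        \<longlonglongrightarrow> 1 / 2 * isoperimetric_constant M R + ennreal (1 - 0)"
      by (intro tendsto_add tendsto_const tendsto_ennrealI tendsto_diff LIMSEQ_Suc lim_1_over_n)
    then have "1 / 2 * isoperimetric_constant M R + ennreal (1 - 0) \<le> system_cost M \<Phi>"
      by (rule LIMSEQ_le_const2) (use bound in blast)
    then show "1 + 1 / 2 * isoperimetric_constant M R \<le> system_cost M \<Phi>" by (simp add: add.commute)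
  qed
qed

end
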